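(* Let $g(x)=bx+\int_0^\infty(1-e^{-sx})\,\nu(ds)$, $b\ge0$, be a Bernstein function whose Lévy measure $\nu$ has tail $w(s)=\nu((s,\infty))$ that is absolutely continuous on $(0,\infty)$ with $w(0+)=+\infty$. Let $\mathcal E_g$ be the inverse of the subordinator with Laplace exponent $g$, and let $\overline W_t^g$ be the complex integral operator defined in the context. Let $f\in A(D^n)$, with expansion $f(z_1,\dots,z_n)=\sum_{k_1,\dots,k_n=0}^\infty a_{k_1,\dots,k_n}z_1^{k_1}\cdots z_n^{k_n}$ for $z_1,\dots,z_n\in D$. (i) For $z_1,\dots,z_n\in D$ and $t>0$, $$\overline W_t^gf(z_1,\dots,z_n)=\sum_{k_1,\dots,k_n=0}^\infty a_{k_1,\dots,k_n}z_1^{k_1}\cdots z_n^{k_n}\,d_{k_1,\dots,k_n}(t),\qquad d_{k_1,\dots,k_n}(t)=\mathbb E\Big[e^{-\frac{\mathcal E_g(t)}{2}\sum_{j=1}^nk_j^2}\Big].$$ Furthermore, for $\theta>0$, $$\int_0^\infty e^{-\theta t}\,\overline W_t^gf(z_1,\dots,z_n)\,dt=\sum_{k_1,\dots,k_n=0}^\infty a_{k_1,\dots,k_n}z_1^{k_1}\cdots z_n^{k_n}\,\tilde d_{k_1,\dots,k_n}(\theta),$$ $$\tilde d_{k_1,\dots,k_n}(\theta)=\frac{g(\theta)/\theta}{g(\theta)+(k_1^2+\cdots+k_n^2)/2}.$$ (ii) Let $t>0$, $f\in A(D^n)$ and $z_1,\dots,z_n\in\overline D$. The function $u(z_1,\dots,z_n,t)=\overline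 W_t^gf(z_1,\dots,z_n)$ is the unique solution (that belongs to $A(D)$ for each complex variable $z_k$) of the fractional Cauchy problem $$\mathfrak D_t^g\,u(z_1,\dots,z_n,t)=\frac12\left[\frac{\partial^2}{\partial\varphi_1^2}+\cdots+\frac{\partial^2}{\partial\varphi_n^2}\right]u(z_1,\dots,z_n,t),$$ for $z_1=r_1e^{i\varphi_1},\dots,z_n=r_ne^{i\varphi_n}\in D\setminus\{0\}$, with $u(z_1,\dots,z_n,0)=f(z_1,\dots,z_n)$, where $\varphi_k$ is the principal value of the argument of $z_k$.
   Context: $D=\{z\in\mathbb C:|z|<1\}$. $A(D)$ is the space of functions $\overline D\to\mathbb C$ that are analytic on $D$ and continuous on $\overline D$. For $n$ complex variables, $f\in A(D^n)$ means that $f(z_1,\dots,z_n)$, $z_1,\dots,z_n\in\overline D$, belongs to $A(D)$ for each complex variable $z_1,\dots,z_n$. A Lévy measure here is a non-negative measure $\nu$ on $(0,\infty)$ with $\int_0^\infty(z\wedge1)\,\nu(dz)<\infty$. $\mathcal H_g=\{\mathcal H_g(t)\}_{t\ge0}$ is the subordinator with drift $b$ and Lévy measure $\nu$, i.e. $\mathbb E e^{-\theta\mathcal H_g(t)}=e^{-tg(\theta)}$ for $\theta\ge0$. Its inverse is $\mathcal E_g(t)=\inf\{s>0:\mathcal H_g(s)>t\}$, and $m_g(s,t)$ denotes the density of $\mathcal E_g(t)$ in $s$. The generalized (regularized Caputo-type) derivative is $$\mathfrak D_t^gu(t):=\frac{d}{dt}\int_0^tw(t-s)\,(u(s)-u(0))\,ds,$$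 acting on the time variable. Let $B_1,\dots,B_n$ be independent standard real Brownian motions, independent of $\mathcal E_g$. For $z_1,\dots,z_n\in\overline D$ and $t>0$, $$\overline W_t^gf(z_1,\dots,z_n):=\frac{1}{(2\pi)^{n/2}}\int_{\mathbb R^n}f(z_1e^{-iu_1},\dots,z_ne^{-iu_n})\int_0^\infty\frac{e^{-\frac{u_1^2+\cdots+u_n^2}{2y}}}{y^{n/2}}\,m_g(y,t)\,dy\,du_1\cdots du_n$$ $$=\mathbb E f\big(z_1e^{-iB_1(\mathcal E_g(t))},\dots,z_ne^{-iB_n(\mathcal E_g(t))}\big),$$ and $\overline W_0^gf=f$.
   Formalization: In (ii): the derivative carries the drift term, d/dt[b(u(t)-u(0)) + ∫w(t-s)(u(s)-u(0))ds] (same for b=0; false otherwise if b>0); f is assumed bounded on the closed polydisc (else W may be undefined there); solutions are jointly continuous on D^n×[0,∞) (else not unique). *)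

theory Defs
  imports "HOL-Probability.Probability"
begin

definition levy_measure :: "real measure \<Rightarrow> bool" where
  "levy_measure \<nu> \<longleftrightarrow> sets \<nu> = sets borel \<and> emeasure \<nu> {..0} = 0 \<and>
     (\<integral>\<^sup>+ z. ennreal (min z 1) \<partial>\<nu>) < \<infinity>"

definition levy_tail :: "real measure \<Rightarrow> real \<Rightarrow> real" where
  "levy_tail \<nu> s = measure \<nu> {s<..}"

definition bernstein :: "real \<Rightarrow> real measure \<Rightarrow> real \<Rightarrow> real" where
  "bernstein b \<nu> x = b * x + (LINT s|\<nu>. 1 - exp (- (s * x)))"

definition abs_continuous_interval :: "(real \<Rightarrow> real) \<Rightarrow> real \<Rightarrow> real \<Rightarrow> bool" where
  "abs_continuous_interval f p q \<longleftrightarrow>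
     (\<forall>\<epsilon>>0. \<exists>\<delta>>0. \<forall>(N::nat) x y.
        (\<forall>i<N. p \<le> x i \<and> x i \<le> y i \<and> y i \<le> q) \<and>
        disjoint_family_on (\<lambda>i. {x i<..<y i}) {..<N} \<and>
        (\<Sum>i<N. y i - x i) < \<delta> \<longrightarrow> (\<Sum>i<N. \<bar>f (y i) - f (x i)\<bar>) < \<epsilon>)"

text \<open>On the open half-line absolute continuity is meant locally, on every compact
  subinterval: an absolutely continuous function on all of \<open>{0<..}\<close> would be bounded
  near 0, which is incompatible with a tail that tends to infinity there.\<close>

definition abs_continuous_pos :: "(real \<Rightarrow> real) \<Rightarrow> bool" where
  "abs_continuous_pos f \<longleftrightarrow> (\<forall>p q. 0 < p \<and> p \<le> q \<longrightarrow> abs_continuous_interval f p q)"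

text \<open>Processes are indexed by all reals; only the times \<open>t \<ge> 0\<close> matter. Left limits
  need not be required, since the paths are nondecreasing.\<close>

definition subordinator :: "'a measure \<Rightarrow> (real \<Rightarrow> 'a \<Rightarrow> real) \<Rightarrow> (real \<Rightarrow> real) \<Rightarrow> bool" where
  "subordinator M H g \<longleftrightarrow>
     prob_space M \<and>
     (\<forall>t\<ge>0. H t \<in> borel_measurable M) \<and>
     (AE \<omega> in M. H 0 \<omega> = 0 \<and> mono_on {0..} (\<lambda>t. H t \<omega>) \<and>
        (\<forall>t\<ge>0. continuous (at_right t) (\<lambda>s. H s \<omega>))) \<and>
     (\<forall>(N::nat) \<tau>. 0 \<le> \<tau> 0 \<and> mono \<tau> \<longrightarrow>
        prob_space.indep_vars M (\<lambda>_. borel) (\<lambda>i \<omega>. H (\<tau> (Suc i)) \<omega> - H (\<tau> i) \<omega>) {..<N}) \<and>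
     (\<forall>s t. 0 \<le> s \<and> s \<le> t \<longrightarrow>
        distr M borel (\<lambda>\<omega>. H t \<omega> - H s \<omega>) = distr M borel (H (t - s))) \<and>
     (\<forall>t\<ge>0. \<forall>\<theta>\<ge>0. (LINT \<omega>|M. exp (- (\<theta> * H t \<omega>))) = exp (- (t * g \<theta>)))"

definition inverse_subordinator :: "(real \<Rightarrow> 'a \<Rightarrow> real) \<Rightarrow> real \<Rightarrow> 'a \<Rightarrow> real" where
  "inverse_subordinator H t \<omega> = Inf {s. 0 < s \<and> t < H s \<omega>}"

definition disc_algebra :: "(complex \<Rightarrow> complex) set" where
  "disc_algebra = {f. f analytic_on ball 0 1 \<and> continuous_on (cball 0 1) f}"

definition polydisc :: "(complex ^ 'n) set" where
  "polydisc = {z. \<forall>j. z $ j \<in> ball 0 1}"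

definition closed_polydisc :: "(complex ^ 'n) set" where
  "closed_polydisc = {z. \<forall>j. z $ j \<in> cball 0 1}"

definition vec_upd :: "'b ^ 'n \<Rightarrow> 'n \<Rightarrow> 'b \<Rightarrow> 'b ^ 'n" where
  "vec_upd z j c = (\<chi> i. if i = j then c else z $ i)"

text \<open>Membership is required in each variable separately; joint continuity on the closed
  polydisc, or boundedness there, is not part of the definition.\<close>

definition polydisc_algebra :: "(complex ^ 'n \<Rightarrow> complex) set" where
  "polydisc_algebra =
     {f. \<forall>z\<in>closed_polydisc. \<forall>j. (\<lambda>c. f (vec_upd z j c)) \<in> disc_algebra}"

definition monomial :: "complex ^ 'n \<Rightarrow> ('n \<Rightarrow> nat) \<Rightarrow> complex" where
  "monomial z k = (\<Prod>j\<in>UNIV. (z $ j) ^ k j)"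

definition sum_squares :: "('n \<Rightarrow> nat) \<Rightarrow> real" where
  "sum_squares k = (\<Sum>j\<in>UNIV. (real (k j))\<^sup>2)"

text \<open>\<open>m y t\<close> is the density in \<open>y\<close> of the inverse subordinator at time \<open>t > 0\<close>.\<close>

definition W_op :: "(real \<Rightarrow> real \<Rightarrow> real) \<Rightarrow> real \<Rightarrow> (complex ^ 'n \<Rightarrow> complex) \<Rightarrow>
    complex ^ 'n \<Rightarrow> complex" where
  "W_op m t f z =
     (if t = 0 then f z
      else 1 / complex_of_real ((2 * pi) powr (real CARD('n) / 2)) *
        (LINT u|(lborel :: (real ^ 'n) measure).
           f (\<chi> j. z $ j * exp (- (\<i> * complex_of_real (u $ j)))) *
           complex_of_real (LBINT y:{0<..}.
             exp (- ((\<Sum>j\<in>UNIV. (u $ j)\<^sup>2) / (2 * y))) / y powr (real CARD('n) / 2) * m y t)))"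

text \<open>The generalized Caputo-type derivative attached to \<open>g = bernstein b \<nu>\<close> is the time
  derivative of \<open>b (u(t) - u(0)) + \<integral> w(t - s) (u(s) - u(0)) ds\<close>, with \<open>w\<close> the tail of
  \<open>\<nu>\<close>. For \<open>b = 0\<close> this is the usual convolution derivative with kernel \<open>w\<close>. The drift
  term is what gives the operator the symbol \<open>g\<close>: the Laplace transform of \<open>w\<close> is
  \<open>g(\<theta>)/\<theta> - b\<close>, so for \<open>b > 0\<close> the convolution alone would have the symbol
  \<open>g(\<theta>) - b \<theta>\<close>.\<close>

definition has_generalized_derivative ::
    "real \<Rightarrow> real measure \<Rightarrow> (real \<Rightarrow> complex) \<Rightarrow> complex \<Rightarrow> real \<Rightarrow> bool" where
  "has_generalized_derivative b \<nu> u d t \<longleftrightarrow>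
     ((\<lambda>\<tau>. b *\<^sub>R (u \<tau> - u 0) +
        (LBINT s:{0<..<\<tau>}. levy_tail \<nu> (\<tau> - s) *\<^sub>R (u s - u 0))) has_vector_derivative d) (at t)"

text \<open>Second derivative in the angle \<open>\<phi>\<^sub>j\<close>, where \<open>z\<^sub>j = r\<^sub>j e^(i \<phi>\<^sub>j)\<close>. At \<open>\<phi>\<^sub>j = pi\<close>
  it is the two-sided derivative of the periodic function of the angle.\<close>

definition angular_deriv2 :: "'n \<Rightarrow> (complex ^ 'n \<Rightarrow> complex) \<Rightarrow> complex ^ 'n \<Rightarrow> complex" where
  "angular_deriv2 j F z =
     vector_derivative
       (\<lambda>\<phi>. vector_derivative (\<lambda>\<psi>. F (vec_upd z j (complex_of_real (norm (z $ j)) * cis \<psi>))) (at \<phi>))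
       (at (Arg (z $ j)))"

text \<open>The joint continuity makes the convolution in the generalized derivative meaningful
  and ties the initial value to the values at positive times. Without such a condition there
  is no uniqueness: a blow-up at time 0 as in \<open>t powr (\<beta> - 1)\<close> produces further solutions for
  \<open>g(\<theta>) = \<theta> powr \<beta>\<close>.\<close>

definition cauchy_solution ::
    "real \<Rightarrow> real measure \<Rightarrow> (complex ^ 'n \<Rightarrow> complex) \<Rightarrow> (complex ^ 'n \<Rightarrow> real \<Rightarrow> complex) \<Rightarrow> bool"
    where
  "cauchy_solution b \<nu> f u \<longleftrightarrow>
     (\<forall>t>0. (\<lambda>z. u z t) \<in> polydisc_algebra) \<and>
     continuous_on (polydisc \<times> {0..}) (\<lambda>(z, t). u z t) \<and>
     (\<forall>z\<in>closed_polydisc. u z 0 = f z) \<and>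
     (\<forall>t>0. \<forall>z\<in>polydisc. (\<forall>j. z $ j \<noteq> 0) \<longrightarrow>
        has_generalized_derivative b \<nu> (u z)
          (1 / 2 * (\<Sum>j\<in>UNIV. angular_deriv2 j (\<lambda>\<zeta>. u \<zeta> t) z)) t)"

end

theory Submission
  imports Defs "HOL-Complex_Analysis.Cauchy_Integral_Formula" "HOL-Real_Asymp.Real_Asymp"
begin

text \<open>Averaging \<open>f\<close> over the rotations with the kernel of \<open>W_op\<close> multiplies the \<open>k\<close>-th coefficient by
  \<open>d(t) = E exp (- \<mu> E(t))\<close> with \<open>\<mu> = sum_squares k / 2\<close>, since the kernel is a mixture of Gaussians.
  Since \<open>E(t) < s\<close> iff \<open>H s > t\<close> up to null events, the Laplace transform of \<open>d\<close> is
  \<open>(g(\<theta>) / \<theta>) / (g(\<theta>) + \<mu>)\<close>. As the Laplace transform of the tail \<open>w\<close> is \<open>g(\<theta>) / \<theta> - b\<close>, \<open>d\<close> solves the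
  Volterra equation \<open>b (1 - d) + w * (1 - d) = \<mu> (1 * d)\<close>, and summing over \<open>k\<close> gives the Cauchy problem.
  The tail is infinite at \<open>0\<close>, so \<open>H\<close> is strictly increasing and \<open>d\<close> is continuous.

  Uniqueness needs no Fourier analysis. The time integral \<open>F\<close> of the difference of two solutions
  satisfies the same equation, and for a function of time
  \<open>w * F'(t)\<close> is the \<open>\<nu>\<close>-integral of the increments \<open>F(t) - F(max (t - r) 0)\<close>. At the earliest positive
  maximum over a torus and a time interval this is strictly positive, whereas the angular Laplacian
  is at most \<open>0\<close>.\<close>

section \<open>Integrals of series and of holomorphic functions\<close>

text \<open>The equation links only points with the same moduli, so the maximum principle runs on a
  torus, which is compact and has no boundary. The moduli are parameters; points with a zero
  coordinate or on the boundary are reached afterwards by continuity in one variable at a time. The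
  time integral enters because a solution is merely continuous in time, and the increments of such a
  function need not be \<open>\<nu>\<close>-integrable, whereas those of its primitive are. In
  exchange the angular derivatives must pass through the time integral, although nothing is assumed
  about them as functions of time; Cauchy estimates supply the majorants. For existence, the
  Volterra equation is used in integrated form, since \<open>d\<close> is only shown to be
  continuous: time is differentiated once, after summation. The other obstacle is that
  \<open>polydisc_algebra\<close> is a condition in each variable separately. Inside the polydisc
  joint continuity comes from the power series. On the boundary there is no series; there the
  integral over rotations is treated by measurability and dominated convergence, with the bound of
  \<open>f\<close> as majorant.\<close>

lemma has_sum_integral_countable:
  fixes c :: "'k::countable \<Rightarrow> complex" and \<psi> :: "'k \<Rightarrow> 'x \<Rightarrow> complex"
  assumes c: "(\<lambda>k. norm (c k)) summable_on UNIV"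
    and meas [measurable]: "\<And>k. \<psi> k \<in> borel_measurable M"
    and bound: "\<And>k x. x \<in> space M \<Longrightarrow> norm (\<psi> k x) \<le> B x"
    and B: "integrable M B"
    and S: "\<And>x. x \<in> space M \<Longrightarrow> ((\<lambda>k. c k * \<psi> k x) has_sum S x) UNIV"
  shows "((\<lambda>k. c k * (LINT x|M. \<psi> k x)) has_sum (LINT x|M. S x)) UNIV"
    and "integrable M S"
proof -
  let ?R = "range (to_nat :: 'k \<Rightarrow> nat)"
  \<comment> \<open>The family is moved to the natural numbers along \<open>to_nat\<close>, with
    coefficient 0 outside its range, so that termwise integration of ordinary series applies;
    \<open>B\<close> times the summable norms of \<open>c\<close> is the majorant.\<close>
  define c' where "c' i = (if i \<in> ?R then c (from_nat i) else 0)" for i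
  have reidx: "((\<lambda>i. c' i * h (from_nat i)) has_sum y) UNIV \<longleftrightarrow> ((\<lambda>k. c k * h k) has_sum y) UNIV" for h :: "'k \<Rightarrow> complex" and y
  proof -
    have "((\<lambda>i. c' i * h (from_nat i)) has_sum y) UNIV \<longleftrightarrow> ((\<lambda>i. c' i * h (from_nat i)) has_sum y) ?R"
      by (rule has_sum_cong_neutral) (auto simp: c'_def)
    also have "\<dots> \<longleftrightarrow> ((\<lambda>k::'k. c' (to_nat k) * h (from_nat (to_nat k))) has_sum y) UNIV"
      by (rule has_sum_reindex_bij_betw[symmetric]) (simp add: inj_on_imp_bij_betw)
    finally show ?thesis by (simp add: c'_def)
  qed
  have "(\<lambda>i. norm (c' i)) summable_on ?R \<longleftrightarrow> (\<lambda>k::'k. norm (c' (to_nat k))) summable_on UNIV"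
    by (rule summable_on_reindex_bij_betw[symmetric]) (simp add: inj_on_imp_bij_betw)
  then have "(\<lambda>i. norm (c' i)) summable_on ?R" using c by (simp add: c'_def)
  then have "(\<lambda>i. norm (c' i)) summable_on UNIV"
    by (rule summable_on_cong_neutral[THEN iffD1, rotated -1]) (auto simp: c'_def)
  then have sc: "summable (\<lambda>i. norm (c' i))" by (simp add: summable_on_UNIV_nonneg_real_iff)
  have ip: "integrable M (\<psi> k)" for k
    by (rule Bochner_Integration.integrable_bound[OF B]) (auto intro!: AE_I2 order_trans[OF bound])
  have i1: "integrable M (\<lambda>x. c' i * \<psi> (from_nat i) x)" for i using ip by auto
  have s1: "AE x in M. summable (\<lambda>i. norm (c' i * \<psi> (from_nat i) x))"
  proof (rule AE_I2)
    fix x assume x: "x \<in> space M"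
    show "summable (\<lambda>i. norm (c' i * \<psi> (from_nat i) x))"
      by (rule summable_comparison_test'[OF summable_mult2[OF sc, of "B x"]])
        (auto simp: norm_mult intro!: mult_left_mono bound x)
  qed
  have s2: "summable (\<lambda>i. LINT x|M. norm (c' i * \<psi> (from_nat i) x))"
  proof (rule summable_comparison_test'[OF summable_mult2[OF sc, of "LINT x|M. B x"]])
    fix i show "norm (LINT x|M. norm (c' i * \<psi> (from_nat i) x)) \<le> norm (c' i) * integral\<^sup>L M B"
      by (auto simp: norm_mult intro!: mult_left_mono integral_mono ip integrable_norm B bound)
  qed
  have sumS: "(\<Sum>i. c' i * \<psi> (from_nat i) x) = S x" if "x \<in> space M" for x
    using S[OF that] reidx[of "\<lambda>k. \<psi> k x"] has_sum_imp_sums sums_unique by metis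
  have sums: "(\<lambda>i. LINT x|M. c' i * \<psi> (from_nat i) x) sums (LINT x|M. S x)"
    using sums_integral[OF i1 s1 s2] sumS by (simp cong: Bochner_Integration.integral_cong)
  show "integrable M S"
    using integrable_suminf[OF i1 s1 s2] sumS by (simp cong: Bochner_Integration.integrable_cong)
  have "((\<lambda>i. LINT x|M. c' i * \<psi> (from_nat i) x) has_sum (LINT x|M. S x)) UNIV"
  proof (rule norm_summable_imp_has_sum[OF _ sums])
    show "summable (\<lambda>i. norm (LINT x|M. c' i * \<psi> (from_nat i) x))"
      by (rule summable_comparison_test'[OF s2]) (simp del: Bochner_Integration.integral_mult_right_zero)
  qed
  then show "((\<lambda>k. c k * (LINT x|M. \<psi> k x)) has_sum (LINT x|M. S x)) UNIV"
    using reidx[of "\<lambda>k. LINT x|M. \<psi> k x"] by simp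
qed

text \<open>Cauchy's inequality on the circle of radius \<open>r/4\<close> about \<open>w\<close>,
  which stays inside \<open>ball c r\<close> because \<open>w\<close> is within \<open>r/2\<close>
  of the centre; hence the factor 4.\<close>

lemma norm_deriv_le_ball:
  assumes "h holomorphic_on ball c r" "0 < r" "\<And>w. w \<in> ball c r \<Longrightarrow> norm (h w) \<le> B" "w \<in> ball c (r/2)"
  shows "norm (deriv h w) \<le> 4 * B / r"
proof -
  have sub: "cball w (r/4) \<subseteq> ball c r"
    using assms(2,4) by (intro subsetI) (auto simp: dist_norm intro!: order.strict_trans1[OF dist_triangle[of c _ w, unfolded dist_norm]])
  have "norm ((deriv ^^ 1) h w) \<le> fact 1 * B / (r/4)^1"
  proof (rule Cauchy_inequality)
    show "h holomorphic_on ball w (r/4)"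
      using sub ball_subset_cball by (intro holomorphic_on_subset[OF assms(1)]) auto
    show "continuous_on (cball w (r/4)) h"
      using sub assms(1) by (intro holomorphic_on_imp_continuous_on) (auto intro: holomorphic_on_subset)
    show "norm (h x) \<le> B" if "norm (w - x) = r/4" for x
      using that sub by (intro assms(3)) (auto simp: dist_norm subset_iff)
  qed (use assms in auto)
  then show ?thesis by (simp add: field_simps)
qed

text \<open>No bound on the derivative is assumed: Cauchy's estimate turns the majorant
  \<open>B\<close> of the functions into the majorant \<open>4 * B / r\<close> of their difference
  quotients, and dominated convergence applies. The half radius leaves room for that
  estimate.\<close>

lemma has_field_derivative_integral_holomorphic:
  fixes h :: "'x \<Rightarrow> complex \<Rightarrow> complex"
  assumes r: "0 < r"
    and meas: "\<And>w. w \<in> ball c r \<Longrightarrow> (\<lambda>x. h x w) \<in> borel_measurable M"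
    and holo: "\<And>x. x \<in> space M \<Longrightarrow> h x holomorphic_on ball c r"
    and bound: "\<And>x w. x \<in> space M \<Longrightarrow> w \<in> ball c r \<Longrightarrow> norm (h x w) \<le> B x"
    and B: "integrable M B"
    and w: "w \<in> ball c (r/2)"
  shows "(\<lambda>x. deriv (h x) w) \<in> borel_measurable M"
    and "((\<lambda>w. LINT x|M. h x w) has_field_derivative (LINT x|M. deriv (h x) w)) (at w)"
proof -
  have wr: "w \<in> ball c r" using w r by auto
  have lim: "((\<lambda>v. (h x v - h x w) / (v - w)) \<longlongrightarrow> deriv (h x) w) (at w)" if "x \<in> space M" for x
    using holomorphic_derivI[OF holo[OF that] open_ball wr] by (simp add: has_field_derivative_iff)
  have lip: "norm ((h x v - h x w) / (v - w)) \<le> 4 * B x / r" if x: "x \<in> space M" and v: "v \<in> ball c (r/2)" for x v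
  proof (cases "v = w")
    case True
    have "0 \<le> B x" using bound[OF x wr] norm_ge_zero order_trans by blast
    then show ?thesis using True r by simp
  next
    case False
    have "norm (h x v - h x w) \<le> 4 * B x / r * norm (v - w)"
    proof (rule field_differentiable_bound[of "ball c (r/2)" "h x" "deriv (h x)"])
      show "(h x has_field_derivative deriv (h x) z) (at z within ball c (r/2))" if "z \<in> ball c (r/2)" for z
        using that r by (intro holomorphic_derivI[OF holo[OF x] open_ball]) auto
      show "norm (deriv (h x) z) \<le> 4 * B x / r" if "z \<in> ball c (r/2)" for z
        by (rule norm_deriv_le_ball[OF holo[OF x] r _ that]) (rule bound[OF x])
    qed (use v w in auto)
    then show ?thesis using False r by (simp add: norm_divide field_simps)
  qed
  have seq: "(\<lambda>n. w + of_real (inverse (Suc n))) \<longlonglongrightarrow> w" 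
    using tendsto_add[OF tendsto_const tendsto_of_real[OF LIMSEQ_inverse_real_of_nat], of w] by simp
  have ev_in: "eventually (\<lambda>n. Y n \<in> ball c (r/2)) sequentially" if "Y \<longlonglongrightarrow> w" for Y
    by (rule topological_tendstoD[OF that open_ball w])
  obtain N where N: "\<And>n. n \<ge> N \<Longrightarrow> w + of_real (inverse (Suc n)) \<in> ball c (r/2)"
    using ev_in[OF seq] by (auto simp: eventually_sequentially)
  \<comment> \<open>A concrete sequence in the half ball that avoids \<open>w\<close>; it serves to
    exhibit the derivative as a pointwise limit of measurable difference quotients.\<close>
  define Y where "Y n = w + of_real (inverse (real (Suc (n + N))))" for n
  have Y: "Y \<longlonglongrightarrow> w" unfolding Y_def using LIMSEQ_ignore_initial_segment[OF seq, of N] by simp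
  have Yne: "Y n \<noteq> w" for n by (simp add: Y_def del: of_nat_Suc)
  have Yin: "Y n \<in> ball c (r/2)" for n unfolding Y_def using N[of "n+N"] by simp
  have YF: "filterlim Y (at w) sequentially" using Y Yne by (auto simp: filterlim_at)
  show md: "(\<lambda>x. deriv (h x) w) \<in> borel_measurable M"
  proof (rule borel_measurable_LIMSEQ_metric)
    show "(\<lambda>x. (h x (Y n) - h x w) / (Y n - w)) \<in> borel_measurable M" for n
      using meas[of "Y n"] meas[OF wr] Yin[of n] r by (intro borel_measurable_divide borel_measurable_diff) auto
    show "(\<lambda>n. (h x (Y n) - h x w) / (Y n - w)) \<longlonglongrightarrow> deriv (h x) w" if "x \<in> space M" for x
      using filterlim_compose[OF lim[OF that] YF] .
  qed
  have int: "integrable M (\<lambda>x. h x v)" if "v \<in> ball c r" for v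
    by (rule Bochner_Integration.integrable_bound[OF B])
      (use meas that bound in \<open>auto intro!: AE_I2 order_trans[OF bound]\<close>)
  show "((\<lambda>w. LINT x|M. h x w) has_field_derivative (LINT x|M. deriv (h x) w)) (at w)"
    unfolding has_field_derivative_iff tendsto_at_iff_sequentially
  proof (intro allI impI)
    fix X :: "nat \<Rightarrow> complex" assume Xi: "\<forall>i. X i \<in> UNIV - {w}" and X: "X \<longlonglongrightarrow> w"
    obtain N where N: "\<And>n. n \<ge> N \<Longrightarrow> X n \<in> ball c (r/2)"
      using ev_in[OF X] by (auto simp: eventually_sequentially)
    have Xr: "X (n+N) \<in> ball c r" for n using N[of "n+N"] r by auto
    have "(\<lambda>n. LINT x|M. (h x (X (n+N)) - h x w) / (X (n+N) - w)) \<longlonglongrightarrow> (LINT x|M. deriv (h x) w)"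
    proof (rule integral_dominated_convergence[where w="\<lambda>x. 4 * B x / r"])
      show "(\<lambda>x. (h x (X (n+N)) - h x w) / (X (n+N) - w)) \<in> borel_measurable M" for n
        using meas[OF Xr] meas[OF wr] by (intro borel_measurable_divide borel_measurable_diff) auto
      show "integrable M (\<lambda>x. 4 * B x / r)" using B by auto
      have XF: "filterlim (\<lambda>n. X (n+N)) (at w) sequentially"
        using LIMSEQ_ignore_initial_segment[OF X, of N] Xi by (auto simp: filterlim_at)
      show "AE x in M. (\<lambda>n. (h x (X (n+N)) - h x w) / (X (n+N) - w)) \<longlonglongrightarrow> deriv (h x) w"
        using filterlim_compose[OF lim XF] by auto
      show "AE x in M. norm ((h x (X (n+N)) - h x w) / (X (n+N) - w)) \<le> 4 * B x / r" for n
        using lip N[of "n+N"] by auto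
    qed (rule md)
    also have "(\<lambda>n. LINT x|M. (h x (X (n+N)) - h x w) / (X (n+N) - w)) =
      (\<lambda>n. ((LINT x|M. h x (X (n+N))) - (LINT x|M. h x w)) / (X (n+N) - w))"
      by (simp add: Bochner_Integration.integral_diff[OF int[OF Xr] int[OF wr], symmetric])
    finally show "((\<lambda>v. ((LINT x|M. h x v) - (LINT x|M. h x w)) / (v - w)) \<circ> X) \<longlonglongrightarrow> (LINT x|M. deriv (h x) w)"
      unfolding o_def by (rule LIMSEQ_offset)
  qed
qed

text \<open>The Euler operator \<open>w d/dw\<close> multiplies the coefficient of a power by its
  exponent and keeps the power, so the statement can be iterated and no truncated exponent
  \<open>p k - 1\<close> survives. The index \<open>k\<close> will be a multi-index and
  \<open>p k\<close> its exponent in a single variable.\<close>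

lemma has_sum_mult_deriv:
  fixes \<alpha> :: "'k \<Rightarrow> complex" and p :: "'k \<Rightarrow> nat"
  assumes sum: "\<And>w. w \<in> ball 0 1 \<Longrightarrow> ((\<lambda>k. \<alpha> k * w ^ p k) has_sum h w) UNIV"
  shows "h holomorphic_on ball 0 1"
    and "w \<in> ball 0 1 \<Longrightarrow> ((\<lambda>k. of_nat (p k) * \<alpha> k * w ^ p k) has_sum (w * deriv h w)) UNIV"
proof -
  have *: "h field_differentiable at w \<and> ((\<lambda>k. of_nat (p k) * \<alpha> k * w ^ p k) has_sum (w * deriv h w)) UNIV"
    if w: "w \<in> ball 0 1" for w
  proof -
    define r where "r = (1 - norm w) / 2"
    have r: "0 < r" "norm w + r < 1" using w by (auto simp: r_def field_simps)
    have in1: "v \<in> ball 0 1" "norm v \<le> norm w + r" if "v \<in> cball w r" for v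
    proof -
      show "norm v \<le> norm w + r"
        using that norm_triangle_sub[of v w] by (auto simp: dist_norm norm_minus_commute)
      then show "v \<in> ball 0 1" using r by auto
    qed
    \<comment> \<open>Unconditional convergence of complex families is absolute, so convergence at
      the real point \<open>norm w + r\<close> gives a majorant of the series on all of
      \<open>cball w r\<close>.\<close>
    have "(\<lambda>k. \<alpha> k * of_real (norm w + r) ^ p k) summable_on UNIV"
      using sum[of "of_real (norm w + r)"] r norm_ge_zero[of w] 
      by (auto simp: summable_on_def simp del: of_real_add)
    then have M: "(\<lambda>k. norm (\<alpha> k) * (norm w + r) ^ p k) summable_on UNIV"
      using r(1) by (subst (asm) summable_on_iff_abs_summable_on_complex) 
        (simp add: norm_mult norm_power del: of_real_add)
    have ul: "uniform_limit (cball w r) (\<lambda>X v. \<Sum>k\<in>X. \<alpha> k * v ^ p k) h (finite_subsets_at_top UNIV)"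
      by (rule Weierstrass_m_test_general'[OF _ _ M])
        (use in1 r in \<open>auto simp: norm_mult norm_power intro!: mult_left_mono power_mono sum\<close>)
    obtain h' where h': "\<And>v. v \<in> ball w r \<Longrightarrow> (h has_field_derivative (h' v)) (at v) \<and>
      ((\<lambda>X. \<Sum>k\<in>X. \<alpha> k * (of_nat (p k) * v ^ (p k - 1))) \<longlongrightarrow> h' v) (finite_subsets_at_top UNIV)"
    proof (rule has_complex_derivative_uniform_limit[OF _ ul _ r(1), 
          of "\<lambda>X v. \<Sum>k\<in>X. \<alpha> k * (of_nat (p k) * v ^ (p k - 1))"])
      show "\<forall>\<^sub>F X in finite_subsets_at_top UNIV. continuous_on (cball w r) (\<lambda>v. \<Sum>k\<in>X. \<alpha> k * v ^ p k) \<and>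
        (\<forall>v\<in>ball w r. ((\<lambda>v. \<Sum>k\<in>X. \<alpha> k * v ^ p k) has_field_derivative
          (\<Sum>k\<in>X. \<alpha> k * (of_nat (p k) * v ^ (p k - 1)))) (at v))"
        by (intro always_eventually allI conjI ballI continuous_intros)
          (auto intro!: derivative_eq_intros simp: mult_ac)
    qed auto
    have d: "(h has_field_derivative h' w) (at w)" 
      and "((\<lambda>k. \<alpha> k * (of_nat (p k) * w ^ (p k - 1))) has_sum h' w) UNIV"
      using h'[of w] r by (auto simp: has_sum_def)
    from has_sum_cmult_right[OF this(2), of w] 
    have "((\<lambda>k. w * (\<alpha> k * (of_nat (p k) * w ^ (p k - 1)))) has_sum w * h' w) UNIV" .
    also have "(\<lambda>k. w * (\<alpha> k * (of_nat (p k) * w ^ (p k - 1)))) = (\<lambda>k. of_nat (p k) * \<alpha> k * w ^ p k)"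
    proof
      fix k show "w * (\<alpha> k * (of_nat (p k) * w ^ (p k - 1))) = of_nat (p k) * \<alpha> k * w ^ p k"
        by (cases "p k") auto
    qed
    finally show ?thesis using d DERIV_imp_deriv[OF d] by (auto simp: field_differentiable_def)
  qed
  show "h holomorphic_on ball 0 1"
    using * by (auto simp: holomorphic_on_def intro: field_differentiable_at_within)
  show "w \<in> ball 0 1 \<Longrightarrow> ((\<lambda>k. of_nat (p k) * \<alpha> k * w ^ p k) has_sum (w * deriv h w)) UNIV"
    using * by blast
qed

text \<open>The second derivative is assumed at \<open>x0\<close> only: if it were positive,
  \<open>G'\<close> would be positive just to the right of its zero \<open>x0\<close>, and the mean
  value theorem would produce a value above the maximum.\<close>

lemma second_derivative_nonpos_at_max:
  fixes G :: "real \<Rightarrow> real"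
  assumes G: "\<And>x. (G has_real_derivative G' x) (at x)"
    and G': "(G' has_real_derivative D) (at x0)"
    and max: "\<And>x. G x \<le> G x0"
  shows "D \<le> 0"
proof (rule ccontr)
  assume "\<not> D \<le> 0"
  then have "D > 0" by simp
  have "G' x0 = 0"
    by (rule DERIV_local_max[OF G, of 1]) (auto simp: max)
  with DERIV_pos_inc_right[OF G' \<open>D > 0\<close>] obtain d where d: "d > 0" "\<And>h. 0 < h \<Longrightarrow> h < d \<Longrightarrow> 0 < G' (x0 + h)"
    by auto
  obtain x where x: "x0 < x" "x < x0 + d/2" "G (x0 + d/2) - G x0 = (x0 + d/2 - x0) * G' x"
    using MVT2[of x0 "x0 + d/2" G G'] G d(1) by auto
  have "G' x > 0" using d(2)[of "x - x0"] x by auto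
  then have "G (x0 + d/2) - G x0 > 0" using d(1) unfolding x(3) by simp
  then show False using max[of "x0 + d/2"] by simp
qed

text \<open>Replacing \<open>t\<close> by a grid point to its right leaves countably many functions
  of \<open>s\<close> alone, glued along measurable sets of \<open>t\<close>; as the grid is
  refined, right continuity recovers \<open>F\<close>. Tonelli will need this for the tail
  probabilities of \<open>H\<close>.\<close>

lemma borel_measurable_pair_right_continuous:
  fixes F :: "'s \<Rightarrow> real \<Rightarrow> real"
  assumes m: "\<And>t. (\<lambda>s. F s t) \<in> borel_measurable M"
    and rc: "\<And>s t. s \<in> space M \<Longrightarrow> continuous (at_right t) (F s)"
  shows "(\<lambda>(s,t). F s t) \<in> borel_measurable (M \<Otimes>\<^sub>M borel)"
proof -
  \<comment> \<open>Floor plus one, not ceiling: the grid point lies strictly to the right of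
    \<open>t\<close> even when \<open>t\<close> is on the grid, as \<open>at_right t\<close>
    demands.\<close>
  define a where "a n t = (of_int \<lfloor>t * real (Suc n)\<rfloor> + 1) / real (Suc n)" for n :: nat and t :: real
  have a: "t < a n t" "a n t \<le> t + 1 / real (Suc n)" for n t
  proof -
    have "t * real (Suc n) < of_int \<lfloor>t * real (Suc n)\<rfloor> + 1" "of_int \<lfloor>t * real (Suc n)\<rfloor> \<le> t * real (Suc n)"
      by linarith+
    then show "t < a n t" "a n t \<le> t + 1 / real (Suc n)"
      unfolding a_def by (auto simp: pos_less_divide_eq pos_divide_le_eq ring_distribs simp del: of_nat_Suc)
  qed
  have lim: "filterlim (\<lambda>n. a n t) (at_right t) sequentially" for t
    unfolding filterlim_at
  proof (intro conjI)
    show "(\<lambda>n. a n t) \<longlonglongrightarrow> t"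
    proof (rule tendsto_sandwich[of "\<lambda>n. t" _ _ "\<lambda>n. t + 1 / real (Suc n)"])
      show "(\<lambda>n. t + 1 / real (Suc n)) \<longlonglongrightarrow> t"
        using tendsto_add[OF tendsto_const LIMSEQ_inverse_real_of_nat, of t] by (simp add: field_simps)
    qed (use a in \<open>auto intro!: always_eventually less_imp_le\<close>)
  qed (use a in \<open>auto intro!: always_eventually simp: less_imp_neq[symmetric]\<close>)
  have lims: "(\<lambda>n. F s (a n t)) \<longlonglongrightarrow> F s t" if "s \<in> space M" for s t
    using filterlim_compose[OF rc[OF that, of t, unfolded continuous_within] lim] .
  show ?thesis
  proof (rule borel_measurable_LIMSEQ_metric)
    fix n
    have "(\<lambda>x. F (fst x) ((of_int \<lfloor>snd x * real (Suc n)\<rfloor> + 1) / real (Suc n))) \<in> borel_measurable (M \<Otimes>\<^sub>M borel)"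
    proof (rule measurable_compose_countable[where f="\<lambda>i x. F (fst x) ((of_int i + 1) / real (Suc n))"])
      show "(\<lambda>x. F (fst x) ((of_int i + 1) / real (Suc n))) \<in> borel_measurable (M \<Otimes>\<^sub>M borel)" for i
        by (rule measurable_compose[OF measurable_fst m])
      show "(\<lambda>x. \<lfloor>snd x * real (Suc n)\<rfloor>) \<in> M \<Otimes>\<^sub>M borel \<rightarrow>\<^sub>M count_space UNIV"
        by measurable
    qed
    then show "(\<lambda>(s, t). F s (a n t)) \<in> borel_measurable (M \<Otimes>\<^sub>M borel)"
      unfolding a_def by (simp add: case_prod_beta')
  qed (use lims in \<open>auto simp: space_pair_measure case_prod_beta'\<close>)
qed

section \<open>Elementary integrals on the half-line\<close>

lemma nn_integral_exp_interval:
  assumes "0 < r" "0 < \<theta>"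
  shows "(\<integral>\<^sup>+ t. ennreal (exp (- (\<theta> * t))) * indicator {0<..<r} t \<partial>lborel) = ennreal ((1 - exp (- (r * \<theta>))) / \<theta>)"
proof -
  have "(\<integral>\<^sup>+ t. ennreal (exp (- (\<theta> * t))) * indicator {0<..<r} t \<partial>lborel) =
    (\<integral>\<^sup>+ t. ennreal (exp (- (\<theta> * t))) * indicator {0..r} t \<partial>lborel)"
  proof (rule nn_integral_cong_AE)
    show "AE t in lborel. ennreal (exp (- (\<theta> * t))) * indicator {0<..<r} t = ennreal (exp (- (\<theta> * t))) * indicator {0..r} t"
      using AE_lborel_singleton[of 0] AE_lborel_singleton[of r] by eventually_elim (auto simp: indicator_def)
  qed
  also have "\<dots> = ennreal (- exp (- (\<theta> * r)) / \<theta> - - exp (- (\<theta> * 0)) / \<theta>)"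
    by (rule nn_integral_FTC_Icc) (use assms in \<open>auto intro!: derivative_eq_intros\<close>)
  finally show ?thesis by (simp add: diff_divide_distrib mult.commute)
qed

lemma nn_integral_exp_Ioi:
  assumes "0 < (c::real)"
  shows "(\<integral>\<^sup>+ s. ennreal (c * exp (- (c * s))) * indicator {a<..} s \<partial>lborel) = ennreal (exp (- (c * a)))"
proof -
  have "(\<integral>\<^sup>+ s. ennreal (c * exp (- (c * s))) * indicator {a<..} s \<partial>lborel) =
    (\<integral>\<^sup>+ s. ennreal (c * exp (- (c * s))) * indicator {a..} s \<partial>lborel)"
  proof (rule nn_integral_cong_AE)
    show "AE s in lborel. ennreal (c * exp (- (c * s))) * indicator {a<..} s = ennreal (c * exp (- (c * s))) * indicator {a..} s"
      using AE_lborel_singleton[of a] by eventually_elim (auto simp: indicator_def)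
  qed
  also have "\<dots> = ennreal (0 - (- exp (- (c * a))))"
  proof (rule nn_integral_FTC_atLeast)
    show "((\<lambda>s. - exp (- (c * s))) \<longlongrightarrow> 0) at_top"
      using assms by real_asymp
  qed (use assms in \<open>auto intro!: derivative_eq_intros\<close>)
  finally show ?thesis by simp
qed

lemma set_integral_of_nn_integral:
  fixes f :: "real \<Rightarrow> real"
  assumes [measurable]: "f \<in> borel_measurable borel" "A \<in> sets borel"
    and nn: "\<And>t. t \<in> A \<Longrightarrow> 0 \<le> f t" and c: "0 \<le> c"
    and eq: "(\<integral>\<^sup>+ t. ennreal (f t) * indicator A t \<partial>lborel) = ennreal c"
  shows "set_integrable lborel A f" and "(LBINT t:A. f t) = c"
proof -
  have "has_bochner_integral lborel (\<lambda>t. indicator A t *\<^sub>R f t) c"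
  proof (rule has_bochner_integral_nn_integral)
    have "(\<integral>\<^sup>+ t. ennreal (indicator A t *\<^sub>R f t) \<partial>lborel) = (\<integral>\<^sup>+ t. ennreal (f t) * indicator A t \<partial>lborel)"
      by (rule nn_integral_cong) (auto simp: indicator_def)
    then show "(\<integral>\<^sup>+ t. ennreal (indicator A t *\<^sub>R f t) \<partial>lborel) = ennreal c" using eq by simp
  qed (use nn c in \<open>auto simp: indicator_def\<close>)
  then show "set_integrable lborel A f" "(LBINT t:A. f t) = c"
    by (auto simp: has_bochner_integral_iff set_integrable_def set_lebesgue_integral_def)
qed

lemma set_integral_Ioo_eq_integral:
  fixes y :: "real \<Rightarrow> 'b::euclidean_space"
  assumes "continuous_on {0..T} y"
  shows "set_integrable lborel {0<..<T} y" and "(LBINT s:{0<..<T}. y s) = integral {0..T} y"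
proof -
  show i: "set_integrable lborel {0<..<T} y"
    by (rule set_integrable_subset[OF borel_integrable_atLeastAtMost'[OF assms]]) auto
  show "(LBINT s:{0<..<T}. y s) = integral {0..T} y"
    using set_borel_integral_eq_integral(2)[OF i] integral_open_interval_real[of 0 T y] by simp
qed

lemma
  fixes y :: "real \<Rightarrow> 'b::euclidean_space"
  assumes y: "continuous_on {0..} y"
  shows continuous_on_set_integral_Ioo: "continuous_on {0..} (\<lambda>t. LBINT s:{0<..<t}. y s)"
    and has_vector_derivative_set_integral_Ioo:
      "0 < t \<Longrightarrow> ((\<lambda>t. LBINT s:{0<..<t}. y s) has_vector_derivative y t) (at t)"
proof -
  have yT: "continuous_on {0..T} y" for T by (rule continuous_on_subset[OF y]) auto
  have eq: "(LBINT s:{0<..<t}. y s) = integral {0..t} y" for t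
    by (rule set_integral_Ioo_eq_integral[OF yT])
  have w: "((\<lambda>t. integral {0..t} y) has_vector_derivative y t) (at t within {0..t+1})" if "0 \<le> t" for t
    using integral_has_vector_derivative[OF yT, of t "t+1"] that by simp
  show "((\<lambda>t. LBINT s:{0<..<t}. y s) has_vector_derivative y t) (at t)" if "0 < t"
    using w[of t] that at_within_interior[of t "{0..t+1}"] unfolding eq by simp
  show "continuous_on {0..} (\<lambda>t. LBINT s:{0<..<t}. y s)"
    unfolding eq continuous_on_eq_continuous_within
  proof
    fix t :: real assume "t \<in> {0..}"
    then have "continuous (at t within {0..t+1}) (\<lambda>t. integral {0..t} y)"
      using has_vector_derivative_continuous[OF w] by simp
    moreover have "at t within {0..t+1} = at t within {0..}"
      by (rule at_within_nhd[of t "{..<t+1}"]) auto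
    ultimately show "continuous (at t within {0..}) (\<lambda>t. integral {0..t} y)" by simp
  qed
qed

section \<open>The tail of an infinite Levy measure\<close>

locale infinite_levy_measure =
  fixes \<nu> :: "real measure"
  assumes levy: "levy_measure \<nu>"
    and tail_inf: "filterlim (levy_tail \<nu>) at_top (at_right 0)"
begin

lemma sets_nu [measurable_cong]: "sets \<nu> = sets borel"
  using levy by (simp add: levy_measure_def)

lemma space_nu [simp]: "space \<nu> = UNIV"
  using sets_eq_imp_space_eq[OF sets_nu] by simp

lemma AE_nu_pos: "AE r in \<nu>. 0 < r"
proof (rule AE_I')
  show "{..0} \<in> null_sets \<nu>"
    using levy sets_nu by (intro null_setsI) (auto simp: levy_measure_def)
qed auto

text \<open>\<open>levy_tail\<close> uses \<open>measure\<close>, whose value on a set of infinite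
  mass is 0. The Levy integral dominates \<open>min s 1\<close> times the mass of
  \<open>{s<..}\<close>, so this default never occurs for \<open>s > 0\<close>.\<close>

lemma emeasure_tail: "0 < s \<Longrightarrow> emeasure \<nu> {s<..} = ennreal (levy_tail \<nu> s)"
proof -
  assume s: "0 < s"
  have "ennreal (min s 1) * emeasure \<nu> {s<..} = (\<integral>\<^sup>+ z. ennreal (min s 1) * indicator {s<..} z \<partial>\<nu>)"
    by (subst nn_integral_cmult_indicator) (auto simp: sets_nu)
  also have "\<dots> \<le> (\<integral>\<^sup>+ z. ennreal (min z 1) \<partial>\<nu>)"
    by (rule nn_integral_mono) (auto simp: indicator_def intro!: ennreal_leI)
  also have "\<dots> < \<infinity>" using levy by (simp add: levy_measure_def)
  finally have "emeasure \<nu> {s<..} \<noteq> \<infinity>" 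
    using s by (auto simp: ennreal_mult_top min_def split: if_splits)
  then show ?thesis by (simp add: levy_tail_def emeasure_eq_ennreal_measure)
qed

lemma tail_nonneg: "0 \<le> levy_tail \<nu> s" by (simp add: levy_tail_def)

sublocale sigma_finite_measure \<nu>
proof
  let ?A = "insert {..0} (range (\<lambda>n. {1 / real (Suc n)<..}))"
  have "x \<in> \<Union>?A" for x
  proof (cases "x \<le> 0")
    case False
    then obtain n where "inverse (real (Suc n)) < x" using reals_Archimedean[of x] by auto
    then show ?thesis by (auto simp: field_simps intro!: exI[of _ n])
  qed auto
  then show "\<exists>A. countable A \<and> A \<subseteq> sets \<nu> \<and> \<Union> A = space \<nu> \<and> (\<forall>a\<in>A. emeasure \<nu> a \<noteq> \<infinity>)"
    using levy by (intro exI[of _ ?A]) (auto simp: sets_nu emeasure_tail levy_measure_def simp del: of_nat_Suc)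
qed

sublocale lborel_nu: pair_sigma_finite lborel \<nu> ..

lemma measurable_tail [measurable]: "levy_tail \<nu> \<in> borel_measurable borel"
proof -
  have "(\<lambda>s. \<integral>\<^sup>+ r. indicator {s<..} r \<partial>\<nu>) \<in> borel_measurable borel"
    unfolding greaterThan_def indicator_def by measurable
  then have "(\<lambda>s. enn2real (\<integral>\<^sup>+ r. indicator {s<..} r \<partial>\<nu>)) \<in> borel_measurable borel" by measurable
  then show ?thesis by (simp add: levy_tail_def[abs_def] measure_def sets_nu)
qed

text \<open>If the integral vanished, \<open>\<nu>\<close> would give no mass to the positive
  half-line, against the divergence of its tail at 0. The strict inequalities for
  \<open>bernstein\<close> and in the maximum principle come from here.\<close>

lemma nu_integral_pos:
  fixes h :: "real \<Rightarrow> real"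
  assumes "integrable \<nu> h" and pos: "\<And>r. 0 < r \<Longrightarrow> 0 < h r"
  shows "0 < (LINT r|\<nu>. h r)"
proof -
  have nn: "AE r in \<nu>. 0 \<le> h r" using AE_nu_pos by eventually_elim (rule less_imp_le[OF pos])
  have "(LINT r|\<nu>. h r) \<noteq> 0"
  proof
    assume "(LINT r|\<nu>. h r) = 0"
    then have "AE r in \<nu>. h r = 0" using integral_nonneg_eq_0_iff_AE[OF assms(1) nn] by simp
    with AE_nu_pos have "AE r in \<nu>. False" by eventually_elim (use pos in force)
    then have "AE r in \<nu>. \<not> s < r" for s by (auto elim: eventually_mono)
    then have "emeasure \<nu> {s<..} = 0" for s
      using emeasure_eq_0_AE[of "\<lambda>r. s < r" \<nu>] by (simp add: greaterThan_def)
    then have "levy_tail \<nu> s = 0" for s by (simp add: levy_tail_def measure_def)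
    moreover have "eventually (\<lambda>s. levy_tail \<nu> s \<ge> 1) (at_right 0)"
      using tail_inf by (simp add: filterlim_at_top)
    ultimately show False by simp
  qed
  then show ?thesis using integral_nonneg_AE[OF nn] by simp
qed

lemma integrable_one_minus_exp: 
  assumes x: "0 \<le> x"
  shows "integrable \<nu> (\<lambda>s. 1 - exp (- (s * x)))"
proof (rule Bochner_Integration.integrable_bound)
  have "(\<integral>\<^sup>+ z. ennreal (norm (min z 1)) \<partial>\<nu>) = (\<integral>\<^sup>+ z. ennreal (min z 1) \<partial>\<nu>)"
    using AE_nu_pos by (intro nn_integral_cong_AE) (auto elim!: eventually_mono)
  then have "integrable \<nu> (\<lambda>z. min z 1)"
    using levy by (intro integrableI_bounded) (auto simp: levy_measure_def)
  then show "integrable \<nu> (\<lambda>z. (1 + x) * min z 1)" by simp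
  show "AE s in \<nu>. norm (1 - exp (- (s * x))) \<le> norm ((1 + x) * min s 1)"
    using AE_nu_pos
  proof eventually_elim
    case (elim s)
    have "1 - exp (- (s * x)) \<le> s * x" using exp_ge_add_one_self[of "-(s*x)"] by simp
    moreover have "1 - exp (- (s * x)) \<le> 1" by simp
    moreover have "exp (- (s * x)) \<le> 1" using elim x by simp
    moreover have "s * x \<le> (1 + x) * s" "1 \<le> (1 + x) * 1" using elim x by (auto simp: algebra_simps)
    ultimately have "\<bar>1 - exp (- (s * x))\<bar> \<le> (1 + x) * s" "\<bar>1 - exp (- (s * x))\<bar> \<le> (1 + x) * 1" by linarith+
    then show ?case using elim x by (auto simp: min_def abs_mult)
  qed
qed measurable

text \<open>The tail at \<open>t\<close> is the \<open>\<nu>\<close>-mass of the jumps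
  \<open>r > t\<close>; after exchanging the integrals, a jump \<open>r\<close> contributes the
  integral of \<open>exp (- (\<theta> * t))\<close> over the times \<open>0 < t < r\<close>.\<close>

lemma nn_integral_laplace_tail:
  assumes \<theta>: "0 < \<theta>"
  shows "(\<integral>\<^sup>+ t. ennreal (exp (- (\<theta> * t)) * levy_tail \<nu> t) * indicator {0<..} t \<partial>lborel)
    = ennreal ((LINT s|\<nu>. 1 - exp (- (s * \<theta>))) / \<theta>)"
proof -
  have "(\<integral>\<^sup>+ t. ennreal (exp (- (\<theta> * t)) * levy_tail \<nu> t) * indicator {0<..} t \<partial>lborel)
    = (\<integral>\<^sup>+ t. \<integral>\<^sup>+ r. ennreal (exp (- (\<theta> * t))) * indicator {0<..} t * (if t < r then 1 else 0) \<partial>\<nu> \<partial>lborel)"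
  proof (rule nn_integral_cong)
    fix t :: real
    show "ennreal (exp (- (\<theta> * t)) * levy_tail \<nu> t) * indicator {0<..} t =
      (\<integral>\<^sup>+ r. ennreal (exp (- (\<theta> * t))) * indicator {0<..} t * (if t < r then 1 else 0) \<partial>\<nu>)"
    proof (cases "0 < t")
      case True
      have "(\<integral>\<^sup>+ r. (if t < r then 1 else 0) \<partial>\<nu>) = (\<integral>\<^sup>+ r. indicator {t<..} r \<partial>\<nu>)"
        by (rule nn_integral_cong) auto
      also have "\<dots> = ennreal (levy_tail \<nu> t)" using emeasure_tail[OF True] by (simp add: sets_nu)
      finally show ?thesis using True by (simp add: nn_integral_cmult ennreal_mult tail_nonneg)
    qed simp
  qed
  also have "\<dots> = (\<integral>\<^sup>+ r. \<integral>\<^sup>+ t. ennreal (exp (- (\<theta> * t))) * indicator {0<..} t * (if t < r then 1 else 0) \<partial>lborel \<partial>\<nu>)"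
    by (rule lborel_nu.Fubini'[symmetric]) measurable
  also have "\<dots> = (\<integral>\<^sup>+ r. ennreal ((1 - exp (- (r * \<theta>))) / \<theta>) \<partial>\<nu>)"
  proof (rule nn_integral_cong_AE, use AE_nu_pos in eventually_elim)
    case (elim r)
    have "(\<integral>\<^sup>+ t. ennreal (exp (- (\<theta> * t))) * indicator {0<..} t * (if t < r then 1 else 0) \<partial>lborel)
      = (\<integral>\<^sup>+ t. ennreal (exp (- (\<theta> * t))) * indicator {0<..<r} t \<partial>lborel)"
      by (rule nn_integral_cong) (auto simp: indicator_def)
    then show ?case using nn_integral_exp_interval[OF elim \<theta>] by simp
  qed
  also have "\<dots> = ennreal (LINT r|\<nu>. (1 - exp (- (r * \<theta>))) / \<theta>)"
    using integrable_one_minus_exp[of \<theta>] \<theta> AE_nu_pos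
    by (intro nn_integral_eq_integral) (auto elim!: eventually_mono)
  finally show ?thesis by simp
qed

text \<open>The tail blows up at 0, but its Laplace transform at 1 is finite, and for
  \<open>t < T\<close> the weight \<open>exp (- t)\<close> is bounded below by
  \<open>exp (- T)\<close>.\<close>

lemma set_integrable_tail: "set_integrable lborel {0<..<T} (levy_tail \<nu>)"
proof -
  have i: "integrable lborel (\<lambda>t. indicator {0<..} t * (exp (- t) * levy_tail \<nu> t))"
  proof (rule integrableI_bounded)
    have "(\<integral>\<^sup>+ t. ennreal (norm (indicator {0<..} t * (exp (- t) * levy_tail \<nu> t))) \<partial>lborel)
      = (\<integral>\<^sup>+ t. ennreal (exp (- (1 * t)) * levy_tail \<nu> t) * indicator {0<..} t \<partial>lborel)"
      using tail_nonneg by (intro nn_integral_cong) (auto simp: indicator_def)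
    then show "(\<integral>\<^sup>+ t. ennreal (norm (indicator {0<..} t * (exp (- t) * levy_tail \<nu> t))) \<partial>lborel) < \<infinity>"
      by (simp only: nn_integral_laplace_tail[OF zero_less_one]) simp
  qed measurable
  show ?thesis unfolding set_integrable_def
  proof (rule Bochner_Integration.integrable_bound)
    show "integrable lborel (\<lambda>t. exp T * (indicator {0<..} t * (exp (- t) * levy_tail \<nu> t)))"
      using i by simp
    have "levy_tail \<nu> t \<le> exp T * (exp (- t) * levy_tail \<nu> t)" if "t < T" for t
      using mult_right_mono[of 1 "exp T * exp (-t)" "levy_tail \<nu> t"] that tail_nonneg 
      by (simp add: mult_exp_exp flip: mult.assoc)
    then show "AE t in lborel. norm (indicator {0<..<T} t *\<^sub>R levy_tail \<nu> t)
        \<le> norm (exp T * (indicator {0<..} t * (exp (- t) * levy_tail \<nu> t)))"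
      using tail_nonneg by (auto simp: indicator_def abs_mult)
  qed measurable
qed

lemma bernstein_pos: 
  assumes "0 \<le> b" "0 < \<theta>" shows "0 < bernstein b \<nu> \<theta>"
  using nu_integral_pos[OF integrable_one_minus_exp[of \<theta>]] assms
  by (simp add: bernstein_def add_nonneg_pos)

text \<open>At \<open>\<theta> = 1/s\<close> the integrand is at least \<open>1 - exp (-1)\<close>
  on all jumps \<open>r > s\<close>, so \<open>bernstein b \<nu> (1/s)\<close> dominates a fixed
  multiple of the tail at \<open>s\<close>, which is unbounded as \<open>s\<close> tends to
  0.\<close>

lemma bernstein_unbounded:
  assumes "0 \<le> b" shows "\<exists>\<theta>>0. C \<le> bernstein b \<nu> \<theta>"
proof -
  define K where "K = C / (1 - exp (-1))"
  have "eventually (\<lambda>s. levy_tail \<nu> s \<ge> K) (at_right 0)" "eventually (\<lambda>s::real. 0 < s) (at_right 0)"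
    using tail_inf by (auto simp: filterlim_at_top eventually_at_right_less)
  then have "eventually (\<lambda>s. levy_tail \<nu> s \<ge> K \<and> 0 < s) (at_right 0)" by eventually_elim auto
  then obtain s where s: "levy_tail \<nu> s \<ge> K" "0 < s"
    using eventually_happens' trivial_limit_at_right_real by blast
  have int: "integrable \<nu> (\<lambda>r. (1 - exp (-1)) * indicator {s<..} r :: real)"
    by (intro integrable_mult_right, subst integrable_indicator_iff) (simp add: sets_nu emeasure_tail[OF s(2)])
  have "C \<le> (1 - exp (-1)) * levy_tail \<nu> s" 
    using s(1) by (simp add: K_def field_simps)
  also have "\<dots> = (LINT r|\<nu>. (1 - exp (-1)) * indicator {s<..} r)"
    by (simp add: levy_tail_def)
  also have "\<dots> \<le> (LINT r|\<nu>. 1 - exp (- (r * (1/s))))"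
  proof (rule integral_mono_AE[OF int integrable_one_minus_exp])
    show "AE r in \<nu>. (1 - exp (-1)) * indicator {s<..} r \<le> 1 - exp (- (r * (1/s)))"
      using AE_nu_pos by eventually_elim (use s in \<open>auto simp: indicator_def field_simps\<close>)
  qed (use s in simp)
  also have "\<dots> \<le> bernstein b \<nu> (1/s)" using assms s by (simp add: bernstein_def)
  finally show ?thesis using s by (intro exI[of _ "1/s"]) auto
qed

section \<open>Convolution with the tail\<close>

lemma set_integrable_convolution:
  fixes q :: "real \<Rightarrow> 'b::{euclidean_space}"
  assumes q: "continuous_on {0..T} q"
  shows "set_integrable lborel {0<..<T} (\<lambda>s. levy_tail \<nu> (T - s) *\<^sub>R q s)"
proof -
  obtain B where B: "\<And>s. s \<in> {0..T} \<Longrightarrow> norm (q s) \<le> B"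
    using compact_imp_bounded[OF compact_continuous_image[OF q compact_Icc]] unfolding bounded_iff by blast
  have [measurable]: "(\<lambda>s. indicator {0..T} s *\<^sub>R q s) \<in> borel_measurable borel"
    by (rule borel_measurable_continuous_on_indicator[OF _ q]) simp
  have "integrable lborel (\<lambda>s. B * (indicator {0<..<T} (T + (-1) * s) *\<^sub>R levy_tail \<nu> (T + (-1) * s)))"
    using set_integrable_tail[of T] unfolding set_integrable_def
    by (intro integrable_mult_right lborel_integrable_real_affine) auto
  then show ?thesis unfolding set_integrable_def
  proof (rule Bochner_Integration.integrable_bound)
    have "(\<lambda>s. indicator {0<..<T} s *\<^sub>R levy_tail \<nu> (T - s) *\<^sub>R indicator {0..T} s *\<^sub>R q s) \<in> borel_measurable lborel"
      by measurable
    also have "(\<lambda>s. indicator {0<..<T} s *\<^sub>R levy_tail \<nu> (T - s) *\<^sub>R indicator {0..T} s *\<^sub>R q s)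
      = (\<lambda>s. indicator {0<..<T} s *\<^sub>R levy_tail \<nu> (T - s) *\<^sub>R q s)"
      by (auto simp: indicator_def)
    finally show "(\<lambda>s. indicator {0<..<T} s *\<^sub>R levy_tail \<nu> (T - s) *\<^sub>R q s) \<in> borel_measurable lborel" .
    show "AE s in lborel. norm (indicator {0<..<T} s *\<^sub>R levy_tail \<nu> (T - s) *\<^sub>R q s)
      \<le> norm (B * (indicator {0<..<T} (T + (-1) * s) *\<^sub>R levy_tail \<nu> (T + (-1) * s)))"
    proof (rule AE_I2)
      fix s
      have "norm (q s) \<le> \<bar>B\<bar>" if "0 < s" "s < T" using B[of s] that by auto
      then show "norm (indicator {0<..<T} s *\<^sub>R levy_tail \<nu> (T - s) *\<^sub>R q s)
      \<le> norm (B * (indicator {0<..<T} (T + (-1) * s) *\<^sub>R levy_tail \<nu> (T + (-1) * s)))"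
        using tail_nonneg by (auto simp: indicator_def abs_mult mult.commute[of _ "levy_tail _ _"] intro!: mult_left_mono)
    qed
  qed
qed

text \<open>Since \<open>q 0 = 0\<close>, the constant continuation \<open>Q\<close> of
  \<open>q\<close> to negative times is zero there. The substitution \<open>r = \<tau> - s\<close>
  then replaces the moving interval by the fixed one \<open>(0, T)\<close>, and
  \<open>\<tau>\<close> occurs only inside the continuous function \<open>Q\<close>; the integrable
  tail times a bound of \<open>q\<close> is the majorant.\<close>

lemma continuous_on_convolution:
  fixes q :: "real \<Rightarrow> 'b::{euclidean_space}"
  assumes q: "continuous_on {0..} q" and q0: "q 0 = 0"
  shows "continuous_on {0..} (\<lambda>\<tau>. LBINT s:{0<..<\<tau>}. levy_tail \<nu> (\<tau> - s) *\<^sub>R q s)"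
proof (rule continuous_on_sequentiallyI)
  fix X :: "nat \<Rightarrow> real" and t :: real
  assume X0: "\<forall>n. X n \<in> {0..}" and t: "t \<in> {0..}" and X: "X \<longlonglongrightarrow> t"
  obtain T where T: "\<And>n. X n < T" "t < T"
  proof -
    obtain K where K: "\<And>n. norm (X n) \<le> K" using convergent_imp_Bseq[of X] X 
      by (auto simp: convergent_def Bseq_def)
    show ?thesis by (rule that[of "max K t + 1"]) (use K in \<open>auto simp: abs_le_iff intro!: le_less_trans[OF conjunct1[OF K[unfolded real_norm_def abs_le_iff]]]\<close>)
  qed
  define Q where "Q x = q (max x 0)" for x
  have Qc: "continuous_on UNIV Q" unfolding Q_def
    by (rule continuous_on_compose2[OF q]) (auto intro!: continuous_intros)
  have [measurable]: "Q \<in> borel_measurable borel" by (rule borel_measurable_continuous_onI[OF Qc])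
  have qT: "continuous_on {0..T} q" by (rule continuous_on_subset[OF q]) auto
  obtain B where B: "\<And>s. s \<in> {0..T} \<Longrightarrow> norm (q s) \<le> B"
    using compact_imp_bounded[OF compact_continuous_image[OF qT compact_Icc]] unfolding bounded_iff by blast
  have eq: "(LBINT s:{0<..<\<tau>}. levy_tail \<nu> (\<tau> - s) *\<^sub>R q s)
      = (LINT r|lborel. (indicator {0<..<T} r * levy_tail \<nu> r) *\<^sub>R Q (\<tau> - r))" if "0 \<le> \<tau>" "\<tau> < T" for \<tau>
  proof -
    have "(LBINT s:{0<..<\<tau>}. levy_tail \<nu> (\<tau> - s) *\<^sub>R q s)
      = \<bar>-1\<bar> *\<^sub>R (LINT r|lborel. indicator {0<..<\<tau>} (\<tau> + (-1) * r) *\<^sub>R (levy_tail \<nu> (\<tau> - (\<tau> + (-1) * r)) *\<^sub>R q (\<tau> + (-1) * r)))"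
      unfolding set_lebesgue_integral_def by (rule lborel_integral_real_affine) simp
    also have "\<dots> = (LINT r|lborel. (indicator {0<..<T} r * levy_tail \<nu> r) *\<^sub>R Q (\<tau> - r))"
      using that q0 by (auto simp: Q_def indicator_def max_def intro!: Bochner_Integration.integral_cong)
    finally show ?thesis .
  qed
  have "(\<lambda>n. LINT r|lborel. (indicator {0<..<T} r * levy_tail \<nu> r) *\<^sub>R Q (X n - r)) \<longlonglongrightarrow>
    (LINT r|lborel. (indicator {0<..<T} r * levy_tail \<nu> r) *\<^sub>R Q (t - r))"
  proof (rule integral_dominated_convergence[where w="\<lambda>r. B * (indicator {0<..<T} r * levy_tail \<nu> r)"])
    show "integrable lborel (\<lambda>r. B * (indicator {0<..<T} r * levy_tail \<nu> r))"
      using set_integrable_tail[of T] by (simp add: set_integrable_def)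
    show "AE r in lborel. (\<lambda>n. (indicator {0<..<T} r * levy_tail \<nu> r) *\<^sub>R Q (X n - r))
       \<longlonglongrightarrow> (indicator {0<..<T} r * levy_tail \<nu> r) *\<^sub>R Q (t - r)"
      by (intro AE_I2 tendsto_intros continuous_on_tendsto_compose[OF Qc] X) auto
    show "AE r in lborel. norm ((indicator {0<..<T} r * levy_tail \<nu> r) *\<^sub>R Q (X n - r))
       \<le> B * (indicator {0<..<T} r * levy_tail \<nu> r)" for n
    proof (rule AE_I2)
      fix r
      have "norm (Q (X n - r)) \<le> B" if "0 < r" unfolding Q_def
        using T(1)[of n] that X0[rule_format, of n] by (intro B) auto
      then show "norm ((indicator {0<..<T} r * levy_tail \<nu> r) *\<^sub>R Q (X n - r))
       \<le> B * (indicator {0<..<T} r * levy_tail \<nu> r)"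
        using tail_nonneg by (auto simp: indicator_def mult.commute[of _ "levy_tail _ _"] intro!: mult_left_mono)
    qed
  qed measurable
  then show "(\<lambda>n. LBINT s:{0<..<X n}. levy_tail \<nu> (X n - s) *\<^sub>R q s) \<longlonglongrightarrow> (LBINT s:{0<..<t}. levy_tail \<nu> (t - s) *\<^sub>R q s)"
    using eq X0 t T by simp
qed

text \<open>Write the tail at \<open>t - s\<close> as the \<open>\<nu>\<close>-mass of the jumps
  \<open>r > t - s\<close> and exchange the integrals: for a fixed jump \<open>r\<close> the
  admissible times \<open>s\<close> are the last stretch from \<open>max (t - r) 0\<close> to
  \<open>t\<close>, over which \<open>y\<close> integrates to an increment of its primitive. This
  puts the convolution into the jump form on which a maximum principle can act.\<close>

lemma convolution_eq_increments:
  fixes y :: "real \<Rightarrow> real"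
  assumes y0: "continuous_on {0..} y" and t: "0 < t"
  defines "Y \<equiv> \<lambda>s. LBINT u:{0<..<s}. y u"
  shows "integrable \<nu> (\<lambda>r. Y t - Y (max (t - r) 0))"
    and "(LBINT s:{0<..<t}. levy_tail \<nu> (t - s) * y s) = (LINT r|\<nu>. Y t - Y (max (t - r) 0))"
proof -
  have y: "continuous_on {0..t} y" by (rule continuous_on_subset[OF y0]) auto
  have [measurable]: "(\<lambda>s. indicator {0..t} s * y s) \<in> borel_measurable borel"
    using borel_measurable_continuous_on_indicator[OF _ y] by simp
  have yi: "integrable lborel (\<lambda>s. indicator {0..t} s * y s)"
    using borel_integrable_compact[OF compact_Icc y] by (simp add: set_integrable_def)
  have yi': "integrable lborel (\<lambda>s. indicator A s * y s)" if A: "A \<in> sets borel" "A \<subseteq> {0..t}" for A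
  proof -
    have "integrable lborel (\<lambda>s. indicator A s * (indicator {0..t} s * y s))"
      using integrable_mult_indicator[OF _ yi, of A] A by simp
    also have "(\<lambda>s. indicator A s * (indicator {0..t} s * y s)) = (\<lambda>s. indicator A s * y s)"
      using A by (auto simp: indicator_def of_bool_def fun_eq_iff subset_iff)
    finally show ?thesis .
  qed
  define f where "f = (\<lambda>s r. indicator {0<..<t} s * (if t - s < r then 1 else 0) * (indicator {0..t} s * y s))"
  have tail: "(LINT r|\<nu>. (if t - s < r then 1 else 0)) = levy_tail \<nu> (t - s)" for s
  proof -
    have "(LINT r|\<nu>. (if t - s < r then 1 else 0)) = (LINT r|\<nu>. indicator {t - s<..} r)"
      by (rule Bochner_Integration.integral_cong) auto
    also have "\<dots> = levy_tail \<nu> (t - s)" by (simp add: levy_tail_def)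
    finally show ?thesis .
  qed
  have taili: "integrable \<nu> (\<lambda>r. (if t - s < r then 1 else 0) :: real)" if "s < t" for s
  proof -
    have "integrable \<nu> (indicator {t - s<..} :: _ \<Rightarrow> real)"
      using emeasure_tail[of "t - s"] that by (simp add: sets_nu)
    also have "(indicator {t - s<..} :: _ \<Rightarrow> real) = (\<lambda>r. (if t - s < r then 1 else 0))" by auto
    finally show ?thesis .
  qed
  have inner1: "(LINT r|\<nu>. f s r) = indicator {0<..<t} s * levy_tail \<nu> (t - s) * y s" for s
    using tail[of s] by (auto simp: f_def indicator_def)
  have intf: "integrable (lborel \<Otimes>\<^sub>M \<nu>) (\<lambda>(s,r). f s r)"
  proof (rule lborel_nu.Fubini_integrable)
    show "(\<lambda>(s,r). f s r) \<in> borel_measurable (lborel \<Otimes>\<^sub>M \<nu>)" unfolding f_def by measurable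
    have "(LINT r|\<nu>. norm (f s r)) = norm (indicator {0<..<t} s *\<^sub>R (levy_tail \<nu> (t - s) *\<^sub>R y s))" for s
    proof -
      have "(LINT r|\<nu>. norm (f s r)) = (LINT r|\<nu>. (if t - s < r then 1 else 0) * (indicator {0<..<t} s * \<bar>y s\<bar>))"
        by (rule Bochner_Integration.integral_cong) (auto simp: f_def indicator_def)
      then show ?thesis using tail_nonneg tail[of s] by (auto simp: abs_mult indicator_def)
    qed
    then show "integrable lborel (\<lambda>s. LINT r|\<nu>. norm (case (s, r) of (s, r) \<Rightarrow> f s r))"
      using set_integrable_convolution[OF y] by (auto simp: set_integrable_def simp del: real_scaleR_def intro: integrable_norm)
    show "AE s in lborel. integrable \<nu> (\<lambda>r. case (s, r) of (s, r) \<Rightarrow> f s r)"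
    proof (rule AE_I2)
      fix s show "integrable \<nu> (\<lambda>r. case (s, r) of (s, r) \<Rightarrow> f s r)"
        unfolding f_def using taili[of s] by (cases "s < t") auto
    qed
  qed
  have inner2: "(LINT s|lborel. f s r) = Y t - Y (max (t - r) 0)" if "0 < r" for r
  proof -
    let ?m = "max (t - r) 0"
    have m: "0 \<le> ?m" "?m < t" using that t by auto
    have "Y t - Y ?m = (LINT s|lborel. indicator {0<..<t} s * y s - indicator {0<..<?m} s * y s)"
      unfolding Y_def set_lebesgue_integral_def using m
      by (subst Bochner_Integration.integral_diff) (auto intro!: yi')
    also have "\<dots> = (LINT s|lborel. f s r)"
    proof (rule integral_cong_AE)
      show "(\<lambda>s. indicator {0<..<t} s * y s - indicator {0<..<?m} s * y s) \<in> borel_measurable lborel"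
        using m by (intro borel_measurable_diff borel_measurable_integrable[OF yi']) auto
      show "(\<lambda>s. f s r) \<in> borel_measurable lborel" unfolding f_def by measurable
      \<comment> \<open>The two sides differ at \<open>s = t - r\<close>: the open interval ending
        there excludes this point, and so does the strict inequality \<open>t - s < r\<close> in
        \<open>f\<close>.\<close>
      show "AE s in lborel. indicator {0<..<t} s * y s - indicator {0<..<?m} s * y s = f s r"
        using AE_lborel_singleton[of "t - r"] 
        by eventually_elim (use m in \<open>auto simp: f_def indicator_def\<close>)
    qed
    finally show ?thesis ..
  qed
  have ae: "AE r in \<nu>. (LINT s|lborel. f s r) = Y t - Y (max (t - r) 0)"
    using AE_nu_pos by eventually_elim (rule inner2)
  have Ym: "(\<lambda>r. Y t - Y (max (t - r) 0)) \<in> borel_measurable \<nu>"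
  proof -
    have [measurable]: "(\<lambda>u. indicator {0..} u * y u) \<in> borel_measurable borel"
      using borel_measurable_continuous_on_indicator[OF _ y0] by simp
    have "(\<lambda>s. LINT u|lborel. (if 0 < u \<and> u < s then 1 else 0) * (indicator {0..} u * y u)) \<in> borel_measurable borel"
      by measurable
    also have "(\<lambda>s. LINT u|lborel. (if 0 < u \<and> u < s then 1 else 0) * (indicator {0..} u * y u)) = Y"
      unfolding Y_def set_lebesgue_integral_def 
      by (intro ext Bochner_Integration.integral_cong) (auto simp: indicator_def)
    finally have [measurable]: "Y \<in> borel_measurable borel" .
    show ?thesis by measurable
  qed
  show "integrable \<nu> (\<lambda>r. Y t - Y (max (t - r) 0))"
    using lborel_nu.integrable_snd[OF intf] ae Ym
    by (subst integrable_cong_AE[where g="\<lambda>r. LINT s|lborel. f s r"]) (auto intro: borel_measurable_integrable)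
  have "(LBINT s:{0<..<t}. levy_tail \<nu> (t - s) * y s) = (LINT s|lborel. LINT r|\<nu>. f s r)"
    unfolding inner1 by (simp add: set_lebesgue_integral_def mult.assoc)
  also have "\<dots> = (LINT r|\<nu>. LINT s|lborel. f s r)"
    using lborel_nu.Fubini_integral[OF intf] by simp
  also have "\<dots> = (LINT r|\<nu>. Y t - Y (max (t - r) 0))"
    using ae Ym lborel_nu.integrable_snd[OF intf] by (intro integral_cong_AE) auto
  finally show "(LBINT s:{0<..<t}. levy_tail \<nu> (t - s) * y s) = (LINT r|\<nu>. Y t - Y (max (t - r) 0))" .
qed

end

section \<open>The inverse subordinator\<close>

text \<open>Strict monotonicity of \<open>h\<close> is what makes \<open>e\<close> continuous: a
  flat stretch of \<open>h\<close> would be a jump of \<open>e\<close>, while jumps of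
  \<open>h\<close> merely become flat stretches of \<open>e\<close>.\<close>

lemma inverse_path:
  fixes h :: "real \<Rightarrow> real"
  assumes strict: "strict_mono_on {0..} h" and unbdd: "\<And>x. \<exists>s>0. x < h s"
  defines "e \<equiv> \<lambda>t. Inf {s. 0 < s \<and> t < h s}"
  shows inverse_path_nonneg: "0 \<le> e t"
    and inverse_path_le: "0 < s \<Longrightarrow> t < h s \<Longrightarrow> e t \<le> s"
    and inverse_path_less: "e t < s \<Longrightarrow> t < h s"
    and inverse_path_tendsto: "(e \<longlongrightarrow> e t) (at t)"
    and inverse_path_zero: "h 0 = 0 \<Longrightarrow> e 0 = 0"
proof -
  have ne: "{s. 0 < s \<and> t < h s} \<noteq> {}" for t using unbdd by blast
  have bdd: "bdd_below {s. 0 < s \<and> t < h s}" for t by (rule bdd_belowI[of _ 0]) auto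
  show nonneg: "0 \<le> e t" for t unfolding e_def using ne by (intro cInf_greatest) auto
  show le: "e t \<le> s" if "0 < s" "t < h s" for s t unfolding e_def using that bdd by (intro cInf_lower) auto
  show less: "t < h s" if lt: "e t < s" for s t
  proof -
    obtain r where r: "0 < r" "t < h r" "r < s"
      using lt unfolding e_def cInf_less_iff[OF ne bdd] by auto
    then have "h r < h s" using strict by (auto intro: strict_mono_onD)
    with r show ?thesis by simp
  qed
  show "(e \<longlongrightarrow> e t) (at t)"
  proof (rule order_tendstoI)
    fix a assume a: "a < e t"
    show "\<forall>\<^sub>F x in at t. a < e x"
    proof (cases "a < 0")
      case True
      then have "a < e x" for x using nonneg[of x] by simp
      then show ?thesis by simp
    next
      case False
      obtain s1 where s1: "a < s1" "s1 < e t" using a dense by blast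
      obtain s2 where s2: "s1 < s2" "s2 < e t" using s1 dense by blast
      have "h s1 < h s2" using strict False s1 s2 by (auto intro: strict_mono_onD)
      moreover have "\<not> t < h s2" using le[of s2 t] s1 s2 False by auto
      ultimately have "h s1 < t" by simp
      then have "\<forall>\<^sub>F x in at t. h s1 < x" by (intro order_tendstoD) auto
      then show ?thesis
      proof eventually_elim
        case (elim x)
        have "s1 \<le> e x" unfolding e_def
        proof (rule cInf_greatest[OF ne])
          fix s assume s: "s \<in> {s. 0 < s \<and> x < h s}"
          show "s1 \<le> s"
          proof (rule ccontr)
            assume "\<not> s1 \<le> s"
            then have "h s < h s1" using strict s by (auto intro: strict_mono_onD)
            then show False using s elim by auto
          qed
        qed
        then show ?case using s1 by simp
      qed
    qed
  next
    fix a assume "e t < a"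
    then obtain s where s: "e t < s" "s < a" using dense by blast
    have "\<forall>\<^sub>F x in at t. x < h s" using less[OF s(1)] by (intro order_tendstoD) auto
    then show "\<forall>\<^sub>F x in at t. e x < a"
    proof eventually_elim
      case (elim x)
      have "0 < s" using nonneg[of t] s by linarith
      then show ?case using le[OF _ elim] s by force
    qed
  qed
  show "e 0 = 0" if "h 0 = 0"
  proof (rule antisym[OF _ nonneg], rule field_le_epsilon)
    fix s :: real assume "0 < s"
    then have "h 0 < h s" using strict by (auto intro: strict_mono_onD)
    then show "e 0 \<le> 0 + s" using le[of s 0] \<open>0 < s\<close> that by simp
  qed
qed

section \<open>Almost sure properties of the paths\<close>

locale inverse_subordinator_density = infinite_levy_measure \<nu>
  for \<nu> :: "real measure" +
  fixes M :: "'a measure" and b :: real and H :: "real \<Rightarrow> 'a \<Rightarrow> real" and m :: "real \<Rightarrow> real \<Rightarrow> real"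
  assumes b: "0 \<le> b"
    and sub: "subordinator M H (bernstein b \<nu>)"
    and m_nonneg: "\<And>s t. t > 0 \<Longrightarrow> m s t \<ge> 0"
    and m_density: "\<And>t. t > 0 \<Longrightarrow>
          distributed M lborel (inverse_subordinator H t) (\<lambda>s. ennreal (m s t))"
begin

sublocale M: prob_space M using sub by (simp add: subordinator_def)
sublocale lborel_M: pair_sigma_finite lborel M ..

abbreviation "g \<equiv> bernstein b \<nu>"

lemma g_pos: "0 < \<theta> \<Longrightarrow> 0 < g \<theta>" using bernstein_pos[OF b] .

lemma measurable_H: "0 \<le> t \<Longrightarrow> H t \<in> borel_measurable M"
  using sub by (simp add: subordinator_def)

lemma AE_path: "AE \<omega> in M. H 0 \<omega> = 0 \<and> mono_on {0..} (\<lambda>t. H t \<omega>)"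
proof -
  have "AE \<omega> in M. H 0 \<omega> = 0 \<and> mono_on {0..} (\<lambda>t. H t \<omega>) \<and>
        (\<forall>t\<ge>0. continuous (at_right t) (\<lambda>s. H s \<omega>))"
    using sub by (simp only: subordinator_def)
  then show ?thesis by eventually_elim auto
qed

lemma AE_H_nonneg: "AE \<omega> in M. \<forall>t\<ge>0. 0 \<le> H t \<omega>"
  using AE_path
proof eventually_elim
  case (elim \<omega>)
  show ?case
  proof (intro allI impI)
    fix t :: real assume "0 \<le> t"
    then have "H 0 \<omega> \<le> H t \<omega>" using elim by (intro mono_onD[of "{0..}" "\<lambda>t. H t \<omega>"]) auto
    then show "0 \<le> H t \<omega>" using elim by simp
  qed
qed

lemma laplace_H: "0 \<le> t \<Longrightarrow> 0 \<le> \<theta> \<Longrightarrow> (LINT \<omega>|M. exp (- (\<theta> * H t \<omega>))) = exp (- (t * g \<theta>))"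
  using sub by (simp add: subordinator_def)

lemma integrable_exp_H: "0 \<le> t \<Longrightarrow> 0 \<le> \<theta> \<Longrightarrow> integrable M (\<lambda>\<omega>. exp (- (\<theta> * H t \<omega>)))"
proof (rule M.integrable_const_bound[where B=1])
  assume t: "0 \<le> t" and \<theta>: "0 \<le> \<theta>"
  show "AE \<omega> in M. norm (exp (- (\<theta> * H t \<omega>))) \<le> 1"
    using AE_H_nonneg by eventually_elim (use t \<theta> in simp)
  show "(\<lambda>\<omega>. exp (- (\<theta> * H t \<omega>))) \<in> borel_measurable M"
    using measurable_H[OF t] by measurable
qed

text \<open>The exponential Markov (Chernoff) bound. Large \<open>\<theta>\<close> at
  \<open>x = 0\<close> will exclude an atom of \<open>H t\<close> at 0; \<open>\<theta> = 1\<close>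
  and large \<open>t\<close> will show that paths are unbounded.\<close>

lemma prob_H_le:
  assumes "0 \<le> t" "0 \<le> \<theta>"
  shows "M.prob {\<omega>\<in>space M. H t \<omega> \<le> x} \<le> exp (\<theta> * x) * exp (- (t * g \<theta>))"
proof -
  note measurable_H[OF assms(1), measurable]
  have "M.prob {\<omega>\<in>space M. H t \<omega> \<le> x} = (LINT \<omega>|M. indicator {\<omega>\<in>space M. H t \<omega> \<le> x} \<omega>)"
    by simp
  also have "\<dots> \<le> (LINT \<omega>|M. exp (\<theta> * x) * exp (- (\<theta> * H t \<omega>)))"
  proof (rule integral_mono)
    show "integrable M (\<lambda>\<omega>. exp (\<theta> * x) * exp (- (\<theta> * H t \<omega>)))"
      using integrable_exp_H[OF assms] by simp
    show "indicator {\<omega>\<in>space M. H t \<omega> \<le> x} \<omega> \<le> exp (\<theta> * x) * exp (- (\<theta> * H t \<omega>))" for \<omega>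
      using assms by (auto simp: indicator_def mult_exp_exp mult_left_mono)
  qed (auto intro!: integrable_real_indicator simp: M.emeasure_eq_measure)
  also have "\<dots> = exp (\<theta> * x) * exp (- (t * g \<theta>))" using laplace_H[OF assms] by simp
  finally show ?thesis .
qed

text \<open>The Chernoff bound at \<open>x = 0\<close> is \<open>exp (- (t * g \<theta>))\<close>,
  which can be made arbitrarily small because \<open>g\<close> is unbounded: infinitely many small
  jumps leave no chance of staying at 0.\<close>

lemma prob_H_le_0:
  assumes "0 < t"
  shows "M.prob {\<omega>\<in>space M. H t \<omega> \<le> 0} = 0"
proof (rule ccontr)
  define p where "p = M.prob {\<omega>\<in>space M. H t \<omega> \<le> 0}"
  assume "M.prob {\<omega>\<in>space M. H t \<omega> \<le> 0} \<noteq> 0"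
  then have p: "0 < p" unfolding p_def by (simp add: zero_less_measure_iff)
  \<comment> \<open>The threshold is chosen so that \<open>exp (- (t * g \<theta>))\<close> is at
    most \<open>p / e\<close>, hence below \<open>p\<close>.\<close>
  obtain \<theta> where \<theta>: "0 < \<theta>" "(1 - ln p) / t \<le> g \<theta>" using bernstein_unbounded[OF b] by blast
  have "p \<le> exp (- (t * g \<theta>))" using prob_H_le[of t \<theta> 0] assms \<theta>(1) by (simp add: p_def)
  also have "\<dots> \<le> exp (ln p - 1)" using \<theta>(2) assms by (simp add: field_simps)
  also have "\<dots> < exp (ln p)" by (subst exp_less_cancel_iff) simp
  also have "\<dots> = p" using p by simp
  finally show False by simp
qed

lemma AE_H_less:
  assumes "0 \<le> s" "s < t"
  shows "AE \<omega> in M. H s \<omega> < H t \<omega>"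
proof -
  note [measurable] = measurable_H[OF assms(1)] measurable_H[of t] measurable_H[of "t - s"]
  have [measurable]: "H t \<in> borel_measurable M" "H (t - s) \<in> borel_measurable M" using assms by auto
  have "distr M borel (\<lambda>\<omega>. H t \<omega> - H s \<omega>) = distr M borel (H (t - s))"
    using sub assms by (simp add: subordinator_def)
  then have "measure (distr M borel (\<lambda>\<omega>. H t \<omega> - H s \<omega>)) {..0} = measure (distr M borel (H (t - s))) {..0}"
    by simp
  then have "M.prob {\<omega>\<in>space M. H t \<omega> - H s \<omega> \<le> 0} = M.prob {\<omega>\<in>space M. H (t - s) \<omega> \<le> 0}"
    by (subst (asm) (1 2) measure_distr) (auto simp: vimage_def Int_def conj_commute)
  then have "M.prob {\<omega>\<in>space M. \<not> H s \<omega> < H t \<omega>} = 0"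
    using prob_H_le_0[of "t - s"] assms by (simp add: not_less)
  then have "AE \<omega> in M. \<omega> \<notin> {\<omega>\<in>space M. \<not> H s \<omega> < H t \<omega>}"
    by (intro AE_not_in) (auto simp: null_sets_def M.emeasure_eq_measure)
  then show ?thesis by (auto elim: AE_mp)
qed

text \<open>Only countably many exceptional sets can be collected, so strict growth is secured for
  rational pairs. Between arbitrary \<open>s < t\<close> lie two rationals \<open>p < q\<close>, and
  monotonicity of the path carries the strict inequality over.\<close>

lemma AE_H_strict_mono: "AE \<omega> in M. strict_mono_on {0..} (\<lambda>t. H t \<omega>)"
proof -
  have "AE \<omega> in M. \<forall>p\<in>{(s,t). s \<in> \<rat> \<and> t \<in> \<rat> \<and> 0 \<le> s \<and> s < (t::real)}. H (fst p) \<omega> < H (snd p) \<omega>"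
  proof (subst AE_ball_countable)
    have "countable (\<rat> \<times> \<rat> :: (real \<times> real) set)" using countable_rat by blast
    then show "countable {(s,t). s \<in> \<rat> \<and> t \<in> \<rat> \<and> 0 \<le> s \<and> s < (t::real)}"
      by (rule countable_subset[rotated]) auto
  qed (use AE_H_less in auto)
  with AE_path show ?thesis
  proof eventually_elim
    case (elim \<omega>)
    show ?case
    proof (rule strict_mono_onI)
      fix s t :: real assume st: "s \<in> {0..}" "t \<in> {0..}" "s < t"
      obtain p where p: "p \<in> \<rat>" "s < p" "p < t" using Rats_dense_in_real[OF st(3)] by auto
      obtain q where q: "q \<in> \<rat>" "p < q" "q < t" using Rats_dense_in_real[OF p(3)] by auto
      have "H s \<omega> \<le> H p \<omega>" "H q \<omega> \<le> H t \<omega>"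
        using elim p q st by (auto simp: mono_on_def)
      moreover have "H p \<omega> < H q \<omega>" using elim p q st by force
      ultimately show "H s \<omega> < H t \<omega>" by simp
    qed
  qed
qed

text \<open>The probability of staying below \<open>k\<close> at all positive integer times is at
  most \<open>exp (real k) * exp (- g 1) ^ Suc n\<close> for every \<open>n\<close>, and
  \<open>g 1\<close> is positive.\<close>

lemma AE_H_unbounded: "AE \<omega> in M. \<forall>x. \<exists>s>0. x < H s \<omega>"
proof -
  have "AE \<omega> in M. \<exists>s>0. real k < H s \<omega>" for k :: nat
  proof -
    let ?A = "{\<omega>\<in>space M. \<forall>n. H (real (Suc n)) \<omega> \<le> real k}"
        have [measurable]: "H (real (Suc n)) \<in> borel_measurable M" for n by (rule measurable_H) simp
    have A: "?A \<in> sets M" by measurable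
    have "M.prob ?A \<le> exp (real k) * exp (- g 1) ^ Suc n" for n
    proof -
      have "M.prob ?A \<le> M.prob {\<omega>\<in>space M. H (real (Suc n)) \<omega> \<le> real k}"
        by (rule M.finite_measure_mono) (auto simp del: of_nat_Suc)
      also have "\<dots> \<le> exp (1 * real k) * exp (- (real (Suc n) * g 1))" by (rule prob_H_le) auto
      finally show ?thesis by (simp only: exp_of_nat_mult[symmetric]) simp
    qed
    moreover have "(\<lambda>n. exp (real k) * exp (- g 1) ^ Suc n) \<longlonglongrightarrow> exp (real k) * 0"
      using g_pos[of 1] by (intro tendsto_intros LIMSEQ_Suc LIMSEQ_power_zero) auto
    ultimately have "M.prob ?A \<le> 0" using LIMSEQ_le_const by fastforce
    then have "AE \<omega> in M. \<omega> \<notin> ?A"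
      using A by (intro AE_not_in) (auto simp: null_sets_def M.emeasure_eq_measure measure_le_0_iff)
    then show ?thesis
      by (rule AE_mp) (auto intro!: AE_I2 simp: not_le intro: exI[of _ "real (Suc _)"])
  qed
  then have "AE \<omega> in M. \<forall>k::nat. \<exists>s>0. real k < H s \<omega>" by (simp add: AE_all_countable)
  then show ?thesis
    by eventually_elim (meson less_trans reals_Archimedean2)
qed

text \<open>At \<open>t = 0\<close> the inverse subordinator is \<open>0\<close> only almost surely and need not be measurable;
  \<open>E0\<close> replaces it by \<open>0\<close> for all \<open>t \<le> 0\<close>, so that \<open>d \<mu>\<close> below is continuous on the whole line.\<close>

definition E0 :: "real \<Rightarrow> 'a \<Rightarrow> real" where
  "E0 t \<omega> = (if t \<le> 0 then 0 else inverse_subordinator H t \<omega>)"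

lemma measurable_E0 [measurable]: "E0 t \<in> borel_measurable M"
proof (cases "t \<le> 0")
  case False
  then have "inverse_subordinator H t \<in> borel_measurable M"
    using distributed_measurable[OF m_density[of t]] by simp
  then show ?thesis using False by (simp add: E0_def[abs_def])
qed (simp add: E0_def[abs_def])

text \<open>The case \<open>E0 t \<omega> = s\<close> is compatible both with
  \<open>t < H s \<omega>\<close> and with its negation, so the pathwise statement consists of two
  implications that leave this case open. It is discarded later, since a law with a density has no
  atoms.\<close>

lemma AE_E0:
  "AE \<omega> in M. continuous_on UNIV (\<lambda>t. E0 t \<omega>) \<and> (\<forall>t. 0 \<le> E0 t \<omega>) \<and>
    (\<forall>t>0. \<forall>s>0. (E0 t \<omega> < s \<longrightarrow> t < H s \<omega>) \<and> (t < H s \<omega> \<longrightarrow> E0 t \<omega> \<le> s))"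
  using AE_H_unbounded AE_H_strict_mono AE_path
proof eventually_elim
  case (elim \<omega>)
  let ?e = "\<lambda>t. Inf {s. 0 < s \<and> t < H s \<omega>}"
  have unb: "\<exists>s>0. x < H s \<omega>" for x using elim by blast
  note e = inverse_path[of "\<lambda>s. H s \<omega>", OF elim(2) unb]
  have eq: "E0 t \<omega> = ?e (max t 0)" for t
    using e(5) elim by (auto simp: E0_def inverse_subordinator_def max_def)
  have "continuous_on UNIV ?e" using e(4) by (simp add: continuous_on_def)
  then have "continuous_on UNIV (\<lambda>t. ?e (max t 0))"
    by (rule continuous_on_compose2) (auto intro!: continuous_intros)
  moreover have "t < H s \<omega>" if "0 < t" "?e (max t 0) < s" for s t using e(3)[of t s] that by simp
  moreover have "?e (max t 0) \<le> s" if "0 < t" "0 < s" "t < H s \<omega>" for s t using e(2)[of s t] that by simp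
  ultimately show ?case using e(1) unfolding eq by blast
qed

section \<open>Laplace transforms of the inverse subordinator in space and time\<close>

definition d :: "real \<Rightarrow> real \<Rightarrow> real" where
  "d \<mu> t = (LINT \<omega>|M. exp (- (\<mu> * E0 t \<omega>)))"

lemma d_nonpos: "t \<le> 0 \<Longrightarrow> d \<mu> t = 1" by (simp add: d_def E0_def M.prob_space)

lemma AE_exp_E0_le: "0 \<le> \<mu> \<Longrightarrow> AE \<omega> in M. norm (exp (- (\<mu> * E0 t \<omega>))) \<le> 1"
proof -
  assume "0 \<le> \<mu>"
  show ?thesis using AE_E0 by eventually_elim (use \<open>0 \<le> \<mu>\<close> in simp)
qed

lemma d_nonneg: "0 \<le> d \<mu> t" by (simp add: d_def)

lemma d_le_1: "0 \<le> \<mu> \<Longrightarrow> d \<mu> t \<le> 1"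
proof -
  assume \<mu>: "0 \<le> \<mu>"
  have "integrable M (\<lambda>\<omega>. exp (- (\<mu> * E0 t \<omega>)))"
    by (rule M.integrable_const_bound[OF AE_exp_E0_le[OF \<mu>]]) measurable
  moreover have "AE \<omega> in M. exp (- (\<mu> * E0 t \<omega>)) \<le> 1"
    using AE_exp_E0_le[OF \<mu>] by eventually_elim simp
  ultimately show ?thesis unfolding d_def by (rule M.integral_le_const)
qed

lemma continuous_on_d: "0 \<le> \<mu> \<Longrightarrow> continuous_on A (d \<mu>)"
proof (rule continuous_on_sequentiallyI)
  fix X :: "nat \<Rightarrow> real" and t assume \<mu>: "0 \<le> \<mu>" and X: "X \<longlonglongrightarrow> t"
  show "(\<lambda>n. d \<mu> (X n)) \<longlonglongrightarrow> d \<mu> t" unfolding d_def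
  proof (rule integral_dominated_convergence[where w="\<lambda>_. 1"])
    show "AE \<omega> in M. (\<lambda>n. exp (- (\<mu> * E0 (X n) \<omega>))) \<longlonglongrightarrow> exp (- (\<mu> * E0 t \<omega>))"
      using AE_E0
    proof eventually_elim
      case (elim \<omega>)
      then have "(\<lambda>n. E0 (X n) \<omega>) \<longlonglongrightarrow> E0 t \<omega>"
        using continuous_on_tendsto_compose[of UNIV "\<lambda>t. E0 t \<omega>", OF _ X] by auto
      then show ?case by (intro tendsto_intros)
    qed
  qed (use AE_exp_E0_le[OF \<mu>] in auto)
qed

lemma measurable_d [measurable]: "0 \<le> \<mu> \<Longrightarrow> d \<mu> \<in> borel_measurable borel"
  by (rule borel_measurable_continuous_onI) (rule continuous_on_d)

text \<open>The value 0 for \<open>s \<le> 0\<close> makes the function nondecreasing in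
  \<open>s\<close> on the whole line; nothing is known about \<open>H\<close> at negative
  times.\<close>

definition H_tail :: "real \<Rightarrow> real \<Rightarrow> real" where
  "H_tail s t = (if s \<le> 0 then 0 else M.prob {\<omega>\<in>space M. t < H s \<omega>})"

lemma mono_H_tail: "mono (\<lambda>s. H_tail s t)"
proof (rule monoI)
  fix r s :: real assume "r \<le> s"
  show "H_tail r t \<le> H_tail s t"
  proof (cases "r \<le> 0")
    case False
    note [measurable] = measurable_H[of r] measurable_H[of s]
    have "M.prob {\<omega>\<in>space M. t < H r \<omega>} \<le> M.prob {\<omega>\<in>space M. t < H s \<omega>}"
    proof (rule M.finite_measure_mono_AE)
      show "AE \<omega> in M. \<omega> \<in> {\<omega>\<in>space M. t < H r \<omega>} \<longrightarrow> \<omega> \<in> {\<omega>\<in>space M. t < H s \<omega>}"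
        using AE_path
      proof eventually_elim
        case (elim \<omega>)
        then have "H r \<omega> \<le> H s \<omega>" using False \<open>r \<le> s\<close> by (auto simp: mono_on_def)
        then show ?case by auto
      qed
      show "{\<omega>\<in>space M. t < H s \<omega>} \<in> sets M" using measurable_H[of s] False \<open>r \<le> s\<close> by simp
    qed
    then show ?thesis using False \<open>r \<le> s\<close> by (simp add: H_tail_def)
  qed (auto simp: H_tail_def)
qed

text \<open>In \<open>s\<close> the function is monotone, hence measurable; in \<open>t\<close> it
  is one minus a distribution function, hence right continuous. Together this is the situation of
  \<open>borel_measurable_pair_right_continuous\<close>.\<close>

lemma measurable_H_tail [measurable]: "(\<lambda>(s,t). H_tail s t) \<in> borel_measurable (lborel \<Otimes>\<^sub>M borel)"
proof (rule borel_measurable_pair_right_continuous)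
  show "(\<lambda>s. H_tail s t) \<in> borel_measurable lborel" for t
    using borel_measurable_mono[OF mono_H_tail] by simp
  show "continuous (at_right t) (H_tail s)" for s t
  proof (cases "s \<le> 0")
    case False
    then have [measurable]: "H s \<in> borel_measurable M" by (intro measurable_H) auto
    interpret D: prob_space "distr M borel (H s)" by (rule M.prob_space_distr) simp
    interpret D: finite_borel_measure "distr M borel (H s)" by standard simp
    have "H_tail s x = 1 - cdf (distr M borel (H s)) x" for x
    proof -
      have "1 - cdf (distr M borel (H s)) x = measure (distr M borel (H s)) (UNIV - {..x})"
        using D.prob_compl[of "{..x}"] by (simp add: cdf_def)
      also have "\<dots> = M.prob {\<omega>\<in>space M. x < H s \<omega>}"
        by (subst measure_distr) (auto intro!: arg_cong[where f="M.prob"])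
      finally show ?thesis using False by (simp add: H_tail_def)
    qed
    then have "H_tail s = (\<lambda>x. 1 - cdf (distr M borel (H s)) x)" by auto
    then show ?thesis using D.cdf_is_right_cont[of t] by (auto intro!: continuous_intros)
  qed (simp add: H_tail_def[abs_def])
qed

text \<open>A law with a density gives no mass to points. This is used at \<open>s > 0\<close> to
  identify \<open>E0 t < s\<close> with \<open>t < H s\<close>, and at \<open>s = 0\<close> to
  confine the density to \<open>y > 0\<close>.\<close>

lemma AE_inverse_subordinator_neq:
  assumes t: "0 < t"
  shows "AE \<omega> in M. inverse_subordinator H t \<omega> \<noteq> s"
proof -
  have "AE x in density lborel (\<lambda>s. ennreal (m s t)). x \<noteq> s"
    using AE_lborel_singleton[of s] distributed_borel_measurable[OF m_density[OF t]]
    by (subst AE_density) (auto elim!: eventually_mono)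
  then have "AE x in distr M lborel (inverse_subordinator H t). x \<noteq> s"
    unfolding distributed_distr_eq_density[OF m_density[OF t]] .
  then show "AE \<omega> in M. inverse_subordinator H t \<omega> \<noteq> s"
    using AE_distr_iff[OF distributed_measurable[OF m_density[OF t]], of "\<lambda>x. x \<noteq> s"] by simp
qed

lemma prob_E0_less:
  assumes t: "0 < t" and s: "0 < s"
  shows "emeasure M {\<omega>\<in>space M. E0 t \<omega> < s} = ennreal (H_tail s t)"
proof -
  note [measurable] = measurable_H[OF less_imp_le[OF s]]
  from AE_inverse_subordinator_neq[OF t, of s]
  have "AE \<omega> in M. E0 t \<omega> < s \<longleftrightarrow> t < H s \<omega>"
    using AE_E0
  proof eventually_elim
    case (elim \<omega>)
    have "E0 t \<omega> \<noteq> s" using elim(1) t by (simp add: E0_def)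
    moreover have "(E0 t \<omega> < s \<longrightarrow> t < H s \<omega>) \<and> (t < H s \<omega> \<longrightarrow> E0 t \<omega> \<le> s)"
      using elim(2) t s by blast
    ultimately show ?case by linarith
  qed
  then have "emeasure M {\<omega>\<in>space M. E0 t \<omega> < s} = emeasure M {\<omega>\<in>space M. t < H s \<omega>}"
    by (intro emeasure_eq_AE) (auto elim!: eventually_mono)
  then show ?thesis using s by (simp add: H_tail_def M.emeasure_eq_measure)
qed

text \<open>\<open>exp (- (\<mu> * E0 t \<omega>))\<close> is the mass that the exponential law of
  rate \<open>\<mu>\<close> puts beyond \<open>E0 t \<omega>\<close>. Tonelli leaves the probability
  of \<open>E0 t < s\<close>, that is of \<open>t < H s\<close>, so \<open>d\<close> is expressed
  through the law of \<open>H\<close> alone.\<close>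

lemma d_eq_H_tail:
  assumes t: "0 < t" and \<mu>: "0 < \<mu>"
  shows "ennreal (d \<mu> t) = (\<integral>\<^sup>+ s. ennreal (\<mu> * exp (- (\<mu> * s))) * indicator {0<..} s * ennreal (H_tail s t) \<partial>lborel)"
proof -
  have "ennreal (d \<mu> t) = (\<integral>\<^sup>+ \<omega>. ennreal (exp (- (\<mu> * E0 t \<omega>))) \<partial>M)"
    unfolding d_def using M.integrable_const_bound[OF AE_exp_E0_le[of \<mu> t]] \<mu>
    by (intro nn_integral_eq_integral[symmetric]) auto
  also have "\<dots> = (\<integral>\<^sup>+ \<omega>. \<integral>\<^sup>+ s. ennreal (\<mu> * exp (- (\<mu> * s))) * indicator {0<..} s * (if E0 t \<omega> < s then 1 else 0) \<partial>lborel \<partial>M)"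
  proof (rule nn_integral_cong_AE, use AE_E0 in eventually_elim)
    case (elim \<omega>)
    have "(\<integral>\<^sup>+ s. ennreal (\<mu> * exp (- (\<mu> * s))) * indicator {0<..} s * (if E0 t \<omega> < s then 1 else 0) \<partial>lborel)
      = (\<integral>\<^sup>+ s. ennreal (\<mu> * exp (- (\<mu> * s))) * indicator {E0 t \<omega><..} s \<partial>lborel)"
      using elim by (intro nn_integral_cong) (auto simp: indicator_def dest: le_less_trans)
    then show ?case using nn_integral_exp_Ioi[OF \<mu>] by simp
  qed
  also have "\<dots> = (\<integral>\<^sup>+ s. \<integral>\<^sup>+ \<omega>. ennreal (\<mu> * exp (- (\<mu> * s))) * indicator {0<..} s * (if E0 t \<omega> < s then 1 else 0) \<partial>M \<partial>lborel)"
    by (rule lborel_M.Fubini') measurable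
  also have "\<dots> = (\<integral>\<^sup>+ s. ennreal (\<mu> * exp (- (\<mu> * s))) * indicator {0<..} s * ennreal (H_tail s t) \<partial>lborel)"
  proof (rule nn_integral_cong)
    fix s :: real
    have "(\<integral>\<^sup>+ \<omega>. (if E0 t \<omega> < s then 1 else 0) \<partial>M) = (\<integral>\<^sup>+ \<omega>. indicator {\<omega>\<in>space M. E0 t \<omega> < s} \<omega> \<partial>M)"
      by (intro nn_integral_cong) auto
    also have "\<dots> = emeasure M {\<omega>\<in>space M. E0 t \<omega> < s}" by simp
    finally have "0 < s \<Longrightarrow> (\<integral>\<^sup>+ \<omega>. (if E0 t \<omega> < s then 1 else 0) \<partial>M) = ennreal (H_tail s t)"
      using prob_E0_less[OF t, of s] by simp
    then show "(\<integral>\<^sup>+ \<omega>. ennreal (\<mu> * exp (- (\<mu> * s))) * indicator {0<..} s * (if E0 t \<omega> < s then 1 else 0) \<partial>M)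
      = ennreal (\<mu> * exp (- (\<mu> * s))) * indicator {0<..} s * ennreal (H_tail s t)"
      by (subst nn_integral_cmult) (auto simp: indicator_def)
  qed
  finally show ?thesis .
qed

text \<open>On each path the condition \<open>t < H s \<omega>\<close> cuts the exponential integral
  at \<open>H s \<omega>\<close>, which gives
  \<open>(1 - exp (- (\<theta> * H s \<omega>))) / \<theta>\<close>; the expectation of this is
  known from the Laplace exponent.\<close>

lemma nn_integral_laplace_H_tail:
  assumes s: "0 < s" and \<theta>: "0 < \<theta>"
  shows "(\<integral>\<^sup>+ t. ennreal (exp (- (\<theta> * t))) * indicator {0<..} t * ennreal (H_tail s t) \<partial>lborel)
    = ennreal ((1 - exp (- (s * g \<theta>))) / \<theta>)"
proof -
  have [measurable]: "H s \<in> borel_measurable M" using s by (intro measurable_H) auto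
  have "(\<integral>\<^sup>+ t. ennreal (exp (- (\<theta> * t))) * indicator {0<..} t * ennreal (H_tail s t) \<partial>lborel)
    = (\<integral>\<^sup>+ t. \<integral>\<^sup>+ \<omega>. ennreal (exp (- (\<theta> * t))) * indicator {0<..} t * (if t < H s \<omega> then 1 else 0) \<partial>M \<partial>lborel)"
  proof (rule nn_integral_cong)
    fix t :: real
    have "(\<integral>\<^sup>+ \<omega>. (if t < H s \<omega> then 1 else 0) \<partial>M) = (\<integral>\<^sup>+ \<omega>. indicator {\<omega>\<in>space M. t < H s \<omega>} \<omega> \<partial>M)"
      by (intro nn_integral_cong) auto
    also have "\<dots> = ennreal (H_tail s t)" using s by (simp add: H_tail_def M.emeasure_eq_measure)
    finally show "ennreal (exp (- (\<theta> * t))) * indicator {0<..} t * ennreal (H_tail s t) =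
      (\<integral>\<^sup>+ \<omega>. ennreal (exp (- (\<theta> * t))) * indicator {0<..} t * (if t < H s \<omega> then 1 else 0) \<partial>M)"
      by (subst nn_integral_cmult) auto
  qed
  also have "\<dots> = (\<integral>\<^sup>+ \<omega>. \<integral>\<^sup>+ t. ennreal (exp (- (\<theta> * t))) * indicator {0<..} t * (if t < H s \<omega> then 1 else 0) \<partial>lborel \<partial>M)"
    by (rule lborel_M.Fubini'[symmetric]) measurable
  also have "\<dots> = (\<integral>\<^sup>+ \<omega>. ennreal ((1 - exp (- (\<theta> * H s \<omega>))) / \<theta>) \<partial>M)"
  proof (rule nn_integral_cong_AE, use AE_H_strict_mono AE_path in eventually_elim)
    case (elim \<omega>)
    then have H: "0 < H s \<omega>" using s strict_mono_onD[OF elim(1), of 0 s] by simp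
    have "(\<integral>\<^sup>+ t. ennreal (exp (- (\<theta> * t))) * indicator {0<..} t * (if t < H s \<omega> then 1 else 0) \<partial>lborel)
      = (\<integral>\<^sup>+ t. ennreal (exp (- (\<theta> * t))) * indicator {0<..<H s \<omega>} t \<partial>lborel)"
      by (rule nn_integral_cong) (auto simp: indicator_def)
    then show ?case using nn_integral_exp_interval[OF H \<theta>] by (simp add: mult.commute)
  qed
  also have "\<dots> = ennreal (LINT \<omega>|M. (1 - exp (- (\<theta> * H s \<omega>))) / \<theta>)"
  proof (rule nn_integral_eq_integral)
    show "integrable M (\<lambda>\<omega>. (1 - exp (- (\<theta> * H s \<omega>))) / \<theta>)"
      using integrable_exp_H[of s \<theta>] s \<theta> by auto
    show "AE \<omega> in M. 0 \<le> (1 - exp (- (\<theta> * H s \<omega>))) / \<theta>"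
      using AE_H_nonneg by eventually_elim (use s \<theta> in auto)
  qed
  also have "(LINT \<omega>|M. (1 - exp (- (\<theta> * H s \<omega>))) / \<theta>) = (1 - exp (- (s * g \<theta>))) / \<theta>"
    using laplace_H[of s \<theta>] integrable_exp_H[of s \<theta>] s \<theta> by (simp add: M.prob_space)
  finally show ?thesis .
qed

text \<open>Tonelli in \<open>s\<close> and \<open>t\<close> combines \<open>d_eq_H_tail\<close>
  with \<open>nn_integral_laplace_H_tail\<close> and leaves an integral of exponentials. The case
  \<open>\<mu> = 0\<close> stands apart because the exponential law of rate \<open>\<mu>\<close>
  degenerates there.\<close>

lemma nn_integral_laplace_d:
  assumes \<theta>: "0 < \<theta>" and \<mu>: "0 \<le> \<mu>"
  shows "(\<integral>\<^sup>+ t. ennreal (exp (- (\<theta> * t)) * d \<mu> t) * indicator {0<..} t \<partial>lborel)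
    = ennreal ((g \<theta> / \<theta>) / (g \<theta> + \<mu>))"
proof (cases "\<mu> = 0")
  case True
  have "(\<integral>\<^sup>+ t. ennreal (exp (- (\<theta> * t)) * d \<mu> t) * indicator {0<..} t \<partial>lborel)
    = (\<integral>\<^sup>+ t. ennreal (1 / \<theta>) * (ennreal (\<theta> * exp (- (\<theta> * t))) * indicator {0<..} t) \<partial>lborel)"
    using \<theta> True by (intro nn_integral_cong) 
      (simp add: d_def M.prob_space ennreal_mult[symmetric] mult.assoc[symmetric])
  also have "\<dots> = ennreal (1 / \<theta>)" using nn_integral_exp_Ioi[OF \<theta>, of 0] by (simp add: nn_integral_cmult)
  finally show ?thesis using True g_pos[OF \<theta>] by simp
next
  case False
  with \<mu> have l: "0 < \<mu>" by simp
  note g = g_pos[OF \<theta>]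
  have "(\<integral>\<^sup>+ t. ennreal (exp (- (\<theta> * t)) * d \<mu> t) * indicator {0<..} t \<partial>lborel)
    = (\<integral>\<^sup>+ t. \<integral>\<^sup>+ s. ennreal (exp (- (\<theta> * t))) * indicator {0<..} t * 
        (ennreal (\<mu> * exp (- (\<mu> * s))) * indicator {0<..} s * ennreal (H_tail s t)) \<partial>lborel \<partial>lborel)"
  proof (rule nn_integral_cong)
    fix t :: real
    show "ennreal (exp (- (\<theta> * t)) * d \<mu> t) * indicator {0<..} t = (\<integral>\<^sup>+ s. ennreal (exp (- (\<theta> * t))) * indicator {0<..} t * 
        (ennreal (\<mu> * exp (- (\<mu> * s))) * indicator {0<..} s * ennreal (H_tail s t)) \<partial>lborel)"
      using d_eq_H_tail[OF _ l, of t] d_nonneg[of \<mu> t] 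
      by (subst nn_integral_cmult) (auto simp: ennreal_mult indicator_def)
  qed
  also have "\<dots> = (\<integral>\<^sup>+ s. \<integral>\<^sup>+ t. ennreal (exp (- (\<theta> * t))) * indicator {0<..} t * 
        (ennreal (\<mu> * exp (- (\<mu> * s))) * indicator {0<..} s * ennreal (H_tail s t)) \<partial>lborel \<partial>lborel)"
    by (rule lborel_pair.Fubini') measurable
  also have "\<dots> = (\<integral>\<^sup>+ s. ennreal (\<mu> * exp (- (\<mu> * s)) * ((1 - exp (- (s * g \<theta>))) / \<theta>)) * indicator {0..} s \<partial>lborel)"
  proof (rule nn_integral_cong_AE, use AE_lborel_singleton[of 0] in eventually_elim)
    case (elim s)
    have "(\<integral>\<^sup>+ t. ennreal (exp (- (\<theta> * t))) * indicator {0<..} t * 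
        (ennreal (\<mu> * exp (- (\<mu> * s))) * indicator {0<..} s * ennreal (H_tail s t)) \<partial>lborel)
      = (\<integral>\<^sup>+ t. ennreal (\<mu> * exp (- (\<mu> * s))) * indicator {0<..} s * 
        (ennreal (exp (- (\<theta> * t))) * indicator {0<..} t * ennreal (H_tail s t)) \<partial>lborel)"
      by (simp add: mult_ac)
    also have "\<dots> = ennreal (\<mu> * exp (- (\<mu> * s))) * indicator {0<..} s *
      (\<integral>\<^sup>+ t. ennreal (exp (- (\<theta> * t))) * indicator {0<..} t * ennreal (H_tail s t) \<partial>lborel)"
      by (rule nn_integral_cmult) measurable
    also have "\<dots> = ennreal (\<mu> * exp (- (\<mu> * s)) * ((1 - exp (- (s * g \<theta>))) / \<theta>)) * indicator {0..} s"
      using nn_integral_laplace_H_tail[OF _ \<theta>, of s] elim l \<theta> g by (auto simp: indicator_def ennreal_mult[symmetric])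
    finally show ?case .
  qed
  also have "\<dots> = ennreal (0 - ((- exp (- (\<mu> * 0)) + \<mu> / (\<mu> + g \<theta>) * exp (- ((\<mu> + g \<theta>) * 0))) / \<theta>))"
  proof (rule nn_integral_FTC_atLeast)
    show "((\<lambda>s. (- exp (- (\<mu> * s)) + \<mu> / (\<mu> + g \<theta>) * exp (- ((\<mu> + g \<theta>) * s))) / \<theta>) \<longlongrightarrow> 0) at_top"
    proof -
      have e: "((\<lambda>s::real. exp (- (c * s))) \<longlongrightarrow> 0) at_top" if "0 < c" for c
        using that by real_asymp
      have "((\<lambda>s. (- exp (- (\<mu> * s)) + \<mu> / (\<mu> + g \<theta>) * exp (- ((\<mu> + g \<theta>) * s))) / \<theta>)
          \<longlongrightarrow> (- 0 + \<mu> / (\<mu> + g \<theta>) * 0) / \<theta>) at_top"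
        by (intro tendsto_divide tendsto_add tendsto_mult tendsto_minus tendsto_const e l add_pos_pos g)
          (use \<theta> in simp)
      then show ?thesis by simp
    qed
    show "((\<lambda>s. (- exp (- (\<mu> * s)) + \<mu> / (\<mu> + g \<theta>) * exp (- ((\<mu> + g \<theta>) * s))) / \<theta>) has_real_derivative
      \<mu> * exp (- (\<mu> * x)) * ((1 - exp (- (x * g \<theta>))) / \<theta>)) (at x)" for x
    proof -
      have e: "exp (- ((\<mu> + g \<theta>) * x)) = exp (- (\<mu> * x)) * exp (- (x * g \<theta>))"
        by (simp add: mult_exp_exp algebra_simps)
      define K where "K = \<mu> / (\<mu> + g \<theta>)"
      have c: "K * (\<mu> + g \<theta>) = \<mu>" using l g by (simp add: K_def)
      have "((\<lambda>s. - exp (- (\<mu> * s)) + K * exp (- ((\<mu> + g \<theta>) * s))) has_real_derivative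
        \<mu> * exp (- (\<mu> * x)) - K * (\<mu> + g \<theta>) * exp (- ((\<mu> + g \<theta>) * x))) (at x)"
        by (auto intro!: derivative_eq_intros) (simp add: algebra_simps)
      from DERIV_cdivide[OF this, of \<theta>] show ?thesis unfolding c e K_def[symmetric] by (simp add: algebra_simps)
    qed
    show "0 \<le> \<mu> * exp (- (\<mu> * x)) * ((1 - exp (- (x * g \<theta>))) / \<theta>)" if "0 \<le> x" for x
      using that l \<theta> g by simp
  qed measurable
  also have "0 - ((- exp (- (\<mu> * 0)) + \<mu> / (\<mu> + g \<theta>) * exp (- ((\<mu> + g \<theta>) * 0))) / \<theta>) = (g \<theta> / \<theta>) / (g \<theta> + \<mu>)"
    using l g \<theta> by (simp add: field_simps)
  finally show ?thesis .
qed

end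

section \<open>The Volterra equation\<close>

text \<open>The convolution theorem for nonnegative functions. With values in
  \<open>ennreal\<close>, Tonelli applies before any integrability is known; finiteness is read off
  from the factors afterwards.\<close>

lemma nn_integral_laplace_convolution:
  fixes f h :: "real \<Rightarrow> real"
  assumes [measurable]: "f \<in> borel_measurable borel" "h \<in> borel_measurable borel"
    and f: "\<And>t. 0 < t \<Longrightarrow> 0 \<le> f t" and h: "\<And>t. 0 < t \<Longrightarrow> 0 \<le> h t"
  shows "(\<integral>\<^sup>+ t. ennreal (exp (- (\<theta> * t))) * indicator {0<..} t * 
      (\<integral>\<^sup>+ s. ennreal (f (t - s) * h s) * indicator {0<..<t} s \<partial>lborel) \<partial>lborel)
    = (\<integral>\<^sup>+ t. ennreal (exp (- (\<theta> * t)) * f t) * indicator {0<..} t \<partial>lborel) *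
      (\<integral>\<^sup>+ t. ennreal (exp (- (\<theta> * t)) * h t) * indicator {0<..} t \<partial>lborel)"
proof -
  define k where "k = (\<lambda>t s. (ennreal (exp (- (\<theta> * (t - s))) * f (t - s)) * indicator {0<..} (t - s)) *
    (ennreal (exp (- (\<theta> * s)) * h s) * indicator {0<..} s))"
  have "(\<integral>\<^sup>+ t. ennreal (exp (- (\<theta> * t))) * indicator {0<..} t * 
      (\<integral>\<^sup>+ s. ennreal (f (t - s) * h s) * indicator {0<..<t} s \<partial>lborel) \<partial>lborel)
    = (\<integral>\<^sup>+ t. \<integral>\<^sup>+ s. k t s \<partial>lborel \<partial>lborel)"
  proof (rule nn_integral_cong)
    fix t :: real
    have "ennreal (exp (- (\<theta> * t))) * indicator {0<..} t * (\<integral>\<^sup>+ s. ennreal (f (t - s) * h s) * indicator {0<..<t} s \<partial>lborel)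
      = (\<integral>\<^sup>+ s. ennreal (exp (- (\<theta> * t))) * indicator {0<..} t * (ennreal (f (t - s) * h s) * indicator {0<..<t} s) \<partial>lborel)"
      by (rule nn_integral_cmult[symmetric]) measurable
    also have "\<dots> = (\<integral>\<^sup>+ s. k t s \<partial>lborel)"
    proof (rule nn_integral_cong)
      fix s :: real
      have e: "exp (- (\<theta> * t)) = exp (- (\<theta> * (t - s))) * exp (- (\<theta> * s))"
        by (simp add: mult_exp_exp algebra_simps)
      show "ennreal (exp (- (\<theta> * t))) * indicator {0<..} t * (ennreal (f (t - s) * h s) * indicator {0<..<t} s) = k t s"
      proof (cases "0 < s \<and> s < t")
        case True
        then have "0 \<le> f (t - s)" "0 \<le> h s" using f h by auto
        then show ?thesis using True unfolding k_def e by (simp add: ennreal_mult[symmetric] mult_ac)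
      qed (auto simp: k_def indicator_def)
    qed
    finally show "ennreal (exp (- (\<theta> * t))) * indicator {0<..} t * (\<integral>\<^sup>+ s. ennreal (f (t - s) * h s) * indicator {0<..<t} s \<partial>lborel)
      = (\<integral>\<^sup>+ s. k t s \<partial>lborel)" .
  qed
  also have "\<dots> = (\<integral>\<^sup>+ s. \<integral>\<^sup>+ t. k t s \<partial>lborel \<partial>lborel)"
    unfolding k_def by (rule lborel_pair.Fubini') measurable
  also have "\<dots> = (\<integral>\<^sup>+ s. (\<integral>\<^sup>+ t. ennreal (exp (- (\<theta> * t)) * f t) * indicator {0<..} t \<partial>lborel) *
      (ennreal (exp (- (\<theta> * s)) * h s) * indicator {0<..} s) \<partial>lborel)"
  proof (rule nn_integral_cong)
    fix s :: real
    have "(\<integral>\<^sup>+ t. k t s \<partial>lborel) = (\<integral>\<^sup>+ t. ennreal (exp (- (\<theta> * (t - s))) * f (t - s)) * indicator {0<..} (t - s) \<partial>lborel) *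
      (ennreal (exp (- (\<theta> * s)) * h s) * indicator {0<..} s)"
      unfolding k_def by (rule nn_integral_multc) measurable
    also have "(\<integral>\<^sup>+ t. ennreal (exp (- (\<theta> * (t - s))) * f (t - s)) * indicator {0<..} (t - s) \<partial>lborel)
      = (\<integral>\<^sup>+ t. ennreal (exp (- (\<theta> * t)) * f t) * indicator {0<..} t \<partial>lborel)"
      using nn_integral_real_affine[of "\<lambda>t. ennreal (exp (- (\<theta> * t)) * f t) * indicator {0<..} t" 1 "-s"] by simp
    finally show "(\<integral>\<^sup>+ t. k t s \<partial>lborel) = (\<integral>\<^sup>+ t. ennreal (exp (- (\<theta> * t)) * f t) * indicator {0<..} t \<partial>lborel) *
      (ennreal (exp (- (\<theta> * s)) * h s) * indicator {0<..} s)" .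
  qed
  also have "\<dots> = (\<integral>\<^sup>+ t. ennreal (exp (- (\<theta> * t)) * f t) * indicator {0<..} t \<partial>lborel) *
      (\<integral>\<^sup>+ t. ennreal (exp (- (\<theta> * t)) * h t) * indicator {0<..} t \<partial>lborel)"
    by (rule nn_integral_cmult) measurable
  finally show ?thesis .
qed

text \<open>With \<open>x = exp (- t)\<close> the hypothesis says that all moments of \<open>x * G (- ln x)\<close> on \<open>[0, 1]\<close>
  vanish, so the Weierstrass approximation theorem applies; the growth bound makes this function
  continuous at \<open>0\<close>.\<close>

lemma laplace_transform_zero_imp_zero:
  fixes G :: "real \<Rightarrow> real"
  assumes cont: "continuous_on {0..} G" and bound: "\<And>t. 0 \<le> t \<Longrightarrow> \<bar>G t\<bar> \<le> C * exp (t / 2)"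
    and zero: "\<And>n::nat. (LBINT t:{0<..}. exp (- (real (Suc n) * t)) * G t) = 0"
    and t0: "0 \<le> t0"
  shows "G t0 = 0"
proof -
  define G1 where "G1 t = G (max t 0)" for t
  have cG1: "continuous_on UNIV G1" unfolding G1_def
    by (rule continuous_on_compose2[OF cont]) (auto intro!: continuous_intros)
  have [measurable]: "G1 \<in> borel_measurable borel" by (rule borel_measurable_continuous_onI[OF cG1])
  have b1: "\<bar>G1 t\<bar> \<le> C * exp (t / 2)" if "0 < t" for t using bound[of t] that by (simp add: G1_def)
  define k where "k t = indicator {0<..} t * (exp (- t) * G1 t)" for t :: real
  have [measurable]: "k \<in> borel_measurable borel" unfolding k_def by measurable
  have ik: "integrable lborel k"
  proof (rule Bochner_Integration.integrable_bound)
    have "set_integrable lborel {0<..} (\<lambda>s::real. 1/2 * exp (- (1/2 * s)))"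
      using set_integral_of_nn_integral(1)[OF _ _ _ _ nn_integral_exp_Ioi[of "1/2" 0, unfolded mult_zero_right minus_zero exp_zero]]
      by auto
    then show "integrable lborel (\<lambda>s. 2 * C * (indicator {0<..} s *\<^sub>R (1/2 * exp (- (1/2 * s)))))"
      unfolding set_integrable_def by (rule integrable_mult_right)
    show "AE t in lborel. norm (k t) \<le> norm (2 * C * (indicator {0<..} t *\<^sub>R (1/2 * exp (- (1/2 * t)))))"
    proof (rule AE_I2)
      fix t :: real
      have "exp (- t) * \<bar>G1 t\<bar> \<le> \<bar>C\<bar> * exp (- (1/2 * t))" if "0 < t"
      proof -
        have "exp (- t) * \<bar>G1 t\<bar> \<le> exp (- t) * (\<bar>C\<bar> * exp (t/2))"
          using b1[OF that] by (intro mult_left_mono) (auto intro: order_trans mult_right_mono)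
        also have "\<dots> = \<bar>C\<bar> * (exp (-t) * exp (t/2))" by simp
        also have "exp (-t) * exp (t/2) = exp (- (1/2 * t))" by (simp add: mult_exp_exp)
        finally show ?thesis .
      qed
      then show "norm (k t) \<le> norm (2 * C * (indicator {0<..} t *\<^sub>R (1/2 * exp (- (1/2 * t)))))"
        by (auto simp: k_def indicator_def abs_mult)
    qed
  qed measurable
  define h where "h x = (if x \<le> 0 then 0 else x * G1 (- ln x))" for x
  \<comment> \<open>Under \<open>x = exp (- t)\<close> the growth bound \<open>exp (t / 2)\<close>
    becomes \<open>1 / sqrt x\<close>, which the factor \<open>x\<close> in \<open>h\<close>
    outweighs.\<close>
  have hb: "\<bar>h x\<bar> \<le> C * sqrt x" if "0 < x" "x < 1" for x
  proof -
    have "\<bar>h x\<bar> \<le> x * (C * exp (- ln x / 2))"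
      using b1[of "- ln x"] that by (simp add: h_def abs_mult)
    also have "exp (- ln x / 2) = 1 / sqrt x"
      using that by (simp add: exp_minus ln_sqrt[symmetric] inverse_eq_divide)
    also have "x * (C * (1 / sqrt x)) = C * (x / sqrt x)" by simp
    also have "x / sqrt x = sqrt x" using that by (intro real_div_sqrt) simp
    finally show ?thesis .
  qed
  have hcont: "continuous_on {0..1} h"
    unfolding continuous_on_def
  proof
    fix x :: real assume x: "x \<in> {0..1}"
    show "(h \<longlongrightarrow> h x) (at x within {0..1})"
    proof (cases "x = 0")
      case False
      then have x0: "0 < x" using x by auto
      have "isCont G1 (- ln x)" using cG1 continuous_on_eq_continuous_at by blast
      then have "((\<lambda>y. y * G1 (- ln y)) \<longlongrightarrow> x * G1 (- ln x)) (at x within {0..1})"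
        using x0 by (intro tendsto_intros isCont_tendsto_compose[of _ G1]) auto
      moreover have "eventually (\<lambda>y. 0 < y) (at x within {0..1})"
        using x0 by (intro order_tendstoD[OF tendsto_ident_at])
      then have "eventually (\<lambda>y. y * G1 (- ln y) = h y) (at x within {0..1})"
        by eventually_elim (simp add: h_def)
      ultimately show ?thesis using x0 by (simp add: h_def Lim_transform_eventually)
    next
      case True
      have "((\<lambda>y. C * sqrt y) \<longlongrightarrow> C * sqrt 0) (at 0 within {0..1})"
        by (intro tendsto_intros)
      moreover have "eventually (\<lambda>y::real. y < 1) (at 0 within {0..1})"
        by (intro order_tendstoD[OF tendsto_ident_at]) simp
      moreover have "eventually (\<lambda>y::real. y \<in> {0..1} \<and> y \<noteq> 0) (at 0 within {0..1})"
        by (simp add: eventually_at_filter)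
      ultimately have "(h \<longlongrightarrow> 0) (at 0 within {0..1})"
      proof (intro Lim_null_comparison[of h "\<lambda>y. C * sqrt y"])
        assume "eventually (\<lambda>y::real. y < 1) (at 0 within {0..1})"
          and "eventually (\<lambda>y::real. y \<in> {0..1} \<and> y \<noteq> 0) (at 0 within {0..1})"
        then show "eventually (\<lambda>y. norm (h y) \<le> C * sqrt y) (at 0 within {0..1})"
          by eventually_elim (use hb in auto)
      qed simp
      then show ?thesis using True by (simp add: h_def)
    qed
  qed
  have hexp: "h (exp (- t)) = exp (- t) * G1 t" for t by (simp add: h_def)
  have hm [measurable]: "(\<lambda>t. h (exp (- t))) \<in> borel_measurable borel" unfolding hexp by measurable
  have isq: "integrable lborel (\<lambda>t. h (exp (- t)) * k t)"
  proof -
    obtain B where B: "\<And>x. x \<in> {0..1} \<Longrightarrow> norm (h x) \<le> B"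
      using compact_imp_bounded[OF compact_continuous_image[OF hcont compact_Icc]] unfolding bounded_iff by blast
    show ?thesis
    proof (rule Bochner_Integration.integrable_bound)
      show "integrable lborel (\<lambda>t. B * k t)" using ik by simp
      show "AE t in lborel. norm (h (exp (- t)) * k t) \<le> norm (B * k t)"
      proof (rule AE_I2)
        fix t :: real
        have "0 < t \<Longrightarrow> \<bar>h (exp (- t))\<bar> \<le> \<bar>B\<bar>" using B[of "exp (-t)"] by auto
        then show "norm (h (exp (- t)) * k t) \<le> norm (B * k t)"
          by (auto simp: k_def indicator_def abs_mult mult_right_mono)
      qed
    qed measurable
  qed
  have poly: "(LINT t|lborel. (\<Sum>i\<le>n. a i * exp (- t) ^ i) * k t) = 0" 
    and ipoly: "integrable lborel (\<lambda>t. (\<Sum>i\<le>n. a i * exp (- t) ^ i) * k t)" for a :: "nat \<Rightarrow> real" and n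
  proof -
    have i: "integrable lborel (\<lambda>t. exp (- t) ^ i * k t)" for i
    proof (rule Bochner_Integration.integrable_bound[OF ik])
      show "AE t in lborel. norm (exp (- t) ^ i * k t) \<le> norm (k t)"
        by (rule AE_I2) (auto simp: k_def indicator_def abs_mult power_le_one intro!: mult_left_le_one_le)
    qed measurable
    have z: "(LINT t|lborel. exp (- t) ^ i * k t) = 0" for i
    proof -
      have e: "exp (- (real (Suc i) * t)) = exp (- t) ^ i * exp (- t)" for t :: real
        using exp_of_nat_mult[of "Suc i" "- t"] by (simp add: mult.commute)
      have "(LINT t|lborel. exp (- t) ^ i * k t) = (LBINT t:{0<..}. exp (- (real (Suc i) * t)) * G t)"
        unfolding set_lebesgue_integral_def e
        by (rule Bochner_Integration.integral_cong) (auto simp: k_def G1_def indicator_def)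
      then show ?thesis using zero[of i] by simp
    qed
    show "integrable lborel (\<lambda>t. (\<Sum>i\<le>n. a i * exp (- t) ^ i) * k t)"
      unfolding sum_distrib_right mult.assoc by (intro Bochner_Integration.integrable_sum integrable_mult_right i)
    show "(LINT t|lborel. (\<Sum>i\<le>n. a i * exp (- t) ^ i) * k t) = 0"
      unfolding sum_distrib_right mult.assoc
      by (subst Bochner_Integration.integral_sum) (auto intro!: i simp: z)
  qed
  \<comment> \<open>For \<open>t > 0\<close> both factors equal \<open>exp (- t) * G1 t\<close>, so
    \<open>J\<close> is the integral of a square. Replacing \<open>h\<close> by a uniformly close
    polynomial makes the integral vanish, so \<open>J\<close> is at most any positive multiple of
    the integral of \<open>\<bar>k t\<bar>\<close>.\<close>
  define J where "J = (LINT t|lborel. h (exp (- t)) * k t)"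
  have Jsmall: "J \<le> e * (LINT t|lborel. \<bar>k t\<bar>)" if e: "0 < e" for e
  proof -
    obtain p where p: "real_polynomial_function p" "\<And>x. x \<in> {0..1} \<Longrightarrow> \<bar>h x - p x\<bar> < e"
      using Stone_Weierstrass_real_polynomial_function[OF compact_Icc hcont e] by blast
    then obtain a n where pa: "p = (\<lambda>x. \<Sum>i\<le>n. a i * x ^ i)" by (auto simp: real_polynomial_function_iff_sum)
    have "J = (LINT t|lborel. h (exp (- t)) * k t - (\<Sum>i\<le>n. a i * exp (- t) ^ i) * k t)"
      unfolding J_def using isq ipoly poly by simp
    also have "\<dots> \<le> (LINT t|lborel. e * \<bar>k t\<bar>)"
    proof (rule integral_mono)
      fix t :: real
      show "h (exp (- t)) * k t - (\<Sum>i\<le>n. a i * exp (- t) ^ i) * k t \<le> e * \<bar>k t\<bar>"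
      proof (cases "0 < t")
        case True
        have "h (exp (- t)) * k t - (\<Sum>i\<le>n. a i * exp (- t) ^ i) * k t = (h (exp (- t)) - p (exp (- t))) * k t"
          by (simp add: pa left_diff_distrib)
        also have "\<dots> \<le> \<bar>h (exp (- t)) - p (exp (- t))\<bar> * \<bar>k t\<bar>" by (simp add: abs_mult[symmetric])
        also have "\<dots> \<le> e * \<bar>k t\<bar>" using p(2)[of "exp (-t)"] True by (intro mult_right_mono) auto
        finally show ?thesis .
      qed (simp add: k_def)
    qed (use isq ipoly ik in auto)
    finally show ?thesis by simp
  qed
  have J0: "J \<le> 0"
  proof (rule field_le_epsilon)
    fix e :: real assume e: "0 < e"
    define I where "I = (LINT t|lborel. \<bar>k t\<bar>)"
    have I: "0 \<le> I" by (simp add: I_def)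
    have "J \<le> e / (I + 1) * I" unfolding I_def using e by (intro Jsmall divide_pos_pos add_nonneg_pos) auto
    also have "\<dots> \<le> e" using e I by (simp add: field_simps)
    finally show "J \<le> 0 + e" by simp
  qed
  have nn: "AE t in lborel. 0 \<le> h (exp (- t)) * k t" 
  proof (rule AE_I2)
    fix t
    have "h (exp (- t)) * k t = indicator {0<..} t * (exp (- t) * G1 t)\<^sup>2"
      by (simp add: hexp k_def power2_eq_square mult_ac)
    then show "0 \<le> h (exp (- t)) * k t" by simp
  qed
  have "J = 0" using J0 integral_nonneg_AE[OF nn] by (simp add: J_def)
  then have "AE t in lborel. h (exp (- t)) * k t = 0"
    using integral_nonneg_eq_0_iff_AE[OF isq nn] by (simp add: J_def)
  then have ae: "AE t in lborel. 0 < t \<longrightarrow> G t = 0"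
    by eventually_elim (auto simp: hexp k_def G1_def)
  \<comment> \<open>From almost everywhere to everywhere: the set of positive times where the
    continuous \<open>G\<close> differs from 0 is open, and an open null set is empty.\<close>
  let ?U = "{0<..} \<inter> G -` (- {0})"
  have op: "open ?U" by (rule continuous_open_preimage[OF continuous_on_subset[OF cont]]) auto
  have "AE t in lborel. t \<notin> ?U" using ae by eventually_elim auto
  then have "?U \<in> null_sets lborel" using op by (intro AE_iff_null_sets[THEN iffD2]) auto
  then have "negligible ?U" by (simp add: negligible_iff_null_sets null_sets_completionI)
  then have "?U = {}" using open_not_negligible[OF op] by blast
  then have pos: "G t = 0" if "0 < t" for t using that by auto
  show ?thesis
  proof (cases "t0 = 0")
    case True
    have "(\<lambda>n. G (inverse (real (Suc n)))) \<longlonglongrightarrow> G 0"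
      by (rule continuous_on_tendsto_compose[OF cont LIMSEQ_inverse_real_of_nat]) auto
    moreover have "G (inverse (real (Suc n))) = 0" for n by (rule pos) simp
    ultimately show ?thesis using True by (simp add: LIMSEQ_const_iff)
  qed (use t0 pos in auto)
qed

context inverse_subordinator_density
begin

lemma laplace_d:
  assumes "0 < \<theta>" "0 \<le> \<mu>"
  shows "set_integrable lborel {0<..} (\<lambda>t. exp (- (\<theta> * t)) * d \<mu> t)"
    and "(LBINT t:{0<..}. exp (- (\<theta> * t)) * d \<mu> t) = (g \<theta> / \<theta>) / (g \<theta> + \<mu>)"
  using set_integral_of_nn_integral[OF _ _ _ _ nn_integral_laplace_d[OF assms]] assms d_nonneg g_pos[of \<theta>]
  by auto

lemma laplace_tail:
  assumes "0 < \<theta>"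
  shows "set_integrable lborel {0<..} (\<lambda>t. exp (- (\<theta> * t)) * levy_tail \<nu> t)"
    and "(\<integral>\<^sup>+ t. ennreal (exp (- (\<theta> * t)) * levy_tail \<nu> t) * indicator {0<..} t \<partial>lborel) = ennreal (g \<theta> / \<theta> - b)"
    and "0 \<le> g \<theta> / \<theta> - b"
proof -
  have eq: "(LINT s|\<nu>. 1 - exp (- (s * \<theta>))) / \<theta> = g \<theta> / \<theta> - b"
    using assms by (simp add: bernstein_def field_simps)
  show nn: "0 \<le> g \<theta> / \<theta> - b"
    using nu_integral_pos[OF integrable_one_minus_exp[of \<theta>]] assms unfolding eq[symmetric] by simp
  show n: "(\<integral>\<^sup>+ t. ennreal (exp (- (\<theta> * t)) * levy_tail \<nu> t) * indicator {0<..} t \<partial>lborel) = ennreal (g \<theta> / \<theta> - b)"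
    using nn_integral_laplace_tail[OF assms] eq by simp
  show "set_integrable lborel {0<..} (\<lambda>t. exp (- (\<theta> * t)) * levy_tail \<nu> t)"
    using set_integral_of_nn_integral(1)[OF _ _ _ nn n] tail_nonneg by auto
qed

text \<open>Both sides have the same Laplace transform in \<open>t\<close>.\<close>

lemma volterra_d:
  assumes \<mu>: "0 \<le> \<mu>" and t: "0 \<le> t"
  shows "b * (1 - d \<mu> t) + (LBINT s:{0<..<t}. levy_tail \<nu> (t - s) * (1 - d \<mu> s))
    = \<mu> * (LBINT s:{0<..<t}. d \<mu> s)"
proof -
  note [measurable] = measurable_d[OF \<mu>]
  define q where "q t = 1 - d \<mu> t" for t
  have [measurable]: "q \<in> borel_measurable borel" unfolding q_def by measurable
  have q0: "q 0 = 0" by (simp add: q_def d_nonpos)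
  have qb: "0 \<le> q s" "q s \<le> 1" for s using d_nonneg[of \<mu> s] d_le_1[OF \<mu>, of s] by (auto simp: q_def)
  have qc: "continuous_on A q" for A unfolding q_def by (intro continuous_intros continuous_on_d \<mu>)
  define Q where "Q t = (LBINT s:{0<..<t}. levy_tail \<nu> (t - s) * q s)" for t
  define D where "D t = (LBINT s:{0<..<t}. d \<mu> s)" for t
  have Qc: "continuous_on {0..} Q" unfolding Q_def 
    using continuous_on_convolution[OF qc q0] by simp
  have di: "set_integrable lborel {0<..<T} (d \<mu>)" for T
    by (rule set_integrable_subset[OF borel_integrable_atLeastAtMost'[OF continuous_on_d[OF \<mu>], of 0 T]]) auto
  have Qn: "ennreal (Q t) = (\<integral>\<^sup>+ s. ennreal (levy_tail \<nu> (t - s) * q s) * indicator {0<..<t} s \<partial>lborel)" for t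
  proof -
    have "(\<integral>\<^sup>+ s. ennreal (levy_tail \<nu> (t - s) * q s) * indicator {0<..<t} s \<partial>lborel)
      = (\<integral>\<^sup>+ s. ennreal (indicator {0<..<t} s *\<^sub>R (levy_tail \<nu> (t - s) * q s)) \<partial>lborel)"
      by (rule nn_integral_cong) (auto simp: indicator_def)
    also have "\<dots> = ennreal (Q t)" unfolding Q_def set_lebesgue_integral_def
      using set_integrable_convolution[OF qc, of t] tail_nonneg qb
      by (intro nn_integral_eq_integral) (auto simp: set_integrable_def)
    finally show ?thesis ..
  qed
  have Dn: "ennreal (D t) = (\<integral>\<^sup>+ s. ennreal (1 * d \<mu> s) * indicator {0<..<t} s \<partial>lborel)" for t
  proof -
    have "(\<integral>\<^sup>+ s. ennreal (1 * d \<mu> s) * indicator {0<..<t} s \<partial>lborel)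
      = (\<integral>\<^sup>+ s. ennreal (indicator {0<..<t} s *\<^sub>R d \<mu> s) \<partial>lborel)"
      by (rule nn_integral_cong) (auto simp: indicator_def)
    also have "\<dots> = ennreal (D t)" unfolding D_def set_lebesgue_integral_def
      using di[of t] d_nonneg by (intro nn_integral_eq_integral) (auto simp: set_integrable_def)
    finally show ?thesis ..
  qed
  have Q0: "0 \<le> Q t" and D0: "0 \<le> D t" for t unfolding Q_def D_def set_lebesgue_integral_def
    using tail_nonneg qb d_nonneg by (auto intro!: integral_nonneg_AE)
  have Dc: "continuous_on {0..} D" unfolding D_def by (rule continuous_on_set_integral_Ioo[OF continuous_on_d[OF \<mu>]])
  have Db: "D t \<le> 2 * exp (t/2)" if "0 \<le> t" for t
  proof -
    have "D t \<le> (LBINT s:{0<..<t}. 1)" unfolding D_def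
      by (rule set_integral_mono[OF di]) (use d_le_1[OF \<mu>] set_integral_Ioo_eq_integral(1)[of t "\<lambda>_. 1 :: real"] in auto)
    also have "\<dots> = t" using that by (simp add: set_lebesgue_integral_def)
    also have "t \<le> 2 * exp (t/2)" using exp_ge_add_one_self[of "t/2"] by linarith
    finally show ?thesis .
  qed
  define W where "W = (LBINT r:{0<..}. exp (- (1/2 * r)) * levy_tail \<nu> r)"
  have Qb: "Q t \<le> W * exp (t/2)" for t
  proof -
    have i: "set_integrable lborel {0<..<t} (\<lambda>s. levy_tail \<nu> (t - s))"
      using set_integrable_convolution[of t "\<lambda>_. 1 :: real"] by simp
    have "Q t \<le> (LBINT s:{0<..<t}. levy_tail \<nu> (t - s))" unfolding Q_def
      by (rule set_integral_mono) (use i set_integrable_convolution[OF qc, of t] tail_nonneg qb in \<open>auto intro: mult_right_le_one_le\<close>)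
    also have "\<dots> = \<bar>-1\<bar> *\<^sub>R (LINT r|lborel. indicator {0<..<t} (t + (-1) * r) *\<^sub>R (levy_tail \<nu> (t - (t + (-1) * r))))"
      unfolding set_lebesgue_integral_def by (rule lborel_integral_real_affine) simp
    also have "\<dots> = (LBINT r:{0<..<t}. levy_tail \<nu> r)"
      by (auto simp: set_lebesgue_integral_def indicator_def intro!: Bochner_Integration.integral_cong)
    also have "\<dots> \<le> (LINT r|lborel. exp (t/2) * (indicator {0<..} r *\<^sub>R (exp (- (1/2 * r)) * levy_tail \<nu> r)))"
      unfolding set_lebesgue_integral_def
    proof (rule integral_mono)
      show "integrable lborel (\<lambda>r. exp (t/2) * (indicator {0<..} r *\<^sub>R (exp (- (1/2 * r)) * levy_tail \<nu> r)))"
        using laplace_tail(1)[of "1/2"] by (simp add: set_integrable_def)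
      fix r :: real
      have "levy_tail \<nu> r \<le> exp (t/2) * exp (- (1/2 * r)) * levy_tail \<nu> r" if "r < t"
        using mult_right_mono[of 1 "exp (t/2) * exp (- (1/2 * r))" "levy_tail \<nu> r"] that tail_nonneg
        by (simp add: mult_exp_exp)
      then show "indicator {0<..<t} r *\<^sub>R levy_tail \<nu> r \<le> exp (t/2) * (indicator {0<..} r *\<^sub>R (exp (- (1/2 * r)) * levy_tail \<nu> r))"
        using tail_nonneg by (auto simp: indicator_def mult.assoc)
    qed (use set_integrable_tail in \<open>simp add: set_integrable_def\<close>)
    also have "\<dots> = W * exp (t/2)" by (simp add: W_def set_lebesgue_integral_def)
    finally show ?thesis .
  qed
  define G where "G t = b * q t + Q t - \<mu> * D t" for t
  have "G t = 0"
  proof (rule laplace_transform_zero_imp_zero[of G "b + W + 2 * \<mu>"])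
    show "continuous_on {0..} G" unfolding G_def by (intro continuous_intros qc Qc Dc)
    show "\<bar>G t\<bar> \<le> (b + W + 2 * \<mu>) * exp (t / 2)" if t: "0 \<le> t" for t
    proof -
      have "\<bar>G t\<bar> \<le> b * q t + Q t + \<mu> * D t"
        unfolding G_def using b \<mu> qb[of t] Q0[of t] D0[of t] by (simp add: abs_le_iff algebra_simps)
      also have "\<dots> \<le> b * 1 + W * exp (t/2) + \<mu> * (2 * exp (t/2))"
        using b \<mu> qb[of t] Qb[of t] Db[OF t] by (intro add_mono mult_left_mono) auto
      also have "\<dots> \<le> (b + W + 2 * \<mu>) * exp (t / 2)"
        using mult_left_mono[of 1 "exp (t/2)" b] t b by (simp add: algebra_simps)
      finally show ?thesis .
    qed
    fix n :: nat
    define \<theta> where "\<theta> = real (Suc n)"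
    have \<theta>: "0 < \<theta>" by (simp add: \<theta>_def)
    note g = g_pos[OF \<theta>]
    define L where "L = (g \<theta> / \<theta>) / (g \<theta> + \<mu>)"
    have L1: "set_integrable lborel {0<..} (\<lambda>t. exp (- (\<theta> * t)) * d \<mu> t)" "(LBINT t:{0<..}. exp (- (\<theta> * t)) * d \<mu> t) = L"
      using laplace_d[OF \<theta> \<mu>] by (auto simp: L_def)
    have L2: "set_integrable lborel {0<..} (\<lambda>t. exp (- (\<theta> * t)) * 1)" "(LBINT t:{0<..}. exp (- (\<theta> * t)) * 1) = 1 / \<theta>"
      and n2: "(\<integral>\<^sup>+ t. ennreal (exp (- (\<theta> * t)) * 1) * indicator {0<..} t \<partial>lborel) = ennreal (1 / \<theta>)"
      using laplace_d[OF \<theta>, of 0] nn_integral_laplace_d[OF \<theta>, of 0] g by (auto simp: d_def M.prob_space)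
    have L3: "set_integrable lborel {0<..} (\<lambda>t. exp (- (\<theta> * t)) * q t)" "(LBINT t:{0<..}. exp (- (\<theta> * t)) * q t) = 1 / \<theta> - L"
      using set_integral_diff[OF L2(1) L1(1)] L1(2) L2(2) by (auto simp: q_def right_diff_distrib)
    have L3': "0 \<le> 1 / \<theta> - L" 
      unfolding L3(2)[symmetric] set_lebesgue_integral_def using qb by (intro integral_nonneg_AE) auto
    have n3: "(\<integral>\<^sup>+ t. ennreal (exp (- (\<theta> * t)) * q t) * indicator {0<..} t \<partial>lborel) = ennreal (1 / \<theta> - L)"
    proof -
      have "(\<integral>\<^sup>+ t. ennreal (exp (- (\<theta> * t)) * q t) * indicator {0<..} t \<partial>lborel)
        = (\<integral>\<^sup>+ t. ennreal (indicator {0<..} t *\<^sub>R (exp (- (\<theta> * t)) * q t)) \<partial>lborel)"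
        by (rule nn_integral_cong) (auto simp: indicator_def)
      also have "\<dots> = ennreal (1 / \<theta> - L)"
        unfolding L3(2)[symmetric] set_lebesgue_integral_def
        using L3(1) qb by (intro nn_integral_eq_integral) (auto simp: set_integrable_def)
      finally show ?thesis .
    qed
    have n1: "(\<integral>\<^sup>+ t. ennreal (exp (- (\<theta> * t)) * d \<mu> t) * indicator {0<..} t \<partial>lborel) = ennreal L"
      using nn_integral_laplace_d[OF \<theta> \<mu>] by (simp add: L_def)
    have Lnn: "0 \<le> L" using g \<theta> \<mu> by (simp add: L_def)
    have mQ: "(\<lambda>t. indicator {0<..} t * Q t) \<in> borel_measurable borel" "(\<lambda>t. indicator {0<..} t * D t) \<in> borel_measurable borel"
      using borel_measurable_continuous_on_indicator[OF _ continuous_on_subset[OF Qc, of "{0<..}"]]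
        borel_measurable_continuous_on_indicator[OF _ continuous_on_subset[OF Dc, of "{0<..}"]]
      by (simp_all add: subset_iff)
    have lt: "set_integrable lborel {0<..} (\<lambda>t. exp (- (\<theta> * t)) * P t) \<and> (LBINT t:{0<..}. exp (- (\<theta> * t)) * P t) = c"
      if m: "(\<lambda>t. indicator {0<..} t * P t) \<in> borel_measurable borel" and nn: "\<And>t. 0 \<le> P t" "0 \<le> c"
        and e: "(\<integral>\<^sup>+ t. ennreal (exp (- (\<theta> * t))) * indicator {0<..} t * ennreal (P t) \<partial>lborel) = ennreal c" for P c
    proof -
      have "has_bochner_integral lborel (\<lambda>t. indicator {0<..} t *\<^sub>R (exp (- (\<theta> * t)) * P t)) c"
      proof (rule has_bochner_integral_nn_integral)
        have "(\<lambda>t. exp (- (\<theta> * t)) * (indicator {0<..} t * P t)) \<in> borel_measurable lborel" using m by measurable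
        then show "(\<lambda>t. indicator {0<..} t *\<^sub>R (exp (- (\<theta> * t)) * P t)) \<in> borel_measurable lborel"
          by (simp add: mult_ac)
        show "(\<integral>\<^sup>+ t. ennreal (indicator {0<..} t *\<^sub>R (exp (- (\<theta> * t)) * P t)) \<partial>lborel) = ennreal c"
          unfolding e[symmetric] using nn by (intro nn_integral_cong) (auto simp: indicator_def ennreal_mult)
      qed (use nn in auto)
      then show ?thesis by (auto simp: has_bochner_integral_iff set_integrable_def set_lebesgue_integral_def)
    qed
    have L4: "set_integrable lborel {0<..} (\<lambda>t. exp (- (\<theta> * t)) * Q t) \<and> (LBINT t:{0<..}. exp (- (\<theta> * t)) * Q t) = (g \<theta> / \<theta> - b) * (1 / \<theta> - L)"
    proof (rule lt[OF mQ(1) Q0])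
      show "(\<integral>\<^sup>+ t. ennreal (exp (- (\<theta> * t))) * indicator {0<..} t * ennreal (Q t) \<partial>lborel) = ennreal ((g \<theta> / \<theta> - b) * (1 / \<theta> - L))"
        unfolding Qn using nn_integral_laplace_convolution[of "levy_tail \<nu>" q \<theta>] tail_nonneg qb laplace_tail(2,3)[OF \<theta>] n3 L3'
        by (simp add: ennreal_mult)
    qed (use laplace_tail(3)[OF \<theta>] L3' in simp)
    have L5: "set_integrable lborel {0<..} (\<lambda>t. exp (- (\<theta> * t)) * D t) \<and> (LBINT t:{0<..}. exp (- (\<theta> * t)) * D t) = 1 / \<theta> * L"
    proof (rule lt[OF mQ(2) D0])
      show "(\<integral>\<^sup>+ t. ennreal (exp (- (\<theta> * t))) * indicator {0<..} t * ennreal (D t) \<partial>lborel) = ennreal (1 / \<theta> * L)"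
        unfolding Dn using nn_integral_laplace_convolution[of "\<lambda>_. 1" "d \<mu>" \<theta>] d_nonneg n1 n2 \<theta> Lnn
        by (simp add: ennreal_mult[symmetric])
    qed (use Lnn \<theta> in simp)
    have "(LBINT t:{0<..}. exp (- (\<theta> * t)) * G t)
      = (LBINT t:{0<..}. (b * (exp (- (\<theta> * t)) * q t) + exp (- (\<theta> * t)) * Q t) - \<mu> * (exp (- (\<theta> * t)) * D t))"
      by (simp add: G_def algebra_simps)
    also have "\<dots> = (b * (1 / \<theta> - L) + (g \<theta> / \<theta> - b) * (1 / \<theta> - L)) - \<mu> * (1 / \<theta> * L)"
      using L3 L4 L5 by (subst set_integral_diff set_integral_add; simp)+
    \<comment> \<open>The drift cancels: \<open>b\<close> from the local term meets
      \<open>- b\<close> from the transform of the tail. What remains vanishes by the choice of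
      \<open>L\<close>.\<close>
    also have "\<dots> = (g \<theta> / \<theta> - (g \<theta> + \<mu>) * L) / \<theta>" by (simp add: algebra_simps diff_divide_distrib add_divide_distrib)
    also have "\<dots> = 0" using g \<mu> by (simp add: L_def)
    finally show "(LBINT t:{0<..}. exp (- (real (Suc n) * t)) * G t) = 0" by (simp only: \<theta>_def)
  qed (rule t)
  then show ?thesis by (simp add: G_def q_def Q_def D_def)
qed

end

section \<open>Gaussian mixtures and the power series of the solution\<close>

text \<open>Rescaling by \<open>\<sigma>\<close> reduces the integral to the characteristic function
  of the standard normal law at \<open>- (\<sigma> * real k)\<close>.\<close>

lemma normal_characteristic:
  assumes "0 < \<sigma>"
  shows "integrable lborel (\<lambda>x. complex_of_real (normal_density 0 \<sigma> x) * exp (- (\<i> * complex_of_real x)) ^ k)" (is "integrable _ ?f")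
    and "(LINT x|lborel. complex_of_real (normal_density 0 \<sigma> x) * exp (- (\<i> * complex_of_real x)) ^ k)
      = complex_of_real (exp (- ((\<sigma> * real k)\<^sup>2 / 2)))"
proof -
  have ni: "norm (exp (- (\<i> * complex_of_real x))) = 1" for x
    by (simp add: norm_exp_eq_Re)
  show "integrable lborel ?f"
  proof (rule Bochner_Integration.integrable_bound[OF integrable_normal_density[OF assms, of 0]])
    show "AE x in lborel. norm (?f x) \<le> norm (normal_density 0 \<sigma> x)"
      by (auto simp: norm_mult norm_power ni)
  qed measurable
  have nd: "\<sigma> * normal_density 0 \<sigma> (\<sigma> * x) = std_normal_density x" for x
    using assms by (simp add: normal_density_def real_sqrt_mult power_mult_distrib)
  have "(LINT x|lborel. ?f x) = \<bar>\<sigma>\<bar> *\<^sub>R (LINT x|lborel. ?f (0 + \<sigma> * x))"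
    using assms by (intro lborel_integral_real_affine) simp
  also have "\<dots> = (LINT x|lborel. \<sigma> *\<^sub>R ?f (\<sigma> * x))" using assms by simp
  also have "\<dots> = (LINT x|lborel. std_normal_density x *\<^sub>R iexp (- (\<sigma> * real k) * x))"
  proof (rule Bochner_Integration.integral_cong)
    fix x
    have "exp (- (\<i> * complex_of_real (\<sigma> * x))) ^ k = iexp (- (\<sigma> * real k) * x)"
      by (simp add: exp_of_nat_mult[symmetric] mult_ac)
    then show "\<sigma> *\<^sub>R ?f (\<sigma> * x) = std_normal_density x *\<^sub>R iexp (- (\<sigma> * real k) * x)"
      unfolding nd[symmetric] by (simp add: scaleR_conv_of_real)
  qed simp
  also have "\<dots> = char std_normal_distribution (- (\<sigma> * real k))"
    unfolding char_def by (rule integral_density[symmetric]) (auto simp: mult_ac)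
  also have "\<dots> = complex_of_real (exp (- ((\<sigma> * real k)\<^sup>2 / 2)))"
    by (simp add: char_std_normal_distribution)
  finally show "(LINT x|lborel. ?f x) = complex_of_real (exp (- ((\<sigma> * real k)\<^sup>2 / 2)))" .
qed

text \<open>\<open>lborel\<close> on a Euclidean space is the image of a product measure indexed by
  \<open>Basis\<close>. Fubini in coordinates therefore requires matching each \<open>j\<close> with
  the basis vector \<open>axis j 1\<close>; \<open>ix\<close> is the inverse of this
  matching.\<close>

lemma
  fixes h :: "'n::finite \<Rightarrow> real \<Rightarrow> complex"
  assumes h: "\<And>j. integrable lborel (h j)"
  shows integrable_lborel_vec_prod: "integrable (lborel :: (real ^ 'n) measure) (\<lambda>u. \<Prod>j\<in>UNIV. h j (u $ j))"
    and integral_lborel_vec_prod: "(LINT u|(lborel :: (real ^ 'n) measure). (\<Prod>j\<in>UNIV. h j (u $ j))) = (\<Prod>j\<in>UNIV. (LINT x|lborel. h j x))"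
proof -
  interpret product_sigma_finite "\<lambda>_ :: real ^ 'n. lborel :: real measure" ..
  define ix :: "real ^ 'n \<Rightarrow> 'n" where "ix b = (SOME j. b = axis j 1)" for b
  have inj: "inj (\<lambda>j :: 'n. axis j (1 :: real))" by (auto simp: inj_def axis_eq_axis)
  have ix: "ix (axis j 1) = j" for j
    unfolding ix_def by (rule some_equality) (auto simp: axis_eq_axis)
  have B: "Basis = range (\<lambda>j :: 'n. axis j (1 :: real))" by (auto simp: Basis_vec_def)
  have comp: "(\<Sum>b\<in>Basis. F b *\<^sub>R b) $ j = F (axis j 1)" for F :: "real ^ 'n \<Rightarrow> real" and j
  proof -
    have "(\<Sum>b\<in>Basis. F b *\<^sub>R b) $ j = (\<Sum>b\<in>Basis. F b *\<^sub>R b) \<bullet> axis j 1"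
      by (simp add: inner_axis)
    also have "\<dots> = F (axis j 1)" by (rule inner_sum_left_Basis) (simp add: B)
    finally show ?thesis .
  qed
  have reidx: "(\<Prod>b\<in>Basis. G (ix b) b) = (\<Prod>j\<in>UNIV. G j (axis j 1))" for G :: "'n \<Rightarrow> real ^ 'n \<Rightarrow> complex"
    unfolding B by (subst prod.reindex[OF inj]) (simp add: ix)
  have reidx': "(\<Prod>j\<in>UNIV. h j ((\<Sum>b\<in>Basis. F b *\<^sub>R b) $ j)) = (\<Prod>b\<in>Basis. h (ix b) (F b))" for F :: "real ^ 'n \<Rightarrow> real"
    unfolding comp by (rule reidx[of "\<lambda>j b. h j (F b)", symmetric])
  have le: "(lborel :: (real ^ 'n) measure) = distr (\<Pi>\<^sub>M b\<in>Basis. lborel) borel (\<lambda>F. \<Sum>b\<in>Basis. F b *\<^sub>R b)"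
    by (rule lborel_eq)
  have hm [measurable]: "h j \<in> borel_measurable borel" for j using borel_measurable_integrable[OF h] by simp
  have m: "(\<lambda>F :: real ^ 'n \<Rightarrow> real. \<Sum>b\<in>Basis. F b *\<^sub>R b) \<in> measurable (\<Pi>\<^sub>M b\<in>Basis. lborel) borel"
    by measurable
  have m2: "(\<lambda>u. \<Prod>j\<in>UNIV. h j (u $ j)) \<in> borel_measurable borel"
  proof (rule borel_measurable_prod)
    fix j :: 'n
    have "(\<lambda>u :: real ^ 'n. u $ j) \<in> borel_measurable borel"
      by (intro borel_measurable_continuous_onI continuous_intros)
    then show "(\<lambda>u :: real ^ 'n. h j (u $ j)) \<in> borel_measurable borel" by (rule measurable_compose) (rule hm)
  qed
  have i: "integrable (\<Pi>\<^sub>M b\<in>Basis. lborel) (\<lambda>F :: real ^ 'n \<Rightarrow> real. \<Prod>b\<in>Basis. h (ix b) (F b))"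
    by (rule product_integrable_prod) (auto intro: h)
  then show "integrable (lborel :: (real ^ 'n) measure) (\<lambda>u. \<Prod>j\<in>UNIV. h j (u $ j))"
    unfolding le by (subst integrable_distr_eq[OF m m2]) (simp only: reidx')
  have "(LINT u|(lborel :: (real ^ 'n) measure). (\<Prod>j\<in>UNIV. h j (u $ j))) =
    (LINT F|(\<Pi>\<^sub>M b\<in>Basis. lborel). (\<Prod>b\<in>Basis. h (ix b) (F b)))"
    unfolding le by (subst integral_distr[OF m m2]) (simp only: reidx')
  also have "\<dots> = (\<Prod>b\<in>Basis. (LINT x|lborel. h (ix b) x))"
    by (rule product_integral_prod) (auto intro: h)
  also have "\<dots> = (\<Prod>j\<in>UNIV. (LINT x|lborel. h j x))" by (rule reidx[of "\<lambda>j b. LINT x|lborel. h j x"])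
  finally show "(LINT u|(lborel :: (real ^ 'n) measure). (\<Prod>j\<in>UNIV. h j (u $ j))) = (\<Prod>j\<in>UNIV. (LINT x|lborel. h j x))" .
qed

text \<open>The density at time \<open>y\<close> of Brownian motion in \<open>real ^ 'n\<close>,
  kept as a product so that its integrals factor; \<open>gauss_eq\<close> identifies it with the
  radial kernel of \<open>W_op\<close>.\<close>

definition gauss :: "real \<Rightarrow> real ^ 'n \<Rightarrow> real" where
  "gauss y u = (\<Prod>j\<in>UNIV. normal_density 0 (sqrt y) (u $ j))"

text \<open>The factor of modulus one that the monomial with exponents \<open>k\<close> acquires
  under the rotation \<open>rot\<close>.\<close>

definition phase :: "('n \<Rightarrow> nat) \<Rightarrow> real ^ 'n \<Rightarrow> complex" where
  "phase k u = (\<Prod>j\<in>UNIV. exp (- (\<i> * complex_of_real (u $ j))) ^ k j)"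

lemma norm_phase: "norm (phase k u) = 1"
  by (simp add: phase_def norm_power norm_exp_eq_Re flip: prod_norm)

lemma measurable_nth [measurable]: "(\<lambda>u :: real ^ 'n. u $ j) \<in> borel_measurable borel"
  by (intro borel_measurable_continuous_onI continuous_intros)

lemma measurable_phase [measurable]: "phase k \<in> borel_measurable borel"
  unfolding phase_def by measurable

lemma gauss_nonneg: "0 \<le> gauss y u" by (simp add: gauss_def prod_nonneg)

lemma gauss_eq:
  assumes "0 < y"
  shows "gauss y (u :: real ^ 'n) = exp (- ((\<Sum>j\<in>UNIV. (u $ j)\<^sup>2) / (2 * y))) / y powr (real CARD('n) / 2)
    / (2 * pi) powr (real CARD('n) / 2)"
proof -
  have p: "sqrt x ^ CARD('n) = x powr (real CARD('n) / 2)" if "0 < x" for x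
    using that by (simp add: powr_half_sqrt[symmetric] powr_realpow[symmetric] powr_powr)
  have "gauss y u = (\<Prod>j\<in>UNIV. exp (- ((u $ j)\<^sup>2 / (2 * y))) / (sqrt y * sqrt (2 * pi)))"
    using assms unfolding gauss_def normal_density_def by (simp add: real_sqrt_mult mult_ac)
  also have "\<dots> = exp (\<Sum>j\<in>UNIV. - ((u $ j)\<^sup>2 / (2 * y))) / (sqrt y ^ CARD('n) * sqrt (2 * pi) ^ CARD('n))"
    by (simp add: prod_dividef exp_sum power_mult_distrib)
  also have "\<dots> = exp (- ((\<Sum>j\<in>UNIV. (u $ j)\<^sup>2) / (2 * y))) / (sqrt y ^ CARD('n) * sqrt (2 * pi) ^ CARD('n))"
    by (simp add: sum_negf sum_divide_distrib)
  finally show ?thesis using p[OF assms] p[of "2 * pi"] by simp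
qed

lemma integral_gauss_phase:
  assumes "0 < y"
  shows "integrable lborel (\<lambda>u. complex_of_real (gauss y u) * phase k u)"
    and "(LINT u|lborel. complex_of_real (gauss y u) * phase k u) = complex_of_real (exp (- (sum_squares k / 2 * y)))"
proof -
  have eq: "complex_of_real (gauss y u) * phase k u =
    (\<Prod>j\<in>UNIV. complex_of_real (normal_density 0 (sqrt y) (u $ j)) * exp (- (\<i> * complex_of_real (u $ j))) ^ k j)" for u :: "real ^ 'a"
    by (simp add: gauss_def phase_def prod.distrib)
  have s: "0 < sqrt y" using assms by simp
  show "integrable lborel (\<lambda>u. complex_of_real (gauss y u) * phase k u)"
    unfolding eq by (rule integrable_lborel_vec_prod[OF normal_characteristic(1)[OF s]])
  have "(LINT u|lborel. complex_of_real (gauss y u) * phase k u)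
    = (\<Prod>j\<in>UNIV. complex_of_real (exp (- ((sqrt y * real (k j))\<^sup>2 / 2))))"
    unfolding eq integral_lborel_vec_prod[OF normal_characteristic(1)[OF s]] normal_characteristic(2)[OF s] ..
  also have "\<dots> = complex_of_real (exp (\<Sum>j\<in>UNIV. - ((sqrt y * real (k j))\<^sup>2 / 2)))"
    by (simp only: exp_sum[OF finite] of_real_prod)
  also have "(\<Sum>j\<in>UNIV. - ((sqrt y * real (k j))\<^sup>2 / 2)) = - (sum_squares k / 2 * y)"
    using assms by (simp add: sum_squares_def power_mult_distrib sum_negf sum_divide_distrib sum_distrib_left mult.commute)
  finally show "(LINT u|lborel. complex_of_real (gauss y u) * phase k u) = complex_of_real (exp (- (sum_squares k / 2 * y)))" .
qed

lemma measurable_gauss [measurable]: "(\<lambda>(u, y). gauss y u) \<in> borel_measurable (borel \<Otimes>\<^sub>M borel)"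
  unfolding gauss_def normal_density_def case_prod_beta' by measurable

lemma nn_integral_gauss:
  assumes "0 < y" shows "(\<integral>\<^sup>+ u. ennreal (gauss y (u :: real ^ 'n)) \<partial>lborel) = 1"
proof -
  have p: "phase (\<lambda>_. 0) u = 1" for u :: "real ^ 'n" by (simp add: phase_def)
  note g = integral_gauss_phase[OF assms, of "\<lambda>_ :: 'n. 0", unfolded p mult_1_right]
  have i: "integrable lborel (gauss y :: real ^ 'n \<Rightarrow> real)"
    using g(1) by (simp only: complex_of_real_integrable_eq)
  have "(LINT u|lborel. gauss y (u :: real ^ 'n)) = 1"
    using g(2) by (simp add: sum_squares_def)
  then show ?thesis using nn_integral_eq_integral[OF i] gauss_nonneg by auto
qed

section \<open>Rotations and the mixed Gaussian kernel\<close>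

definition rot :: "complex ^ 'n \<Rightarrow> real ^ 'n \<Rightarrow> complex ^ 'n" where
  "rot z u = (\<chi> j. z $ j * exp (- (\<i> * complex_of_real (u $ j))))"

lemma monomial_rot: "monomial (rot z u) k = monomial z k * phase k u"
  by (simp add: monomial_def rot_def phase_def power_mult_distrib prod.distrib)

lemma rot_nth_norm: "norm (rot z u $ j) = norm (z $ j)"
  by (simp add: rot_def norm_mult norm_exp_eq_Re)

lemma rot_polydisc: "z \<in> polydisc \<Longrightarrow> rot z u \<in> polydisc"
  and rot_closed_polydisc: "z \<in> closed_polydisc \<Longrightarrow> rot z u \<in> closed_polydisc"
  by (simp_all add: polydisc_def closed_polydisc_def rot_nth_norm)

context inverse_subordinator_density
begin

text \<open>The density of Brownian motion run at the inverse subordinator. It includes the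
  normalisation by a power of \<open>2 * pi\<close> that \<open>W_op\<close> keeps outside the
  integral.\<close>

definition kern :: "real \<Rightarrow> real ^ 'n \<Rightarrow> real" where
  "kern t u = (LINT y|lborel. indicator {0<..} y * gauss y u * m y t)"

lemma measurable_m [measurable]: "0 < t \<Longrightarrow> (\<lambda>y. m y t) \<in> borel_measurable borel"
  using distributed_real_measurable[OF _ m_density[of t]] m_nonneg by simp

lemma kern_nonneg: "0 < t \<Longrightarrow> 0 \<le> kern t u"
  unfolding kern_def by (intro integral_nonneg_AE AE_I2 mult_nonneg_nonneg gauss_nonneg m_nonneg) auto

text \<open>Restricting the density to \<open>y > 0\<close>, where the Gaussian makes sense, loses
  no mass: the inverse subordinator is almost surely nonnegative and has no atom at 0.\<close>

lemma integral_m: 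
  assumes "0 < t" "0 \<le> \<mu>"
  shows "(LINT y|lborel. m y t * (indicator {0<..} y * exp (- (\<mu> * y)))) = d \<mu> t"
proof -
  have "(LINT y|lborel. m y t * (indicator {0<..} y * exp (- (\<mu> * y)))) 
    = (LINT \<omega>|M. indicator {0<..} (inverse_subordinator H t \<omega>) * exp (- (\<mu> * inverse_subordinator H t \<omega>)))"
    by (rule distributed_integral[OF m_density[OF assms(1)]]) (use m_nonneg assms in auto)
  also have "\<dots> = d \<mu> t" unfolding d_def
  proof (rule integral_cong_AE)
    have [measurable]: "inverse_subordinator H t \<in> borel_measurable M"
      using distributed_measurable[OF m_density[OF assms(1)]] by simp
    show "(\<lambda>\<omega>. indicator {0<..} (inverse_subordinator H t \<omega>) * exp (- (\<mu> * inverse_subordinator H t \<omega>))) \<in> borel_measurable M"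
      by measurable
    show "AE \<omega> in M. indicator {0<..} (inverse_subordinator H t \<omega>) * exp (- (\<mu> * inverse_subordinator H t \<omega>)) = exp (- (\<mu> * E0 t \<omega>))"
      using AE_inverse_subordinator_neq[OF assms(1), of 0] AE_E0
    proof eventually_elim
      case (elim \<omega>)
      then have "0 \<le> E0 t \<omega>" by blast
      then show ?case using elim(1) assms(1) by (simp add: E0_def)
    qed
  qed measurable
  finally show ?thesis .
qed

text \<open>For each \<open>y > 0\<close> the Gaussian has total mass 1 and \<open>m\<close> is a
  probability density, so Tonelli bounds the joint integral by 1. A phase has modulus one and keeps
  integrability; exchanging the order puts the Gaussian characteristic function inside, and
  \<open>integral_m\<close> evaluates the rest.\<close>

lemma kernel_fubini:
  assumes t: "0 < t"
  shows "integrable lborel (kern t :: real ^ 'n \<Rightarrow> real)"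
    and "(LINT u|lborel. phase k u * complex_of_real (kern t (u :: real ^ 'n))) = complex_of_real (d (sum_squares k / 2) t)"
proof -
  note [measurable] = measurable_m[OF t]
  define q where "q = (\<lambda>(u :: real ^ 'n) y. indicator {0<..} y * gauss y u * m y t)"
  have qnn: "0 \<le> q u y" for u y unfolding q_def by (intro mult_nonneg_nonneg gauss_nonneg m_nonneg t) auto
  have qm [measurable]: "(\<lambda>(u, y). q u y) \<in> borel_measurable (lborel \<Otimes>\<^sub>M lborel)"
  proof -
    have "(\<lambda>p. indicator {0<..} (snd p) * (case p of (u, y) \<Rightarrow> gauss y (u :: real ^ 'n)) * m (snd p) t) \<in> borel_measurable (borel \<Otimes>\<^sub>M borel)"
      by measurable
    then show ?thesis by (simp add: q_def case_prod_beta')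
  qed
  have qi: "integrable (lborel \<Otimes>\<^sub>M lborel) (\<lambda>(u, y). q u y)"
  proof (rule integrableI_bounded)
    have "(\<integral>\<^sup>+ p. ennreal (norm (case p of (u, y) \<Rightarrow> q u y)) \<partial>(lborel \<Otimes>\<^sub>M lborel))
      = (\<integral>\<^sup>+ y. \<integral>\<^sup>+ u. ennreal (norm (case (u, y) of (u, y) \<Rightarrow> q u y)) \<partial>lborel \<partial>lborel)"
      by (rule lborel_pair.nn_integral_snd[symmetric]) measurable
    also have "\<dots> \<le> (\<integral>\<^sup>+ y. ennreal (m y t) \<partial>lborel)"
    proof (rule nn_integral_mono)
      fix y :: real
      show "(\<integral>\<^sup>+ u. ennreal (norm (case (u, y) of (u, y) \<Rightarrow> q u y)) \<partial>lborel) \<le> ennreal (m y t)"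
      proof (cases "0 < y")
        case True
        have "(\<integral>\<^sup>+ u. ennreal (norm (case (u, y) of (u, y) \<Rightarrow> q u y)) \<partial>lborel)
          = (\<integral>\<^sup>+ u. ennreal (m y t) * ennreal (gauss y (u :: real ^ 'n)) \<partial>lborel)"
        proof (rule nn_integral_cong)
          fix u :: "real ^ 'n"
          have "norm (q u y) = m y t * gauss y u"
            using qnn[of u y] True by (simp add: q_def)
          then show "ennreal (norm (case (u, y) of (u, y) \<Rightarrow> q u y)) = ennreal (m y t) * ennreal (gauss y u)"
            using ennreal_mult[OF m_nonneg[OF t] gauss_nonneg] by simp
        qed
        also have "\<dots> = ennreal (m y t) * (\<integral>\<^sup>+ u. ennreal (gauss y (u :: real ^ 'n)) \<partial>lborel)"
          by (rule nn_integral_cmult) (simp add: measurable_Pair1'[THEN measurable_compose, OF _ measurable_gauss])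
        finally show ?thesis by (simp add: nn_integral_gauss[OF True])
      qed (simp add: q_def)
    qed
    also have "\<dots> = (\<integral>\<^sup>+ \<omega>. 1 \<partial>M)"
      using distributed_nn_integral[OF m_density[OF t], of "\<lambda>_. 1"] by simp
    also have "\<dots> < \<infinity>" by (simp add: M.emeasure_space_1)
    finally show "(\<integral>\<^sup>+ p. ennreal (norm (case p of (u, y) \<Rightarrow> q u y)) \<partial>(lborel \<Otimes>\<^sub>M lborel)) < \<infinity>" .
  qed measurable
  show ki: "integrable lborel (kern t :: real ^ 'n \<Rightarrow> real)"
    using lborel_pair.integrable_fst[OF qi] by (simp add: kern_def[abs_def] q_def)
  have qki: "integrable (lborel \<Otimes>\<^sub>M lborel) (\<lambda>(u, y). phase k u * complex_of_real (q u y))"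
  proof (rule Bochner_Integration.integrable_bound[OF qi])
    have "(\<lambda>p. phase k (fst p) * complex_of_real (case p of (u, y) \<Rightarrow> q u y)) \<in> borel_measurable (lborel \<Otimes>\<^sub>M lborel)"
      by measurable
    then show "(\<lambda>(u, y). phase k u * complex_of_real (q u y)) \<in> borel_measurable (lborel \<Otimes>\<^sub>M lborel)"
      by (simp add: case_prod_beta')
  qed (auto simp: norm_mult norm_phase)
  have "(LINT u|lborel. phase k u * complex_of_real (kern t (u :: real ^ 'n)))
    = (LINT u|lborel. LINT y|lborel. phase k u * complex_of_real (q u y))"
    by (simp add: kern_def q_def integral_complex_of_real del: of_real_mult)
  also have "\<dots> = (LINT y|lborel. LINT u|lborel. phase k u * complex_of_real (q u y))"
    using lborel_pair.Fubini_integral[OF qki] by simp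
  also have "\<dots> = (LINT y|lborel. complex_of_real (m y t * (indicator {0<..} y * exp (- (sum_squares k / 2 * y)))))"
  proof (rule Bochner_Integration.integral_cong)
    fix y :: real
    show "(LINT u|lborel. phase k u * complex_of_real (q u y)) = complex_of_real (m y t * (indicator {0<..} y * exp (- (sum_squares k / 2 * y))))"
    proof (cases "0 < y")
      case True
      have "(LINT u|lborel. phase k u * complex_of_real (q u y))
        = (LINT u|lborel. complex_of_real (m y t) * (complex_of_real (gauss y u) * phase k u))"
        using True by (simp add: q_def mult_ac)
      also have "\<dots> = complex_of_real (m y t) * (LINT u|lborel. (complex_of_real (gauss y u) * phase k u))"
        by (rule Bochner_Integration.integral_mult_right_zero)
      finally show ?thesis using integral_gauss_phase(2)[OF True, of k] True by simp
    qed (simp add: q_def)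
  qed simp
  also have "\<dots> = complex_of_real (d (sum_squares k / 2) t)"
    using integral_m[OF t, of "sum_squares k / 2"] by (simp only: integral_complex_of_real) (simp add: sum_squares_def sum_nonneg)
  finally show "(LINT u|lborel. phase k u * complex_of_real (kern t (u :: real ^ 'n))) = complex_of_real (d (sum_squares k / 2) t)" .
qed

lemma W_op_eq_kern:
  fixes f :: "complex ^ 'n \<Rightarrow> complex"
  assumes t: "0 < t"
  shows "W_op m t f z = (LINT u|lborel. f (rot z u) * complex_of_real (kern t u))"
proof -
  let ?C = "(2 * pi) powr (real CARD('n) / 2)"
  have k: "kern t u = (LBINT y:{0<..}. exp (- ((\<Sum>j\<in>UNIV. (u $ j)\<^sup>2) / (2 * y))) / y powr (real CARD('n) / 2) * m y t) / ?C"
    for u :: "real ^ 'n"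
  proof -
    have "kern t u = (LINT y|lborel. (indicator {0<..} y *\<^sub>R (exp (- ((\<Sum>j\<in>UNIV. (u $ j)\<^sup>2) / (2 * y))) / y powr (real CARD('n) / 2) * m y t)) / ?C)"
      unfolding kern_def by (rule Bochner_Integration.integral_cong) (auto simp: gauss_eq indicator_def)
    then show ?thesis by (simp only: set_lebesgue_integral_def Bochner_Integration.integral_divide_zero)
  qed
  show ?thesis
    using t unfolding W_op_def k rot_def by (simp del: Bochner_Integration.integral_divide_zero add: Bochner_Integration.integral_divide_zero[symmetric])
qed

end

section \<open>The power series of the solution and of its Laplace transform\<close>

locale polydisc_expansion = inverse_subordinator_density \<nu> M b H m
  for \<nu> :: "real measure" and M :: "'a measure" and b :: real and H :: "real \<Rightarrow> 'a \<Rightarrow> real" and m :: "real \<Rightarrow> real \<Rightarrow> real" +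
  fixes f :: "complex ^ 'n \<Rightarrow> complex" and a :: "('n \<Rightarrow> nat) \<Rightarrow> complex"
  assumes f: "f \<in> polydisc_algebra"
    and expansion: "\<And>z. z \<in> polydisc \<Longrightarrow> ((\<lambda>k. a k * monomial z k) has_sum f z) UNIV"
begin

abbreviation "W \<equiv> \<lambda>t. W_op m t f"

lemma abs_summable: "z \<in> polydisc \<Longrightarrow> (\<lambda>k. norm (a k * monomial z k)) summable_on UNIV"
  using expansion[of z] by (subst summable_on_iff_abs_summable_on_complex[symmetric]) (auto simp: summable_on_def)

lemma sum_squares_nonneg: "0 \<le> sum_squares k" by (simp add: sum_squares_def sum_nonneg)

text \<open>A rotation changes the terms of the expansion by phases only, so absolute convergence at
  \<open>z\<close> dominates the series along the whole orbit and it may be integrated against the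
  kernel. At \<open>t = 0\<close> all values of \<open>d\<close> are 1 and the expansion of
  \<open>f\<close> itself remains.\<close>

lemma W_has_sum:
  assumes z: "z \<in> polydisc" and t: "0 \<le> t"
  shows "((\<lambda>k. a k * monomial z k * complex_of_real (d (sum_squares k / 2) t)) has_sum W t z) UNIV"
proof (cases "t = 0")
  case True
  then show ?thesis using expansion[OF z] by (simp add: W_op_def d_nonpos)
next
  case False
  with t have t: "0 < t" by simp
  have "((\<lambda>k. a k * monomial z k * (LINT u|lborel. phase k u * complex_of_real (kern t u))) has_sum
    (LINT u|lborel. f (rot z u) * complex_of_real (kern t u))) UNIV"
  proof (rule has_sum_integral_countable(1)[OF abs_summable[OF z], where B="kern t"])
    have [measurable]: "(kern t :: real ^ 'n \<Rightarrow> real) \<in> borel_measurable borel"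
      using borel_measurable_integrable[OF kernel_fubini(1)[OF t]] by simp
    show "(\<lambda>u. phase k u * complex_of_real (kern t (u :: real ^ 'n))) \<in> borel_measurable lborel" for k by measurable
    show "norm (phase k u * complex_of_real (kern t u)) \<le> kern t u" for k and u :: "real ^ 'n"
      using kern_nonneg[OF t] by (simp add: norm_mult norm_phase)
    show "((\<lambda>k. a k * monomial z k * (phase k u * complex_of_real (kern t u))) has_sum f (rot z u) * complex_of_real (kern t u)) UNIV"
      for u
      using has_sum_cmult_left[OF expansion[OF rot_polydisc[OF z, of u]], of "complex_of_real (kern t u)"]
      by (simp add: monomial_rot mult_ac)
  qed (rule kernel_fubini(1)[OF t])
  then show ?thesis by (simp only: kernel_fubini(2)[OF t] W_op_eq_kern[OF t])
qed

text \<open>The same interchange, now in time: \<open>0 \<le> d \<le> 1\<close> makes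
  \<open>exp (- (\<theta> * t))\<close> a common majorant, and the terms integrate by
  \<open>laplace_d\<close>.\<close>

lemma laplace_W:
  assumes z: "z \<in> polydisc" and \<theta>: "0 < \<theta>"
  shows "set_integrable lborel {0<..} (\<lambda>t. complex_of_real (exp (- (\<theta> * t))) * W t z)" (is ?A)
    and "((\<lambda>k. a k * monomial z k * complex_of_real ((g \<theta> / \<theta>) / (g \<theta> + sum_squares k / 2)))
        has_sum (LBINT t:{0<..}. complex_of_real (exp (- (\<theta> * t))) * W t z)) UNIV" (is ?B)
proof -
  define \<psi> where "\<psi> k t = indicator {0<..} t *\<^sub>R (complex_of_real (exp (- (\<theta> * t)) * d (sum_squares k / 2) t))" for k :: "'n \<Rightarrow> nat" and t
  have ip: "(LINT t|lborel. \<psi> k t) = complex_of_real ((g \<theta> / \<theta>) / (g \<theta> + sum_squares k / 2))" for k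
  proof -
    have "(LINT t|lborel. \<psi> k t) = (LINT t|lborel. complex_of_real (indicator {0<..} t *\<^sub>R (exp (- (\<theta> * t)) * d (sum_squares k / 2) t)))"
      by (rule Bochner_Integration.integral_cong) (auto simp: \<psi>_def indicator_def)
    also have "\<dots> = complex_of_real (LBINT t:{0<..}. exp (- (\<theta> * t)) * d (sum_squares k / 2) t)"
      unfolding set_lebesgue_integral_def by (rule integral_complex_of_real)
    finally show ?thesis by (simp only: laplace_d(2)[OF \<theta> divide_nonneg_nonneg[OF sum_squares_nonneg zero_le_numeral]])
  qed
  note [measurable] = measurable_d[of "sum_squares (k :: 'n \<Rightarrow> nat) / 2" for k, OF divide_nonneg_nonneg[OF sum_squares_nonneg zero_le_numeral]]
  have m: "\<psi> k \<in> borel_measurable lborel" for k unfolding \<psi>_def by measurable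
  have n: "norm (\<psi> k t) \<le> indicator {0<..} t *\<^sub>R exp (- (\<theta> * t))" for k t
    using d_nonneg[of "sum_squares k / 2" t] d_le_1[of "sum_squares k / 2" t] sum_squares_nonneg[of k]
    by (auto simp: \<psi>_def indicator_def norm_mult intro: mult_left_le)
  have i: "integrable lborel (\<lambda>t. indicator {0<..} t *\<^sub>R exp (- (\<theta> * t)))"
    using laplace_d(1)[OF \<theta>, of 0] by (simp add: set_integrable_def d_def M.prob_space)
  have s: "((\<lambda>k. a k * monomial z k * \<psi> k t) has_sum indicator {0<..} t *\<^sub>R (complex_of_real (exp (- (\<theta> * t))) * W t z)) UNIV" for t
  proof (cases "0 < t")
    case True
    have "((\<lambda>k. a k * monomial z k * complex_of_real (d (sum_squares k / 2) t) * complex_of_real (exp (- (\<theta> * t))))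
        has_sum W t z * complex_of_real (exp (- (\<theta> * t)))) UNIV"
      using True by (intro has_sum_cmult_left W_has_sum z) simp
    then show ?thesis using True by (simp add: \<psi>_def mult_ac)
  qed (simp add: \<psi>_def)
  note * = has_sum_integral_countable[OF abs_summable[OF z] m n i s]
  show ?A using *(2) by (simp only: set_integrable_def)
  show ?B using *(1) by (simp only: ip set_lebesgue_integral_def)
qed

end

section \<open>The fractional Cauchy problem\<close>

lemma has_sum_finite_sum:
  fixes h :: "'j \<Rightarrow> 'k \<Rightarrow> complex"
  assumes "finite J" and "\<And>j. j \<in> J \<Longrightarrow> (h j has_sum s j) A"
  shows "((\<lambda>k. \<Sum>j\<in>J. h j k) has_sum (\<Sum>j\<in>J. s j)) A"
  using assms by (induction J rule: finite_induct) (auto intro: has_sum_add)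

section \<open>Changing one coordinate, and angular derivatives\<close>

lemma vec_upd_nth: "vec_upd z j c $ i = (if i = j then c else z $ i)"
  by (simp add: vec_upd_def)

lemma vec_upd_same: "vec_upd z j (z $ j) = z"
  by (simp add: vec_upd_def vec_eq_iff)

lemma rot_vec_upd: "rot (vec_upd z j c) u = vec_upd (rot z u) j (c * exp (- (\<i> * complex_of_real (u $ j))))"
  by (simp add: vec_upd_def rot_def vec_eq_iff)

lemma vec_upd_polydisc: "z \<in> polydisc \<Longrightarrow> c \<in> ball 0 1 \<Longrightarrow> vec_upd z j c \<in> polydisc"
  and vec_upd_closed_polydisc: "z \<in> closed_polydisc \<Longrightarrow> c \<in> cball 0 1 \<Longrightarrow> vec_upd z j c \<in> closed_polydisc"
  by (auto simp: polydisc_def closed_polydisc_def vec_upd_nth)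

lemma polydisc_subset: "polydisc \<subseteq> closed_polydisc"
  by (auto simp: polydisc_def closed_polydisc_def less_imp_le)

lemma monomial_vec_upd: "monomial (vec_upd z j c) k = monomial (vec_upd z j 1) k * c ^ k j"
proof -
  have "(\<Prod>i\<in>UNIV - {j}. (vec_upd z j c $ i) ^ k i) = (\<Prod>i\<in>UNIV - {j}. (vec_upd z j 1 $ i) ^ k i)"
    by (rule prod.cong) (auto simp: vec_upd_nth)
  then show ?thesis unfolding monomial_def
    by (subst (1 2) prod.remove[of _ j]) (auto simp: vec_upd_nth)
qed

lemma continuous_on_monomial: "continuous_on A (\<lambda>z. monomial z k)"
  unfolding monomial_def by (intro continuous_intros)

lemma norm_monomial_mono:
  assumes "\<And>j. norm (z $ j) \<le> norm (w $ j)"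
  shows "norm (monomial z k) \<le> norm (monomial w k)"
  unfolding monomial_def prod_norm[symmetric] norm_power
  by (intro prod_mono conjI power_mono assms) auto

text \<open>Along a circle the angular derivative is \<open>\<i>\<close> times the Euler operator of
  \<open>has_sum_mult_deriv\<close>.\<close>

lemma has_vector_derivative_polar:
  assumes "(h has_field_derivative D) (at (complex_of_real r * cis \<psi>))"
  shows "((\<lambda>\<psi>. h (complex_of_real r * cis \<psi>)) has_vector_derivative \<i> * (complex_of_real r * cis \<psi> * D)) (at \<psi>)"
proof -
  have "((\<lambda>w. complex_of_real r * exp (\<i> * w)) has_field_derivative \<i> * (complex_of_real r * cis \<psi>)) (at (complex_of_real \<psi>))"
    by (auto intro!: derivative_eq_intros simp: cis_conv_exp)
  note A = this
  have "(h has_field_derivative D) (at (complex_of_real r * exp (\<i> * complex_of_real \<psi>)))"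
    using assms by (simp add: cis_conv_exp)
  from DERIV_chain2[OF this A] have "((\<lambda>w. h (complex_of_real r * exp (\<i> * w))) has_field_derivative D * (\<i> * (complex_of_real r * cis \<psi>))) (at (complex_of_real \<psi>))"
    .
  from has_vector_derivative_real_field[OF this, of UNIV] show ?thesis
    by (simp add: cis_conv_exp mult_ac)
qed

text \<open>Two angular derivatives give minus the square of the Euler operator, an expression in
  \<open>z $ j\<close> that no longer mentions the argument. The two derivatives are stated as well,
  since computing with \<open>vector_derivative\<close> requires knowing that they exist.\<close>

lemma angular_deriv2_eq:
  fixes F :: "complex ^ 'n \<Rightarrow> complex"
  assumes z: "norm (z $ j) < 1" and h: "(\<lambda>c. F (vec_upd z j c)) holomorphic_on ball 0 1"
  defines "h1 \<equiv> \<lambda>c. c * deriv (\<lambda>c. F (vec_upd z j c)) c"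
  shows "((\<lambda>\<psi>. F (vec_upd z j (complex_of_real (norm (z $ j)) * cis \<psi>))) has_vector_derivative
      \<i> * h1 (complex_of_real (norm (z $ j)) * cis \<psi>)) (at \<psi>)"
    and "((\<lambda>\<psi>. \<i> * h1 (complex_of_real (norm (z $ j)) * cis \<psi>)) has_vector_derivative - (z $ j * deriv h1 (z $ j))) (at (Arg (z $ j)))"
    and "angular_deriv2 j F z = - (z $ j * deriv h1 (z $ j))"
proof -
  let ?h = "\<lambda>c. F (vec_upd z j c)" and ?p = "\<lambda>\<psi>. complex_of_real (norm (z $ j)) * cis \<psi>"
  have h1: "h1 holomorphic_on ball 0 1"
    unfolding h1_def by (intro holomorphic_intros h) auto
  have p: "?p \<psi> \<in> ball 0 1" for \<psi> using z by (simp add: norm_mult)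
  show d1: "((\<lambda>\<psi>. ?h (?p \<psi>)) has_vector_derivative \<i> * h1 (?p \<psi>)) (at \<psi>)" for \<psi>
    unfolding h1_def by (rule has_vector_derivative_polar[OF holomorphic_derivI[OF h open_ball p]])
  have pz: "?p (Arg (z $ j)) = z $ j" using rcis_cmod_Arg[of "z $ j"] by (simp add: rcis_def)
  have "((\<lambda>\<psi>. \<i> * h1 (?p \<psi>)) has_vector_derivative \<i> * (\<i> * (?p (Arg (z $ j)) * deriv h1 (?p (Arg (z $ j)))))) (at (Arg (z $ j)))"
    by (intro has_vector_derivative_mult_right has_vector_derivative_polar holomorphic_derivI[OF h1 open_ball p])
  then show d2: "((\<lambda>\<psi>. \<i> * h1 (?p \<psi>)) has_vector_derivative - (z $ j * deriv h1 (z $ j))) (at (Arg (z $ j)))"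
    unfolding pz by (simp add: mult.assoc[symmetric])
  show "angular_deriv2 j F z = - (z $ j * deriv h1 (z $ j))"
    unfolding angular_deriv2_def vector_derivative_at[OF d1] by (rule vector_derivative_at[OF d2])
qed

context polydisc_expansion
begin

text \<open>On a smaller closed polydisc of radius \<open>r < 1\<close> the series at the point with
  all coordinates \<open>r\<close> is a majorant for all times at once, because \<open>d\<close> is
  at most 1. Every point of the open polydisc has a neighbourhood inside such a set, so continuity
  follows locally.\<close>

lemma continuous_on_W: "continuous_on (polydisc \<times> {0..}) (\<lambda>(z, t). W t z)"
proof -
  have V: "continuous_on ({z :: complex ^ 'n. \<forall>j. norm (z $ j) \<le> r} \<times> {0..}) (\<lambda>(z, t). W t z)"
    if r: "0 < r" "r < 1" for r
  proof (rule uniform_limit_theorem)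
    let ?V = "{z :: complex ^ 'n. \<forall>j. norm (z $ j) \<le> r}"
    let ?r = "(\<chi> j. complex_of_real r) :: complex ^ 'n"
    have rp: "?r \<in> polydisc" using r by (simp add: polydisc_def)
    have Vp: "z \<in> polydisc" if "z \<in> ?V" for z
    proof -
      have "norm (z $ j) < 1" for j using that r by (auto intro: le_less_trans)
      then show ?thesis by (simp add: polydisc_def)
    qed
    show "uniform_limit (?V \<times> {0..}) (\<lambda>X (z, t). \<Sum>k\<in>X. a k * monomial z k * complex_of_real (d (sum_squares k / 2) t))
        (\<lambda>(z, t). W t z) (finite_subsets_at_top UNIV)"
      unfolding case_prod_beta'
    proof (rule Weierstrass_m_test_general'[OF _ _ abs_summable[OF rp]])
      fix k :: "'n \<Rightarrow> nat" and p :: "(complex ^ 'n) \<times> real" assume p: "p \<in> ?V \<times> {0..}"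
      have "norm (monomial (fst p) k) \<le> norm (monomial ?r k)"
        using p r by (intro norm_monomial_mono) auto
      moreover have "norm (complex_of_real (d (sum_squares k / 2) (snd p))) \<le> 1"
        using d_nonneg[of "sum_squares k / 2" "snd p"] d_le_1[of "sum_squares k / 2" "snd p"] sum_squares_nonneg[of k] by simp
      ultimately show "norm (a k * monomial (fst p) k * complex_of_real (d (sum_squares k / 2) (snd p))) \<le> norm (a k * monomial ?r k)"
        using mult_mono[of "norm (a k * monomial (fst p) k)" "norm (a k * monomial ?r k)"
            "norm (complex_of_real (d (sum_squares k / 2) (snd p)))" 1]
        by (simp add: norm_mult mult_left_mono)
    next
      fix p :: "(complex ^ 'n) \<times> real" assume "p \<in> ?V \<times> {0..}"
      then show "((\<lambda>k. a k * monomial (fst p) k * complex_of_real (d (sum_squares k / 2) (snd p))) has_sum W (snd p) (fst p)) UNIV"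
        by (intro W_has_sum Vp) auto
    qed
    have "continuous_on (?V \<times> {0..}) (\<lambda>p. monomial (fst p) k)" for k
      by (rule continuous_on_compose2[OF continuous_on_monomial[of UNIV]]) (auto intro!: continuous_intros)
    moreover have "continuous_on (?V \<times> {0..}) (\<lambda>p. d (sum_squares k / 2) (snd p))" for k :: "'n \<Rightarrow> nat"
      by (rule continuous_on_compose2[OF continuous_on_d[of _ UNIV]]) (auto intro!: continuous_intros simp: sum_squares_nonneg)
    ultimately show "\<forall>\<^sub>F X in finite_subsets_at_top UNIV. continuous_on (?V \<times> {0..}) (\<lambda>(z, t). \<Sum>k\<in>X. a k * monomial z k * complex_of_real (d (sum_squares k / 2) t))"
      unfolding case_prod_beta' by (intro always_eventually allI continuous_intros) auto
  qed simp
  show ?thesis unfolding continuous_on_eq_continuous_within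
  proof
    fix p :: "(complex ^ 'n) \<times> real" assume p: "p \<in> polydisc \<times> {0..}"
    define \<rho> where "\<rho> = Max (range (\<lambda>j. norm (fst p $ j)))"
    have \<rho>1: "\<rho> < 1" unfolding \<rho>_def using p by (subst Max_less_iff) (auto simp: polydisc_def)
    have \<rho>: "norm (fst p $ j) \<le> \<rho>" for j unfolding \<rho>_def by (rule Max_ge) auto
    then have "0 \<le> \<rho>" using norm_ge_zero order_trans by blast
    define r where "r = (\<rho> + 1) / 2"
    have r: "0 < r" "r < 1" "\<rho> < r" using \<rho>1 \<open>0 \<le> \<rho>\<close> by (auto simp: r_def)
    let ?V = "{z :: complex ^ 'n. \<forall>j. norm (z $ j) \<le> r}"
    let ?O = "{z :: complex ^ 'n. \<forall>j. norm (z $ j) < r} \<times> (UNIV :: real set)"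
    have op: "open ?O"
    proof (rule open_Times)
      have "{z :: complex ^ 'n. \<forall>j. norm (z $ j) < r} = (\<Inter>j. {z. norm (z $ j) < r})" by auto
      also have "open \<dots>" by (intro open_INT ballI open_Collect_less continuous_intros) auto
      finally show "open {z :: complex ^ 'n. \<forall>j. norm (z $ j) < r}" .
    qed simp
    have pO: "p \<in> ?O" using le_less_trans[OF \<rho> r(3)] by (simp add: mem_Times_iff)
    have "at p within polydisc \<times> {0..} = at p within ?V \<times> {0..}"
    proof (rule at_within_nhd[OF pO op])
      show "polydisc \<times> {0..} \<inter> ?O - {p} = ?V \<times> {0..} \<inter> ?O - {p}"
        using r(2) by (auto simp: polydisc_def intro: less_trans less_imp_le)
    qed
    moreover have pV: "p \<in> ?V \<times> {0..}" using pO p by (auto simp: mem_Times_iff intro: less_imp_le)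
    ultimately show "continuous (at p within polydisc \<times> {0..}) (\<lambda>(z, t). W t z)"
      using bspec[OF V[OF r(1,2), unfolded continuous_on_eq_continuous_within] pV] by (simp only:)
  qed
qed

text \<open>Membership in \<open>polydisc_algebra\<close> is separate in each variable; joint
  continuity is read off from the power series, as the slice \<open>t = 0\<close>.\<close>

lemma continuous_on_f: "continuous_on polydisc f"
proof -
  have "continuous_on polydisc (\<lambda>z. (\<lambda>(z, t). W t z) (z, 0))"
    by (rule continuous_on_compose2[OF continuous_on_W]) (auto intro!: continuous_intros)
  then show ?thesis by (simp add: W_op_def)
qed

lemma f_disc: 
  assumes "z \<in> closed_polydisc"
  shows "(\<lambda>c. f (vec_upd z j c)) holomorphic_on ball 0 1" "continuous_on (cball 0 1) (\<lambda>c. f (vec_upd z j c))"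
  using f assms by (auto simp: polydisc_algebra_def disc_algebra_def analytic_on_open)

text \<open>Radial limits, taken in one variable after the other, exhibit \<open>f\<close> on the distinguished
  torus as an iterated pointwise limit of continuous functions.\<close>

lemma measurable_f_rot:
  assumes z: "z \<in> closed_polydisc"
  shows "(\<lambda>u. f (rot z u)) \<in> borel_measurable borel"
proof -
  \<comment> \<open>The coordinates in \<open>S\<close> are at full radius, the others are
    contracted by factors below 1. For \<open>S = {}\<close> the point lies in the open polydisc,
    where \<open>f\<close> is continuous; the induction sends one further factor to 1 at each
    step.\<close>
  define P where "P S r u = (\<chi> j. complex_of_real (if j \<in> S then 1 else r j) * rot z u $ j)" for S and r :: "'n \<Rightarrow> real" and u
  have "\<forall>r. (\<forall>j. 0 \<le> r j \<and> r j < 1) \<longrightarrow> (\<lambda>u. f (P S r u)) \<in> borel_measurable borel" if "finite S" for S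
    using that
  proof induction
    case empty
    show ?case
    proof (intro allI impI)
      fix r :: "'n \<Rightarrow> real" assume r: "\<forall>j. 0 \<le> r j \<and> r j < 1"
      have "P {} r u \<in> polydisc" for u
      proof -
        have "norm (P {} r u $ j) < 1" for j
        proof -
          have "norm (P {} r u $ j) = r j * norm (z $ j)" using r by (simp add: P_def norm_mult rot_nth_norm)
          also have "\<dots> \<le> r j * 1" using r z by (intro mult_left_mono) (auto simp: closed_polydisc_def)
          finally show ?thesis using r by (auto intro: le_less_trans)
        qed
        then show ?thesis by (simp add: polydisc_def)
      qed
      then have "continuous_on UNIV (\<lambda>u. f (P {} r u))"
        by (intro continuous_on_compose2[OF continuous_on_f]) (auto simp: P_def rot_def intro!: continuous_intros)
      then show "(\<lambda>u. f (P {} r u)) \<in> borel_measurable borel" by (rule borel_measurable_continuous_onI)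
    qed
  next
    case (insert i S)
    show ?case
    proof (intro allI impI)
      fix r :: "'n \<Rightarrow> real" assume r: "\<forall>j. 0 \<le> r j \<and> r j < 1"
      define \<rho> where "\<rho> n = real n / real (Suc n)" for n
      have \<rho>: "0 \<le> \<rho> n" "\<rho> n < 1" for n by (auto simp: \<rho>_def)
      show "(\<lambda>u. f (P (insert i S) r u)) \<in> borel_measurable borel"
      proof (rule borel_measurable_LIMSEQ_metric)
        show "(\<lambda>u. f (P S (r(i := \<rho> n)) u)) \<in> borel_measurable borel" for n
          using insert.IH r \<rho> by auto
        fix u :: "real ^ 'n"
        let ?Z = "P (insert i S) r u"
        have Z: "?Z \<in> closed_polydisc"
        proof -
          have "norm (?Z $ j) \<le> 1" for j
          proof -
            have "norm (?Z $ j) = (if j \<in> insert i S then 1 else r j) * norm (z $ j)"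
              using r by (simp add: P_def norm_mult rot_nth_norm)
            also have "\<dots> \<le> 1 * 1" using r z by (intro mult_mono) (auto simp: closed_polydisc_def less_imp_le)
            finally show ?thesis by simp
          qed
          then show ?thesis by (simp add: closed_polydisc_def)
        qed
        have eq: "P S (r(i := \<rho> n)) u = vec_upd ?Z i (complex_of_real (\<rho> n) * rot z u $ i)" for n
          using insert.hyps by (auto simp: P_def vec_upd_def vec_eq_iff)
        have eq1: "vec_upd ?Z i (rot z u $ i) = ?Z" by (auto simp: P_def vec_upd_def vec_eq_iff)
        have Zi: "rot z u $ i \<in> cball 0 1" using rot_closed_polydisc[OF z, of u] by (simp add: closed_polydisc_def)
        have "(\<lambda>n. complex_of_real (\<rho> n) * rot z u $ i) \<longlonglongrightarrow> complex_of_real 1 * rot z u $ i"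
          unfolding \<rho>_def by (intro tendsto_intros LIMSEQ_n_over_Suc_n)
        moreover have "complex_of_real (\<rho> n) * rot z u $ i \<in> cball 0 1" for n
        proof -
          have "\<rho> n * norm (rot z u $ i) \<le> 1 * 1" using \<rho>[of n] Zi by (intro mult_mono) auto
          then show ?thesis using \<rho>[of n] by (simp add: norm_mult)
        qed
        ultimately have "(\<lambda>n. f (vec_upd ?Z i (complex_of_real (\<rho> n) * rot z u $ i))) \<longlonglongrightarrow> f (vec_upd ?Z i (rot z u $ i))"
          using continuous_on_tendsto_compose[OF f_disc(2)[OF Z, of i], of "\<lambda>n. complex_of_real (\<rho> n) * rot z u $ i" "rot z u $ i" sequentially] Zi
          by simp
        then show "(\<lambda>n. f (P S (r(i := \<rho> n)) u)) \<longlonglongrightarrow> f ?Z" by (simp only: eq eq1)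
      qed
    qed
  qed
  from this[of UNIV] have "(\<lambda>u. f (P UNIV (\<lambda>_. 0) u)) \<in> borel_measurable borel" by simp
  also have "(\<lambda>u. f (P UNIV (\<lambda>_. 0) u)) = (\<lambda>u. f (rot z u))" by (simp add: P_def)
  finally show ?thesis .
qed

text \<open>When other coordinates lie on the boundary there is no power series, so the kernel
  integral is used directly. The bound of \<open>f\<close> times the kernel is an integrable
  majorant: it gives holomorphy by differentiation under the integral and continuity up to the
  circle by dominated convergence.\<close>

lemma W_polydisc_algebra:
  assumes bdd: "bounded (f ` closed_polydisc)" and t: "0 < t"
  shows "W t \<in> polydisc_algebra"
proof -
  obtain C where C: "\<And>z. z \<in> closed_polydisc \<Longrightarrow> norm (f z) \<le> C"
    using bdd unfolding bounded_iff by blast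
  have ki: "integrable lborel (\<lambda>u. C * kern t (u :: real ^ 'n))" by (intro integrable_mult_right kernel_fubini(1)[OF t])
  have [measurable]: "(kern t :: real ^ 'n \<Rightarrow> real) \<in> borel_measurable borel"
    using borel_measurable_integrable[OF kernel_fubini(1)[OF t]] by simp
  have "(\<lambda>c. W t (vec_upd z j c)) holomorphic_on ball 0 1 \<and> continuous_on (cball 0 1) (\<lambda>c. W t (vec_upd z j c))"
    if z: "z \<in> closed_polydisc" for z and j
  proof -
    define h where "h u c = f (rot (vec_upd z j c) u) * complex_of_real (kern t u)" for u c
    have Wh: "W t (vec_upd z j c) = (LINT u|lborel. h u c)" for c
      by (simp add: h_def W_op_eq_kern[OF t])
    have hm: "(\<lambda>u. h u c) \<in> borel_measurable lborel" if "c \<in> cball 0 1" for c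
      unfolding h_def using measurable_f_rot[OF vec_upd_closed_polydisc[OF z that]] by measurable
    have hb: "norm (h u c) \<le> C * kern t u" if "c \<in> cball 0 1" for u c
      using mult_right_mono[OF C[OF rot_closed_polydisc[OF vec_upd_closed_polydisc[OF z that]]] kern_nonneg[OF t]]
      by (simp add: h_def norm_mult kern_nonneg[OF t])
    have hcont: "continuous_on (cball 0 1) (h u)" for u
      unfolding h_def rot_vec_upd
      by (intro continuous_intros continuous_on_compose2[OF f_disc(2)[OF rot_closed_polydisc[OF z]]])
        (auto simp: norm_mult norm_exp_eq_Re)
    have hholo: "h u holomorphic_on ball 0 1" for u
      unfolding h_def rot_vec_upd
      by (intro holomorphic_intros holomorphic_on_compose_gen[OF _ f_disc(1)[OF rot_closed_polydisc[OF z]], unfolded o_def])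
        (auto simp: norm_mult norm_exp_eq_Re)
    have "(\<lambda>c. W t (vec_upd z j c)) field_differentiable at w" if w: "w \<in> ball 0 1" for w
    proof -
      have sub: "ball w (1 - norm w) \<subseteq> ball 0 1"
        by (subst ball_subset_ball_iff) simp
      have "((\<lambda>c. LINT u|lborel. h u c) has_field_derivative (LINT u|lborel. deriv (h u) w)) (at w)"
      proof (rule has_field_derivative_integral_holomorphic(2))
        show "0 < 1 - norm w" using w by simp
        show "w \<in> ball w ((1 - norm w) / 2)" using w by simp
        show "h u holomorphic_on ball w (1 - norm w)" for u by (rule holomorphic_on_subset[OF hholo sub])
        show "(\<lambda>u. h u c) \<in> borel_measurable lborel" if "c \<in> ball w (1 - norm w)" for c
          using that sub by (intro hm) (auto simp: less_imp_le subset_iff)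
        show "norm (h u c) \<le> C * kern t u" if "c \<in> ball w (1 - norm w)" for u c
          using that sub by (intro hb) (auto simp: less_imp_le subset_iff)
      qed (rule ki)
      then show ?thesis unfolding Wh field_differentiable_def by blast
    qed
    moreover have "continuous_on (cball 0 1) (\<lambda>c. W t (vec_upd z j c))"
    proof (rule continuous_on_sequentiallyI)
      fix X :: "nat \<Rightarrow> complex" and w assume X: "\<forall>n. X n \<in> cball 0 1" "w \<in> cball 0 1" "X \<longlonglongrightarrow> w"
      show "(\<lambda>n. W t (vec_upd z j (X n))) \<longlonglongrightarrow> W t (vec_upd z j w)" unfolding Wh
      proof (rule integral_dominated_convergence[OF hm hm ki])
        show "AE u in lborel. (\<lambda>n. h u (X n)) \<longlonglongrightarrow> h u w"
          using X by (intro AE_I2 continuous_on_tendsto_compose[OF hcont]) auto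
      qed (use X hb in auto)
    qed
    ultimately show ?thesis by (auto simp: holomorphic_on_def intro: field_differentiable_at_within)
  qed
  then show ?thesis by (auto simp: polydisc_algebra_def disc_algebra_def analytic_on_open)
qed

lemma angular_deriv2_W_has_sum:
  assumes z: "z \<in> polydisc" and t: "0 \<le> t"
  shows "((\<lambda>k. - (of_nat (k j))\<^sup>2 * (a k * monomial z k * complex_of_real (d (sum_squares k / 2) t))) has_sum
    angular_deriv2 j (W t) z) UNIV"
proof -
  \<comment> \<open>Setting the \<open>j\<close>-th coordinate to 1 strips its factor from the
    monomial, which leaves a one-variable series with exponents \<open>k j\<close>, to which the
    Euler operator is applied twice.\<close>
  define \<alpha> where "\<alpha> k = a k * complex_of_real (d (sum_squares k / 2) t) * monomial (vec_upd z j 1) k" for k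
  have s0: "((\<lambda>k. \<alpha> k * c ^ k j) has_sum W t (vec_upd z j c)) UNIV" if "c \<in> ball 0 1" for c
    using W_has_sum[OF vec_upd_polydisc[OF z that, of j] t] 
    by (subst (asm) monomial_vec_upd) (simp add: \<alpha>_def mult_ac)
  define h1 where "h1 c = c * deriv (\<lambda>c. W t (vec_upd z j c)) c" for c
  have s1: "((\<lambda>k. (of_nat (k j) * \<alpha> k) * c ^ k j) has_sum h1 c) UNIV" if "c \<in> ball 0 1" for c
    unfolding h1_def using has_sum_mult_deriv(2)[OF s0 that] by simp
  have zj: "norm (z $ j) < 1" "z $ j \<in> ball 0 1" using z by (auto simp: polydisc_def)
  have "((\<lambda>k. of_nat (k j) * (of_nat (k j) * \<alpha> k) * (z $ j) ^ k j) has_sum (z $ j * deriv h1 (z $ j))) UNIV"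
    by (rule has_sum_mult_deriv(2)[OF s1 zj(2)])
  then have "((\<lambda>k. - (of_nat (k j) * (of_nat (k j) * \<alpha> k) * (z $ j) ^ k j)) has_sum - (z $ j * deriv h1 (z $ j))) UNIV"
    by (simp add: has_sum_uminus)
  moreover have "- (of_nat (k j) * (of_nat (k j) * \<alpha> k) * (z $ j) ^ k j)
      = - (of_nat (k j))\<^sup>2 * (a k * monomial z k * complex_of_real (d (sum_squares k / 2) t))" for k
    using monomial_vec_upd[of z j "z $ j" k] by (simp add: vec_upd_same \<alpha>_def power2_eq_square mult_ac)
  ultimately show ?thesis
    using angular_deriv2_eq(3)[OF zj(1), of "W t"] has_sum_mult_deriv(1)[OF s0] unfolding h1_def by simp
qed

lemma angular_laplacian_W_has_sum:
  assumes z: "z \<in> polydisc" and t: "0 \<le> t"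
  shows "((\<lambda>k. complex_of_real (- (sum_squares k / 2)) * (a k * monomial z k) * complex_of_real (d (sum_squares k / 2) t)) has_sum
    1 / 2 * (\<Sum>j\<in>UNIV. angular_deriv2 j (W t) z)) UNIV"
proof -
  have "((\<lambda>k. 1 / 2 * (\<Sum>j\<in>UNIV. - (of_nat (k j))\<^sup>2 * (a k * monomial z k * complex_of_real (d (sum_squares k / 2) t)))) has_sum
    1 / 2 * (\<Sum>j\<in>UNIV. angular_deriv2 j (W t) z)) UNIV"
    by (intro has_sum_cmult_right has_sum_finite_sum angular_deriv2_W_has_sum z t) auto
  moreover have "1 / 2 * (\<Sum>j\<in>UNIV. - (of_nat (k j))\<^sup>2 * (a k * monomial z k * complex_of_real (d (sum_squares k / 2) t)))
    = complex_of_real (- (sum_squares k / 2)) * (a k * monomial z k) * complex_of_real (d (sum_squares k / 2) t)" for k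
    unfolding sum_distrib_right[symmetric] sum_squares_def by (simp add: sum_negf mult_ac)
  ultimately show ?thesis by simp
qed

text \<open>Summing the Volterra equations over \<open>k\<close> shows that the expression under the
  generalized derivative is the time integral of the angular Laplacian \<open>L\<close>. As
  \<open>L\<close> is continuous, the fundamental theorem of calculus differentiates the sum as a
  whole.\<close>

lemma W_generalized_derivative:
  assumes z: "z \<in> polydisc" and t: "0 < t"
  shows "has_generalized_derivative b \<nu> (\<lambda>t. W t z) (1 / 2 * (\<Sum>j\<in>UNIV. angular_deriv2 j (W t) z)) t"
proof -
  define L where "L s = 1 / 2 * (\<Sum>j\<in>UNIV. angular_deriv2 j (W s) z)" for s
  let ?c = "\<lambda>k. a k * monomial z k" and ?d = "\<lambda>k :: 'n \<Rightarrow> nat. d (sum_squares k / 2)"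
  let ?c' = "\<lambda>k. complex_of_real (- (sum_squares k / 2)) * (a k * monomial z k)"
  have s2: "0 \<le> sum_squares k / 2" for k :: "'n \<Rightarrow> nat" using sum_squares_nonneg[of k] by simp
  note [measurable] = measurable_d[OF s2]
  have d01: "0 \<le> ?d k s" "?d k s \<le> 1" for k s using d_le_1[OF s2] by (simp_all add: d_nonneg)
  have Ls: "((\<lambda>k. ?c' k * complex_of_real (?d k s)) has_sum L s) UNIV" if "0 \<le> s" for s
    unfolding L_def by (rule angular_laplacian_W_has_sum[OF z that])
  \<comment> \<open>At time 0 every \<open>?d k\<close> is 1, so the series of the Laplacian at
    \<open>s = 0\<close> is the sum of the \<open>?c' k\<close>; its absolute convergence is the
    majorant for all times.\<close>
  have c': "(\<lambda>k. norm (?c' k)) summable_on UNIV"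
  proof -
    have "?c' summable_on UNIV" using Ls[of 0] by (auto simp: d_nonpos summable_on_def)
    then show ?thesis by (subst (asm) summable_on_iff_abs_summable_on_complex)
  qed
  have Lc: "continuous_on {0..} L"
  proof (rule uniform_limit_theorem)
    show "uniform_limit {0..} (\<lambda>X s. \<Sum>k\<in>X. ?c' k * complex_of_real (?d k s)) L (finite_subsets_at_top UNIV)"
    proof (rule Weierstrass_m_test_general'[OF _ _ c'])
      show "norm (?c' k * complex_of_real (?d k s)) \<le> norm (?c' k)" for k s
        using d01[of k s] unfolding norm_mult[of "?c' k"] by (intro mult_left_le) auto
    qed (use Ls in auto)
    show "\<forall>\<^sub>F X in finite_subsets_at_top UNIV. continuous_on {0..} (\<lambda>s. \<Sum>k\<in>X. ?c' k * complex_of_real (?d k s))"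
      by (intro always_eventually allI continuous_intros continuous_on_d s2)
  qed simp
  define \<Phi> where "\<Phi> \<tau> = b *\<^sub>R (W \<tau> z - W 0 z) + (LBINT s:{0<..<\<tau>}. levy_tail \<nu> (\<tau> - s) *\<^sub>R (W s z - W 0 z))" for \<tau>
  have eq: "\<Phi> \<tau> = (LBINT s:{0<..<\<tau>}. L s)" if \<tau>: "0 < \<tau>" for \<tau>
  proof -
    have inc: "((\<lambda>k. ?c k * complex_of_real (?d k s - 1)) has_sum (W s z - W 0 z)) UNIV" if "0 \<le> s" for s
    proof -
      have "((\<lambda>k. - (?c k * complex_of_real (?d k 0))) has_sum - W 0 z) UNIV"
        using W_has_sum[OF z order.refl] by (simp add: has_sum_uminus)
      from has_sum_add[OF W_has_sum[OF z that] this] show ?thesis by (simp add: d_nonpos right_diff_distrib)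
    qed
    define I where "I k = (LBINT s:{0<..<\<tau>}. levy_tail \<nu> (\<tau> - s) * (1 - ?d k s))" for k
    define J where "J k = (LBINT s:{0<..<\<tau>}. ?d k s)" for k
    have tail_i: "integrable lborel (\<lambda>s. indicator {0<..<\<tau>} s *\<^sub>R levy_tail \<nu> (\<tau> - s))"
      using set_integrable_convolution[of \<tau> "\<lambda>_. 1 :: real"] by (simp add: set_integrable_def)
    have "((\<lambda>k. ?c k * (LINT s|lborel. indicator {0<..<\<tau>} s *\<^sub>R (levy_tail \<nu> (\<tau> - s) *\<^sub>R complex_of_real (?d k s - 1)))) has_sum
      (LINT s|lborel. indicator {0<..<\<tau>} s *\<^sub>R (levy_tail \<nu> (\<tau> - s) *\<^sub>R (W s z - W 0 z)))) UNIV"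
    proof (rule has_sum_integral_countable(1)[OF abs_summable[OF z] _ _ tail_i])
      show "(\<lambda>s. indicator {0<..<\<tau>} s *\<^sub>R (levy_tail \<nu> (\<tau> - s) *\<^sub>R complex_of_real (?d k s - 1))) \<in> borel_measurable lborel" for k
        by measurable
      show "norm (indicator {0<..<\<tau>} s *\<^sub>R (levy_tail \<nu> (\<tau> - s) *\<^sub>R complex_of_real (?d k s - 1)))
          \<le> indicator {0<..<\<tau>} s *\<^sub>R levy_tail \<nu> (\<tau> - s)" for k s
      proof -
        have "norm (complex_of_real (?d k s - 1)) \<le> 1" using d01[of k s] unfolding norm_of_real by auto
        then show ?thesis using tail_nonneg by (auto simp: indicator_def intro: mult_left_le)
      qed
      show "((\<lambda>k. ?c k * (indicator {0<..<\<tau>} s *\<^sub>R (levy_tail \<nu> (\<tau> - s) *\<^sub>R complex_of_real (?d k s - 1)))) has_sum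
        indicator {0<..<\<tau>} s *\<^sub>R (levy_tail \<nu> (\<tau> - s) *\<^sub>R (W s z - W 0 z))) UNIV" for s
      proof (cases "s \<in> {0<..<\<tau>}")
        case True
        have "((\<lambda>k. complex_of_real (levy_tail \<nu> (\<tau> - s)) * (?c k * complex_of_real (?d k s - 1))) has_sum
          complex_of_real (levy_tail \<nu> (\<tau> - s)) * (W s z - W 0 z)) UNIV"
          using True by (intro has_sum_cmult_right inc) auto
        then show ?thesis using True by (simp add: scaleR_conv_of_real mult_ac)
      qed simp
    qed
    moreover have "(LINT s|lborel. indicator {0<..<\<tau>} s *\<^sub>R (levy_tail \<nu> (\<tau> - s) *\<^sub>R complex_of_real (?d k s - 1))) = complex_of_real (- I k)" for k
    proof -
      have "(LINT s|lborel. indicator {0<..<\<tau>} s *\<^sub>R (levy_tail \<nu> (\<tau> - s) *\<^sub>R complex_of_real (?d k s - 1)))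
        = (LINT s|lborel. complex_of_real (- (indicator {0<..<\<tau>} s *\<^sub>R (levy_tail \<nu> (\<tau> - s) * (1 - ?d k s)))))"
        by (rule Bochner_Integration.integral_cong) (auto simp: indicator_def scaleR_conv_of_real algebra_simps)
      then show ?thesis by (simp only: integral_complex_of_real integral_minus I_def set_lebesgue_integral_def)
    qed
    ultimately have "((\<lambda>k. ?c k * complex_of_real (- I k)) has_sum
      (LBINT s:{0<..<\<tau>}. levy_tail \<nu> (\<tau> - s) *\<^sub>R (W s z - W 0 z))) UNIV" by (simp only: set_lebesgue_integral_def)
    then have "((\<lambda>k. complex_of_real b * (?c k * complex_of_real (?d k \<tau> - 1)) + ?c k * complex_of_real (- I k)) has_sum \<Phi> \<tau>) UNIV"
      unfolding \<Phi>_def scaleR_conv_of_real[of b] using \<tau> by (intro has_sum_add has_sum_cmult_right inc) auto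
    \<comment> \<open>For each coefficient this is \<open>volterra_d\<close> with
      \<open>?d k - 1\<close> in place of \<open>1 - ?d k\<close>; the sign turns
      \<open>\<mu>\<close> into the eigenvalue \<open>- (sum_squares k / 2)\<close>.\<close>
    moreover have "complex_of_real b * (?c k * complex_of_real (?d k \<tau> - 1)) + ?c k * complex_of_real (- I k) = ?c' k * complex_of_real (J k)" for k
    proof -
      have v: "b * (?d k \<tau> - 1) - I k = - (sum_squares k / 2) * J k"
        using volterra_d[OF s2, of \<tau> k] \<tau> by (simp add: I_def J_def algebra_simps)
      have "complex_of_real b * (?c k * complex_of_real (?d k \<tau> - 1)) + ?c k * complex_of_real (- I k)
        = ?c k * complex_of_real (b * (?d k \<tau> - 1) - I k)" by (simp add: algebra_simps)
      then show ?thesis unfolding v by (simp add: mult_ac)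
    qed
    ultimately have "((\<lambda>k. ?c' k * complex_of_real (J k)) has_sum \<Phi> \<tau>) UNIV" by simp
    moreover have "((\<lambda>k. ?c' k * (LINT s|lborel. indicator {0<..<\<tau>} s *\<^sub>R complex_of_real (?d k s))) has_sum
      (LINT s|lborel. indicator {0<..<\<tau>} s *\<^sub>R L s)) UNIV"
    proof (rule has_sum_integral_countable(1)[OF c'])
      show "(\<lambda>s. indicator {0<..<\<tau>} s *\<^sub>R complex_of_real (?d k s)) \<in> borel_measurable lborel" for k by measurable
      show "norm (indicator {0<..<\<tau>} s *\<^sub>R complex_of_real (?d k s)) \<le> indicator {0<..<\<tau>} s" for k s
        using d01[of k s] by (auto simp: indicator_def)
      show "integrable lborel (\<lambda>s. indicator {0<..<\<tau>} s :: real)"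
        using set_integral_Ioo_eq_integral(1)[of \<tau> "\<lambda>_. 1 :: real"] by (simp add: set_integrable_def)
      show "((\<lambda>k. ?c' k * (indicator {0<..<\<tau>} s *\<^sub>R complex_of_real (?d k s))) has_sum indicator {0<..<\<tau>} s *\<^sub>R L s) UNIV" for s
        using Ls[of s] by (cases "s \<in> {0<..<\<tau>}") auto
    qed
    moreover have "(LINT s|lborel. indicator {0<..<\<tau>} s *\<^sub>R complex_of_real (?d k s)) = complex_of_real (J k)" for k
    proof -
      have "(LINT s|lborel. indicator {0<..<\<tau>} s *\<^sub>R complex_of_real (?d k s)) = (LINT s|lborel. complex_of_real (indicator {0<..<\<tau>} s *\<^sub>R ?d k s))"
        by (rule Bochner_Integration.integral_cong) (auto simp: indicator_def)
      then show ?thesis by (simp only: integral_complex_of_real J_def set_lebesgue_integral_def)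
    qed
    ultimately show ?thesis using has_sum_unique by (simp add: set_lebesgue_integral_def)
  qed
  have "((\<lambda>\<tau>. LBINT s:{0<..<\<tau>}. L s) has_vector_derivative L t) (at t)"
    by (rule has_vector_derivative_set_integral_Ioo[OF Lc t])
  then have "(\<Phi> has_vector_derivative L t) (at t)"
    by (rule has_vector_derivative_transform_within_open[of _ _ _ "{0<..}"]) (use t eq in auto)
  then show ?thesis unfolding has_generalized_derivative_def \<Phi>_def L_def .
qed

lemma cauchy_solution_W:
  assumes "bounded (f ` closed_polydisc)"
  shows "cauchy_solution b \<nu> f (\<lambda>z t. W t z)"
  unfolding cauchy_solution_def
proof (intro conjI allI ballI impI)
  show "(\<lambda>z. W t z) \<in> polydisc_algebra" if "0 < t" for t by (rule W_polydisc_algebra[OF assms that])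
  show "W 0 z = f z" for z by (simp add: W_op_def)
qed (rule continuous_on_W W_generalized_derivative; assumption)+

end

section \<open>Uniqueness\<close>

text \<open>The integral over \<open>x\<close> is holomorphic in the remaining variable, and two
  Euler operators pass through it. At a maximum of its real part on the circle through
  \<open>c1\<close> the second angular derivative is nonpositive, and it equals the integral of the
  second angular derivatives of the single functions. In the application \<open>x\<close> is
  time.\<close>

lemma
  fixes h :: "'x \<Rightarrow> complex \<Rightarrow> complex"
  assumes c1: "norm c1 < R"
    and holo: "\<And>x. x \<in> space M \<Longrightarrow> h x holomorphic_on ball 0 R"
    and meas: "\<And>c. c \<in> ball 0 R \<Longrightarrow> (\<lambda>x. h x c) \<in> borel_measurable M"
    and bound: "\<And>x c. x \<in> space M \<Longrightarrow> c \<in> ball 0 R \<Longrightarrow> norm (h x c) \<le> B x"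
    and B: "integrable M B"
    and max: "\<And>\<psi>. Re (LINT x|M. h x (complex_of_real (norm c1) * cis \<psi>)) \<le> Re (LINT x|M. h x c1)"
  shows integrable_angular_deriv2: "integrable M (\<lambda>x. - (c1 * deriv (\<lambda>c. c * deriv (h x) c) c1))"
    and integral_angular_deriv2_nonpos: "Re (LINT x|M. - (c1 * deriv (\<lambda>c. c * deriv (h x) c) c1)) \<le> 0"
proof -
  define k where "k x c = c * deriv (h x) c" for x c
  define G where "G c = (LINT x|M. h x c)" for c
  define G1 where "G1 c = (LINT x|M. k x c)" for c
  define D1 where "D1 = (LINT x|M. deriv (k x) c1)"
  have kx: "k x = (\<lambda>c. c * deriv (h x) c)" for x by (simp add: k_def fun_eq_iff)
  have sub: "ball c (R - norm c) \<subseteq> ball 0 R" for c :: complex by (subst ball_subset_ball_iff) simp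
  have loc: "(\<lambda>x. deriv (h x) c) \<in> borel_measurable M" "(G has_field_derivative (LINT x|M. deriv (h x) c)) (at c)"
    if c: "norm c < R" for c
  proof -
    have "c \<in> ball c ((R - norm c) / 2)" "0 < R - norm c" using c by auto
    note * = has_field_derivative_integral_holomorphic[OF this(2) meas holomorphic_on_subset[OF holo sub] bound B this(1)]
    show "(\<lambda>x. deriv (h x) c) \<in> borel_measurable M" by (rule *(1)) (use sub in blast)+
    show "(G has_field_derivative (LINT x|M. deriv (h x) c)) (at c)"
      unfolding G_def by (rule *(2)) (use sub in blast)+
  qed
  have G1: "G1 c = c * (LINT x|M. deriv (h x) c)" for c by (simp add: G1_def k_def)
  define r where "r = (R - norm c1) / 2"
  have r: "0 < r" using c1 by (simp add: r_def)
  have sub1: "ball c1 r \<subseteq> ball 0 R" using sub[of c1] r by (auto simp: r_def)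
  have kholo: "k x holomorphic_on ball 0 R" if "x \<in> space M" for x
    unfolding k_def by (intro holomorphic_intros holo that) auto
  have km: "(\<lambda>x. k x c) \<in> borel_measurable M" if "c \<in> ball 0 R" for c
    unfolding k_def using loc(1)[of c] that by simp
  \<comment> \<open>Cauchy's estimate is used twice on nested discs: on
    \<open>ball c1 (R - norm c1)\<close> to bound \<open>k\<close> on the concentric disc of half
    the radius \<open>r\<close>, then on that disc to bound the derivative of
    \<open>k\<close>.\<close>
  have kb: "norm (k x c) \<le> R * (4 * B x / (R - norm c1))" if x: "x \<in> space M" and c: "c \<in> ball c1 r" for x c
  proof -
    have "norm (deriv (h x) c) \<le> 4 * B x / (R - norm c1)"
    proof (rule norm_deriv_le_ball)
      show "h x holomorphic_on ball c1 (R - norm c1)" by (rule holomorphic_on_subset[OF holo[OF x] sub])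
      show "norm (h x w) \<le> B x" if "w \<in> ball c1 (R - norm c1)" for w using bound[OF x] sub that by blast
    qed (use c1 c in \<open>auto simp: r_def\<close>)
    moreover have "norm c \<le> R" using sub1 c by (auto simp: less_imp_le subset_iff)
    ultimately show ?thesis unfolding k_def norm_mult by (intro mult_mono) (auto intro: order_trans[OF norm_ge_zero])
  qed
  have Bk: "integrable M (\<lambda>x. R * (4 * B x / (R - norm c1)))" using B by auto
  have c1r: "c1 \<in> ball c1 (r / 2)" using r by simp
  note ** = has_field_derivative_integral_holomorphic[OF r km holomorphic_on_subset[OF kholo sub1] kb Bk c1r]
  have dkm: "(\<lambda>x. deriv (k x) c1) \<in> borel_measurable M" by (rule **(1)) (use sub1 in blast)+
  have G1': "(G1 has_field_derivative D1) (at c1)" unfolding D1_def G1_def by (rule **(2)) (use sub1 in blast)+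
  have dki: "integrable M (\<lambda>x. deriv (k x) c1)"
  proof (rule Bochner_Integration.integrable_bound[OF _ dkm])
    show "integrable M (\<lambda>x. 4 * (R * (4 * B x / (R - norm c1))) / r)" using B by auto
    show "AE x in M. norm (deriv (k x) c1) \<le> norm (4 * (R * (4 * B x / (R - norm c1))) / r)"
    proof (rule AE_I2)
      fix x assume x: "x \<in> space M"
      have "norm (deriv (k x) c1) \<le> 4 * (R * (4 * B x / (R - norm c1))) / r"
        by (rule norm_deriv_le_ball[OF holomorphic_on_subset[OF kholo[OF x] sub1] r kb[OF x] c1r])
      then show "norm (deriv (k x) c1) \<le> norm (4 * (R * (4 * B x / (R - norm c1))) / r)"
        unfolding real_norm_def by (rule order_trans[OF _ abs_ge_self])
    qed
  qed
  then show "integrable M (\<lambda>x. - (c1 * deriv (\<lambda>c. c * deriv (h x) c) c1))" unfolding kx by (intro Bochner_Integration.integrable_minus integrable_mult_right)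
  let ?p = "\<lambda>\<psi>. complex_of_real (norm c1) * cis \<psi>"
  have p: "norm (?p \<psi>) < R" for \<psi> using c1 by (simp add: norm_mult)
  have pc: "?p (Arg c1) = c1" using rcis_cmod_Arg[of c1] by (simp add: rcis_def)
  have "((\<lambda>\<psi>. G (?p \<psi>)) has_vector_derivative \<i> * G1 (?p \<psi>)) (at \<psi>)" for \<psi>
    unfolding G1 by (rule has_vector_derivative_polar[OF loc(2)[OF p]])
  then have d1: "((\<lambda>\<psi>. Re (G (?p \<psi>))) has_real_derivative Re (\<i> * G1 (?p \<psi>))) (at \<psi>)" for \<psi>
    unfolding has_real_derivative_iff_has_vector_derivative
    by (rule bounded_linear.has_vector_derivative[OF bounded_linear_Re])
  have "((\<lambda>\<psi>. \<i> * G1 (?p \<psi>)) has_vector_derivative \<i> * (\<i> * (?p (Arg c1) * D1))) (at (Arg c1))"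
    by (intro has_vector_derivative_mult_right has_vector_derivative_polar) (simp only: pc G1')
  then have "((\<lambda>\<psi>. \<i> * G1 (?p \<psi>)) has_vector_derivative - (c1 * D1)) (at (Arg c1))"
    unfolding pc by (simp add: mult.assoc[symmetric])
  then have d2: "((\<lambda>\<psi>. Re (\<i> * G1 (?p \<psi>))) has_real_derivative Re (- (c1 * D1))) (at (Arg c1))"
    unfolding has_real_derivative_iff_has_vector_derivative
    by (rule bounded_linear.has_vector_derivative[OF bounded_linear_Re])
  have "Re (G (?p \<psi>)) \<le> Re (G (?p (Arg c1)))" for \<psi>
    unfolding pc using max[of \<psi>] by (simp add: G_def)
  from second_derivative_nonpos_at_max[OF d1 d2 this] have "Re (- (c1 * D1)) \<le> 0" .
  moreover have "(LINT x|M. - (c1 * deriv (\<lambda>c. c * deriv (h x) c) c1)) = - (c1 * D1)"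
    unfolding D1_def kx by simp
  ultimately show "Re (LINT x|M. - (c1 * deriv (\<lambda>c. c * deriv (h x) c) c1)) \<le> 0" by (simp only:)
qed

lemma polydisc_algebra_eqI:
  fixes F G :: "complex ^ 'n \<Rightarrow> complex"
  assumes F: "F \<in> polydisc_algebra" and G: "G \<in> polydisc_algebra"
    and eq: "\<And>z. z \<in> polydisc \<Longrightarrow> (\<forall>j. z $ j \<noteq> 0) \<Longrightarrow> F z = G z"
    and z: "z \<in> closed_polydisc"
  shows "F z = G z"
proof -
  have "\<forall>z\<in>closed_polydisc. (\<forall>j. j \<notin> S \<longrightarrow> z $ j \<in> ball 0 1 - {0}) \<longrightarrow> F z = G z" if "finite S" for S
    using that
  proof induction
    case empty
    then show ?case using eq by (auto simp: polydisc_def)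
  next
    case (insert i S)
    show ?case
    proof (intro ballI impI)
      fix z :: "complex ^ 'n" assume z: "z \<in> closed_polydisc" and zi: "\<forall>j. j \<notin> insert i S \<longrightarrow> z $ j \<in> ball 0 1 - {0}"
      define d where "d c = F (vec_upd z i c) - G (vec_upd z i c)" for c
      have dc: "continuous_on (cball 0 1) d"
        using F G z unfolding d_def polydisc_algebra_def disc_algebra_def by (auto intro!: continuous_intros)
      have d0: "d c = 0" if "c \<in> ball 0 1 - {0}" for c
      proof -
        have "vec_upd z i c \<in> closed_polydisc" using that by (intro vec_upd_closed_polydisc[OF z]) auto
        moreover have "\<forall>j. j \<notin> S \<longrightarrow> vec_upd z i c $ j \<in> ball 0 1 - {0}"
          using zi that by (auto simp: vec_upd_nth)
        ultimately show ?thesis using insert.IH by (simp add: d_def)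
      qed
      define c where "c = z $ i"
      have c: "norm c \<le> 1" using z by (simp add: c_def closed_polydisc_def)
      \<comment> \<open>A sequence in the punctured open disc tending to \<open>c\<close>: along the
        reals if \<open>c = 0\<close>, radially otherwise. The shift by 2 keeps its terms nonzero
        and of modulus below 1 from \<open>n = 0\<close> on.\<close>
      define X where "X n = (if c = 0 then complex_of_real (1 / real (n + 2)) else complex_of_real (1 - 1 / real (n + 2)) * c)" for n
      have i0: "(\<lambda>n. 1 / real (n + 2)) \<longlonglongrightarrow> 0"
        using LIMSEQ_ignore_initial_segment[OF lim_1_over_n, of 2] by simp
      have "X \<longlonglongrightarrow> c"
      proof (cases "c = 0")
        case True
        then have "X = (\<lambda>n. complex_of_real (1 / real (n + 2)))" by (simp add: X_def fun_eq_iff)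
        then show ?thesis using tendsto_of_real[OF i0, where 'a=complex] True by (simp only: of_real_0)
      next
        case False
        have "(\<lambda>n. complex_of_real (1 - 1 / real (n + 2)) * c) \<longlonglongrightarrow> complex_of_real (1 - 0) * c"
          by (intro tendsto_intros i0)
        moreover have "X = (\<lambda>n. complex_of_real (1 - 1 / real (n + 2)) * c)" using False by (simp add: X_def fun_eq_iff)
        ultimately show ?thesis by (simp only: diff_zero of_real_1 mult_1_left)
      qed
      moreover have X: "X n \<in> ball 0 1 - {0}" for n
      proof (cases "c = 0")
        case False
        have "norm (X n) = (1 - 1 / real (n + 2)) * norm c" using False by (simp add: X_def norm_mult del: of_real_diff)
        also have "\<dots> \<le> (1 - 1 / real (n + 2)) * 1" using c by (intro mult_left_mono) auto
        also have "\<dots> < 1" by simp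
        finally have "norm (X n) < 1" .
        moreover have "1 - 1 / real (n + 2) \<noteq> 0" by (simp add: field_simps)
        then have "X n \<noteq> 0" using False by (simp add: X_def del: of_real_diff)
        ultimately show ?thesis by simp
      next
        case True
        then have "X n = complex_of_real (1 / real (n + 2))" unfolding X_def by (rule if_P)
        then have "norm (X n) = 1 / real (n + 2)" by (simp only: norm_of_real) simp
        then have "norm (X n) < 1" "norm (X n) \<noteq> 0" by auto
        then show ?thesis by simp
      qed
      ultimately have "(\<lambda>n. d (X n)) \<longlonglongrightarrow> d c"
        using c by (intro continuous_on_tendsto_compose[OF dc]) (auto simp: less_imp_le)
      then have "d c = 0" using d0[OF X] by (simp add: LIMSEQ_const_iff)
      then show "F z = G z" by (simp add: d_def c_def vec_upd_same)
    qed
  qed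
  from this[of UNIV] show ?thesis using z by simp
qed

section \<open>Regularity and linearity of solutions\<close>

lemma cauchy_solution_continuous:
  assumes "cauchy_solution b \<nu> f u" "z \<in> polydisc"
  shows "continuous_on {0..} (u z)"
proof -
  have c: "continuous_on (polydisc \<times> {0..}) (\<lambda>(z, t). u z t)"
    using assms(1) unfolding cauchy_solution_def by blast
  have "continuous_on {0..} (\<lambda>t. (\<lambda>(z, t). u z t) (z, t))"
    by (rule continuous_on_compose2[OF c]) (use assms(2) in \<open>auto intro!: continuous_intros\<close>)
  then show ?thesis by simp
qed

lemma cauchy_solution_holomorphic:
  assumes "cauchy_solution b \<nu> f u" "0 < t" "z \<in> closed_polydisc"
  shows "(\<lambda>c. u (vec_upd z j c) t) holomorphic_on ball 0 1"
proof -
  have "(\<lambda>z. u z t) \<in> polydisc_algebra" using assms(1,2) unfolding cauchy_solution_def by blast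
  then show ?thesis using assms(3) by (simp add: polydisc_algebra_def disc_algebra_def analytic_on_open)
qed

text \<open>\<open>vector_derivative\<close> is linear only where the derivatives exist, so the
  argument goes through the explicit derivatives supplied by
  \<open>angular_deriv2_eq\<close>.\<close>

lemma angular_deriv2_diff:
  fixes F G :: "complex ^ 'n \<Rightarrow> complex"
  assumes z: "norm (z $ j) < 1"
    and F: "(\<lambda>c. F (vec_upd z j c)) holomorphic_on ball 0 1" and G: "(\<lambda>c. G (vec_upd z j c)) holomorphic_on ball 0 1"
  shows "angular_deriv2 j (\<lambda>\<zeta>. \<kappa> * (F \<zeta> - G \<zeta>)) z = \<kappa> * (angular_deriv2 j F z - angular_deriv2 j G z)"
proof -
  note * = has_vector_derivative_mult_right[OF has_vector_derivative_diff]
  note 1 = *[OF angular_deriv2_eq(1)[of z j F, OF z F] angular_deriv2_eq(1)[of z j G, OF z G], of \<kappa>]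
  note 2 = *[OF angular_deriv2_eq(2)[of z j F, OF z F] angular_deriv2_eq(2)[of z j G, OF z G], of \<kappa>]
  show ?thesis
    unfolding angular_deriv2_eq(3)[of z j F, OF z F] angular_deriv2_eq(3)[of z j G, OF z G]
    unfolding angular_deriv2_def vector_derivative_at[OF 1] vector_derivative_at[OF 2] ..
qed

context infinite_levy_measure
begin

text \<open>The maximum principle speaks about real parts; the free factor \<open>\<kappa>\<close>
  will be taken from 1, -1, \<open>\<i>\<close> and \<open>- \<i>\<close> to control both parts of
  the complex difference from both sides.\<close>

lemma cauchy_solution_diff:
  fixes u v :: "complex ^ 'n \<Rightarrow> real \<Rightarrow> complex"
  assumes u: "cauchy_solution b \<nu> f u" and v: "cauchy_solution b \<nu> f v"
  shows "cauchy_solution b \<nu> (\<lambda>_. 0) (\<lambda>z t. \<kappa> * (u z t - v z t))"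
  unfolding cauchy_solution_def
proof (intro conjI allI ballI impI)
  show "(\<lambda>z. \<kappa> * (u z t - v z t)) \<in> polydisc_algebra" if "0 < t" for t
    using u v that unfolding cauchy_solution_def polydisc_algebra_def disc_algebra_def
    by (auto intro!: analytic_intros continuous_intros)
  show "continuous_on (polydisc \<times> {0..}) (\<lambda>(z, t). \<kappa> * (u z t - v z t))"
    using u v unfolding cauchy_solution_def case_prod_beta' by (auto intro!: continuous_intros)
  show "\<kappa> * (u z 0 - v z 0) = 0" if "z \<in> closed_polydisc" for z
    using u v that by (auto simp: cauchy_solution_def)
next
  fix t :: real and z :: "complex ^ 'n"
  assume t: "0 < t" and z: "z \<in> polydisc" and z0: "\<forall>j. z $ j \<noteq> 0"
  define \<Phi> where "\<Phi> u \<tau> = b *\<^sub>R (u \<tau> - u 0) + (LBINT s:{0<..<\<tau>}. levy_tail \<nu> (\<tau> - s) *\<^sub>R (u s - u 0))" for u :: "real \<Rightarrow> complex" and \<tau>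
  have zj: "norm (z $ j) < 1" for j using z by (simp add: polydisc_def)
  have zc: "z \<in> closed_polydisc" using z polydisc_subset by blast
  have i: "set_integrable lborel {0<..<\<tau>} (\<lambda>s. levy_tail \<nu> (\<tau> - s) *\<^sub>R (w z s - w z 0))" if w: "cauchy_solution b \<nu> f w" for w \<tau>
    by (intro set_integrable_convolution continuous_intros continuous_on_subset[OF cauchy_solution_continuous[OF w z]]) auto
  have eq: "\<Phi> (\<lambda>t. \<kappa> * (u z t - v z t)) \<tau> = \<kappa> * (\<Phi> (u z) \<tau> - \<Phi> (v z) \<tau>)" for \<tau>
  proof -
    have "(LBINT s:{0<..<\<tau>}. levy_tail \<nu> (\<tau> - s) *\<^sub>R (\<kappa> * (u z s - v z s) - \<kappa> * (u z 0 - v z 0)))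
      = (LBINT s:{0<..<\<tau>}. \<kappa> * (levy_tail \<nu> (\<tau> - s) *\<^sub>R (u z s - u z 0) - levy_tail \<nu> (\<tau> - s) *\<^sub>R (v z s - v z 0)))"
      by (simp add: algebra_simps scaleR_conv_of_real)
    also have "\<dots> = \<kappa> * ((LBINT s:{0<..<\<tau>}. levy_tail \<nu> (\<tau> - s) *\<^sub>R (u z s - u z 0)) - (LBINT s:{0<..<\<tau>}. levy_tail \<nu> (\<tau> - s) *\<^sub>R (v z s - v z 0)))"
      by (simp add: set_integral_diff(2)[OF i[OF u] i[OF v]])
    finally show ?thesis by (simp add: \<Phi>_def algebra_simps)
  qed
  have "(\<Phi> (w z) has_vector_derivative (1 / 2 * (\<Sum>j\<in>UNIV. angular_deriv2 j (\<lambda>\<zeta>. w \<zeta> t) z))) (at t)" if w: "cauchy_solution b \<nu> f w" for w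
    using w t z z0 unfolding cauchy_solution_def has_generalized_derivative_def \<Phi>_def by blast
  from has_vector_derivative_mult_right[OF has_vector_derivative_diff[OF this[OF u] this[OF v]], of \<kappa>]
  have "(\<Phi> (\<lambda>t. \<kappa> * (u z t - v z t)) has_vector_derivative
    \<kappa> * (1 / 2 * (\<Sum>j\<in>UNIV. angular_deriv2 j (\<lambda>\<zeta>. u \<zeta> t) z) - 1 / 2 * (\<Sum>j\<in>UNIV. angular_deriv2 j (\<lambda>\<zeta>. v \<zeta> t) z))) (at t)"
    unfolding eq[abs_def] .
  also have "\<kappa> * (1 / 2 * (\<Sum>j\<in>UNIV. angular_deriv2 j (\<lambda>\<zeta>. u \<zeta> t) z) - 1 / 2 * (\<Sum>j\<in>UNIV. angular_deriv2 j (\<lambda>\<zeta>. v \<zeta> t) z))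
    = 1 / 2 * (\<Sum>j\<in>UNIV. angular_deriv2 j (\<lambda>\<zeta>. \<kappa> * (u \<zeta> t - v \<zeta> t)) z)"
    by (simp only: angular_deriv2_diff[OF zj cauchy_solution_holomorphic[OF u t zc] cauchy_solution_holomorphic[OF v t zc]]
        sum_subtractf sum_distrib_left[symmetric]) (simp add: right_diff_distrib)
  finally show "has_generalized_derivative b \<nu> (\<lambda>t. \<kappa> * (u z t - v z t))
      (1 / 2 * (\<Sum>j\<in>UNIV. angular_deriv2 j (\<lambda>\<zeta>. \<kappa> * (u \<zeta> t - v \<zeta> t)) z)) t"
    unfolding has_generalized_derivative_def \<Phi>_def .
qed

text \<open>Maximum principle for the time integral of a solution over a torus times \<open>[0, T]\<close>: at the
  earliest point where a positive maximum is attained, the nonlocal time derivative is strictly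
  positive, being an integral of increments, while all second angular derivatives are \<open>\<le> 0\<close>.\<close>

lemma cauchy_solution_zero_nonpos:
  fixes e :: "complex ^ 'n \<Rightarrow> real \<Rightarrow> complex"
  assumes b: "0 \<le> b" and e: "cauchy_solution b \<nu> (\<lambda>_. 0) e"
    and z: "z \<in> polydisc" and z0: "\<forall>j. z $ j \<noteq> 0" and T: "0 \<le> T"
  shows "(LBINT s:{0<..<T}. Re (e z s)) \<le> 0"
proof (rule ccontr)
  \<comment> \<open>The torus through \<open>z\<close> stays where the equation holds, because no
    modulus is 0, and it is invariant under rotating any single coordinate, so a maximum over it is
    a maximum in each angle.\<close>
  define K where "K = {w :: complex ^ 'n. \<forall>j. norm (w $ j) = norm (z $ j)}"
  define F where "F = (\<lambda>(w, t). LBINT s:{0<..<t}. Re (e w s))"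
  assume "\<not> ?thesis"
  then have Fz: "0 < F (z, T)" by (simp add: F_def)
  have zK: "z \<in> K" by (simp add: K_def)
  have Kp: "w \<in> polydisc" "w \<in> closed_polydisc" "\<forall>j. w $ j \<noteq> 0" if "w \<in> K" for w
  proof -
    have n: "norm (w $ j) = norm (z $ j)" for j using that by (simp add: K_def)
    show "w \<in> polydisc" using z n by (simp add: polydisc_def)
    then show "w \<in> closed_polydisc" using polydisc_subset by blast
    show "\<forall>j. w $ j \<noteq> 0" using n z0 by (metis norm_eq_zero)
  qed
  have e0: "e w 0 = 0" if "w \<in> closed_polydisc" for w using e that by (simp add: cauchy_solution_def)
  have ec: "continuous_on {0..} (e w)" if "w \<in> K" for w by (rule cauchy_solution_continuous[OF e Kp(1)[OF that]])
  have yc: "continuous_on {0..} (\<lambda>s. Re (e w s))" if "w \<in> K" for w by (intro continuous_intros ec that)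
  have compK: "compact K"
  proof -
    have "closed K" unfolding K_def Collect_all_eq by (intro closed_INT ballI closed_Collect_eq continuous_intros)
    moreover have "bounded K" unfolding bounded_iff
      by (rule exI[of _ "norm z"]) (auto simp: K_def norm_vec_def)
    ultimately show ?thesis by (simp add: compact_eq_bounded_closed)
  qed
  define C where "C = K \<times> {0..T}"
  have C: "compact C" unfolding C_def by (intro compact_Times compK) auto
  have ejc: "continuous_on C (\<lambda>p. e (fst p) (snd p))"
    using e unfolding cauchy_solution_def case_prod_beta'
    by (auto intro: continuous_on_subset simp: C_def dest: Kp(1))
  obtain B where B: "\<And>w s. w \<in> K \<Longrightarrow> 0 \<le> s \<Longrightarrow> s \<le> T \<Longrightarrow> norm (e w s) \<le> B"
    using compact_imp_bounded[OF compact_continuous_image[OF ejc C]] unfolding bounded_iff C_def by force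
  have Fc: "continuous_on C F"
  proof (rule continuous_on_sequentiallyI)
    fix X :: "nat \<Rightarrow> (complex ^ 'n) \<times> real" and p
    assume XC: "\<forall>n. X n \<in> C" and pC: "p \<in> C" and X: "X \<longlonglongrightarrow> p"
    have Fi: "F q = (LINT s|lborel. indicator {0<..<snd q} s *\<^sub>R Re (e (fst q) s))" for q
      by (simp add: F_def case_prod_beta' set_lebesgue_integral_def)
    have m: "(\<lambda>s. indicator {0<..<snd q} s *\<^sub>R Re (e (fst q) s)) \<in> borel_measurable lborel" if "q \<in> C" for q
      using set_integral_Ioo_eq_integral(1)[OF continuous_on_subset[OF yc], of "fst q" "snd q"] that
      by (auto simp: C_def set_integrable_def)
    show "(\<lambda>n. F (X n)) \<longlonglongrightarrow> F p" unfolding Fi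
    proof (rule integral_dominated_convergence[OF m[OF pC] m, where w="\<lambda>s. indicator {0<..<T} s *\<^sub>R B"])
      show "integrable lborel (\<lambda>s. indicator {0<..<T} s *\<^sub>R B)"
        using set_integral_Ioo_eq_integral(1)[of T "\<lambda>_. B"] by (simp add: set_integrable_def)
      show "AE s in lborel. norm (indicator {0<..<snd (X n)} s *\<^sub>R Re (e (fst (X n)) s)) \<le> indicator {0<..<T} s *\<^sub>R B" for n
      proof (rule AE_I2)
        fix s :: real
        have Xn: "fst (X n) \<in> K" "snd (X n) \<le> T" using XC[rule_format, of n] by (auto simp: C_def mem_Times_iff)
        have "\<bar>Re (e (fst (X n)) s)\<bar> \<le> B" if "0 < s" "s < snd (X n)"
          using B[OF Xn(1), of s] that Xn(2) abs_Re_le_cmod[of "e (fst (X n)) s"] by linarith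
        moreover have "0 \<le> B" if "0 < s" "s < T"
          using B[OF Xn(1), of s] that norm_ge_zero[of "e (fst (X n)) s"] by linarith
        ultimately show "norm (indicator {0<..<snd (X n)} s *\<^sub>R Re (e (fst (X n)) s)) \<le> indicator {0<..<T} s *\<^sub>R B"
          using Xn(2) by (auto simp: indicator_def)
      qed
      \<comment> \<open>At the limiting endpoint \<open>s = snd p\<close> the indicators may
        oscillate; everywhere else they are eventually constant.\<close>
      show "AE s in lborel. (\<lambda>n. indicator {0<..<snd (X n)} s *\<^sub>R Re (e (fst (X n)) s)) \<longlonglongrightarrow> indicator {0<..<snd p} s *\<^sub>R Re (e (fst p) s)"
        using AE_lborel_singleton[of "snd p"]
      proof eventually_elim
        case (elim s)
        have X2: "(\<lambda>n. snd (X n)) \<longlonglongrightarrow> snd p" and X1: "(\<lambda>n. fst (X n)) \<longlonglongrightarrow> fst p"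
          using X by (auto intro: tendsto_intros)
        show ?case
        proof (cases "0 < s \<and> s < snd p")
          case True
          have ev: "eventually (\<lambda>n. s < snd (X n)) sequentially" using X2 True by (intro order_tendstoD(1)) auto
          have "(\<lambda>n. (fst (X n), s)) \<longlonglongrightarrow> (fst p, s)" by (intro tendsto_intros X1)
          then have "(\<lambda>n. e (fst (fst (X n), s)) (snd (fst (X n), s))) \<longlonglongrightarrow> e (fst (fst p, s)) (snd (fst p, s))"
            by (rule continuous_on_tendsto_compose[OF ejc])
              (use XC pC True in \<open>auto simp: C_def mem_Times_iff\<close>)
          then have "(\<lambda>n. Re (e (fst (X n)) s)) \<longlonglongrightarrow> Re (e (fst p) s)" by (intro tendsto_Re) simp
          then show ?thesis using True
            by (rule_tac Lim_transform_eventually) (auto intro!: eventually_mono[OF ev])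
        next
          case False
          have "eventually (\<lambda>n. s \<notin> {0<..<snd (X n)}) sequentially"
          proof (cases "0 < s")
            case True
            then have "snd p < s" using False elim by auto
            from order_tendstoD(2)[OF X2 this] show ?thesis by eventually_elim auto
          qed auto
          then have "eventually (\<lambda>n. indicator {0<..<snd (X n)} s *\<^sub>R Re (e (fst (X n)) s) = 0) sequentially"
            by eventually_elim auto
          from tendsto_eventually[OF this] show ?thesis using False by simp
        qed
      qed
    qed (use XC in auto)
  qed
  have "C \<noteq> {}" using zK T by (auto simp: C_def)
  obtain p where p: "p \<in> C" "\<And>q. q \<in> C \<Longrightarrow> F q \<le> F p"
    using continuous_attains_sup[OF C \<open>C \<noteq> {}\<close> Fc] by blast
  have Fp: "0 < F p" using p(2)[of "(z, T)"] Fz zK T by (auto simp: C_def)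
  \<comment> \<open>The set of maximisers is compact, so one of them has the least time. At its
    point \<open>w\<close> all earlier times then give strictly smaller values, which makes the
    increments in \<open>y2\<close> positive.\<close>
  define S where "S = {q \<in> C. F q = F p}"
  have cS: "compact S"
  proof -
    have "closed S" unfolding S_def by (rule continuous_closed_preimage_constant[OF Fc compact_imp_closed[OF C]])
    then have "compact (S \<inter> C)" by (rule closed_Int_compact[OF _ C])
    also have "S \<inter> C = S" by (auto simp: S_def)
    finally show ?thesis .
  qed
  have "p \<in> S" using p(1) by (simp add: S_def)
  then have "S \<noteq> {}" by blast
  then obtain q where q: "q \<in> S" "\<And>q'. q' \<in> S \<Longrightarrow> snd q \<le> snd q'"
    using continuous_attains_inf[OF cS _ continuous_on_snd[OF continuous_on_id]] by blast
  define w t where "w = fst q" and "t = snd q"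
  have w: "w \<in> K" and t: "0 \<le> t" "t \<le> T" and Fwt: "F (w, t) = F p"
    using q(1) by (auto simp: S_def C_def w_def t_def)
  have t0: "0 < t" using t Fwt Fp by (cases "t = 0") (auto simp: F_def set_lebesgue_integral_def)
  have less: "F (w, s) < F (w, t)" if "0 \<le> s" "s < t" for s
  proof -
    have "(w, s) \<in> C" using that t w by (simp add: C_def)
    moreover have "(w, s) \<notin> S" using q(2)[of "(w, s)"] that by (auto simp: t_def)
    ultimately show ?thesis using p(2)[of "(w, s)"] Fwt by (auto simp: S_def less_le)
  qed
  define y where "y s = Re (e w s)" for s
  have FY: "F (w, s) = (LBINT u:{0<..<s}. y u)" for s by (simp add: F_def y_def)
  have ycont: "continuous_on {0..} y" unfolding y_def by (rule yc[OF w])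
  \<comment> \<open>\<open>y t\<close> is the time derivative of the primitive at its first maximum
    along \<open>w\<close>: if it were negative, slightly earlier values would be larger. This
    settles the sign of the drift term.\<close>
  have y1: "0 \<le> y t"
  proof (rule ccontr)
    assume "\<not> 0 \<le> y t"
    then have neg: "y t < 0" by simp
    have "((\<lambda>s. F (w, s)) has_real_derivative y t) (at t)"
      unfolding FY has_real_derivative_iff_has_vector_derivative
      by (rule has_vector_derivative_set_integral_Ioo[OF ycont t0])
    from DERIV_neg_dec_left[OF this neg] obtain d where d: "0 < d" "\<And>h. 0 < h \<Longrightarrow> h < d \<Longrightarrow> F (w, t) < F (w, t - h)"
      by blast
    define h where "h = min (d / 2) (t / 2)"
    have h: "0 < h" "h < d" "h < t" using d(1) t0 by (auto simp: h_def)
    show False using d(2)[OF h(1,2)] less[of "t - h"] h by simp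
  qed
  have y2: "0 < (LBINT s:{0<..<t}. levy_tail \<nu> (t - s) * y s)"
    unfolding convolution_eq_increments(2)[OF ycont t0]
  proof (rule nu_integral_pos[OF convolution_eq_increments(1)[OF ycont t0]])
    fix r :: real assume "0 < r"
    then show "0 < (LBINT u:{0<..<t}. y u) - (LBINT u:{0<..<max (t - r) 0}. y u)"
      using less[of "max (t - r) 0"] t0 by (simp add: FY)
  qed
  \<comment> \<open>The time integral up to \<open>t\<close> has its maximal real part over the
    circle of the \<open>j\<close>-th coordinate at \<open>w $ j\<close>, so the preceding result on
    integrals of holomorphic functions applies, with \<open>R\<close> between \<open>norm c1\<close>
    and 1 to leave room for a uniform bound.\<close>
  have ang: "set_integrable lborel {0<..<t} (\<lambda>s. angular_deriv2 j (\<lambda>\<zeta>. e \<zeta> s) w) \<and>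
    Re (LBINT s:{0<..<t}. angular_deriv2 j (\<lambda>\<zeta>. e \<zeta> s) w) \<le> 0" for j
  proof -
    define c1 where "c1 = w $ j"
    have c11: "norm c1 < 1" using Kp(1)[OF w] by (simp add: polydisc_def c1_def)
    define R where "R = (1 + norm c1) / 2"
    have R: "norm c1 < R" "R < 1" using c11 by (auto simp: R_def)
    define h where "h s c = indicator {0<..<t} s *\<^sub>R e (vec_upd w j c) s" for s c
    have cont2: "continuous_on (cball 0 R \<times> {0..t}) (\<lambda>p. e (vec_upd w j (fst p)) (snd p))"
    proof -
      have "continuous_on (cball 0 R \<times> {0..t}) (\<lambda>p. (\<lambda>(z, t). e z t) (vec_upd w j (fst p), snd p))"
      proof (rule continuous_on_compose2[where g="\<lambda>(z, t). e z t" and f="\<lambda>p. (vec_upd w j (fst p), snd p)"])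
        show "continuous_on (polydisc \<times> {0..}) (\<lambda>(z, t). e z t)" using e by (simp add: cauchy_solution_def)
        have "continuous_on A (\<lambda>p. vec_upd w j (fst p))" for A :: "(complex \<times> real) set"
          unfolding vec_upd_def
        proof (rule continuous_on_vec_lambda)
          show "continuous_on A (\<lambda>p. if i = j then fst p else w $ i)" for i
            by (cases "i = j") (auto intro!: continuous_intros)
        qed
        then show "continuous_on (cball 0 R \<times> {0..t}) (\<lambda>p. (vec_upd w j (fst p), snd p))"
          by (intro continuous_intros)
        show "(\<lambda>p. (vec_upd w j (fst p), snd p)) ` (cball 0 R \<times> {0..t}) \<subseteq> polydisc \<times> {0..}"
          using R by (auto intro!: vec_upd_polydisc Kp(1)[OF w])
      qed
      then show ?thesis by simp
    qed
    have "compact (cball (0::complex) R \<times> {0..t})" by (intro compact_Times) auto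
    from compact_imp_bounded[OF compact_continuous_image[OF cont2 this]]
    obtain B where B: "\<And>c s. c \<in> cball 0 R \<Longrightarrow> s \<in> {0..t} \<Longrightarrow> norm (e (vec_upd w j c) s) \<le> B"
      unfolding bounded_iff by force
    have upd: "vec_upd w j c \<in> polydisc" if "c \<in> ball 0 R" for c
      using that R by (intro vec_upd_polydisc Kp(1)[OF w]) auto
    have hi: "integrable lborel (\<lambda>s. h s c)" if "c \<in> ball 0 R" for c
      using set_integral_Ioo_eq_integral(1)[OF continuous_on_subset[OF cauchy_solution_continuous[OF e upd[OF that]]], of t]
      by (simp add: h_def set_integrable_def)
    have Re_int: "Re (LINT s|lborel. h s c) = F (vec_upd w j c, t)" if "c \<in> ball 0 R" for c
    proof -
      have "Re (LINT s|lborel. h s c) = (LINT s|lborel. Re (h s c))" using hi[OF that] by simp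
      then show ?thesis by (simp add: F_def h_def set_lebesgue_integral_def)
    qed
    have *: "norm c1 < R" "\<And>s. s \<in> space lborel \<Longrightarrow> h s holomorphic_on ball 0 R"
      "\<And>c. c \<in> ball 0 R \<Longrightarrow> (\<lambda>s. h s c) \<in> borel_measurable lborel"
      "\<And>s c. s \<in> space lborel \<Longrightarrow> c \<in> ball 0 R \<Longrightarrow> norm (h s c) \<le> indicator {0<..<t} s *\<^sub>R B"
      "integrable lborel (\<lambda>s. indicator {0<..<t} s *\<^sub>R B)"
      "\<And>\<psi>. Re (LINT s|lborel. h s (complex_of_real (norm c1) * cis \<psi>)) \<le> Re (LINT s|lborel. h s c1)"
    proof -
      show "h s holomorphic_on ball 0 R" for s
      proof (cases "s \<in> {0<..<t}")
        case True
        then have "(\<lambda>c. e (vec_upd w j c) s) holomorphic_on ball 0 R"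
          using R by (intro holomorphic_on_subset[OF cauchy_solution_holomorphic[OF e _ Kp(2)[OF w]]]) auto
        then show ?thesis using True by (simp add: h_def[abs_def])
      qed (simp add: h_def[abs_def])
      show "(\<lambda>s. h s c) \<in> borel_measurable lborel" if "c \<in> ball 0 R" for c using hi[OF that] by simp
      show "norm (h s c) \<le> indicator {0<..<t} s *\<^sub>R B" if "c \<in> ball 0 R" for s c
        using B[of c s] that by (auto simp: h_def indicator_def)
      show "integrable lborel (\<lambda>s. indicator {0<..<t} s *\<^sub>R B)"
        using set_integral_Ioo_eq_integral(1)[of t "\<lambda>_. B"] by (simp add: set_integrable_def)
      show "Re (LINT s|lborel. h s (complex_of_real (norm c1) * cis \<psi>)) \<le> Re (LINT s|lborel. h s c1)" for \<psi>
      proof -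
        let ?c = "complex_of_real (norm c1) * cis \<psi>"
        have "vec_upd w j ?c \<in> K" using w by (auto simp: K_def vec_upd_nth norm_mult c1_def)
        then have "F (vec_upd w j ?c, t) \<le> F (w, t)" using p(2)[of "(vec_upd w j ?c, t)"] t Fwt by (simp add: C_def)
        moreover have "?c \<in> ball 0 R" "c1 \<in> ball 0 R" using R by (auto simp: norm_mult)
        ultimately show ?thesis using Re_int[of ?c] Re_int[of c1] by (simp add: c1_def vec_upd_same)
      qed
    qed (rule R)
    have ang_eq: "- (c1 * deriv (\<lambda>c. c * deriv (h s) c) c1) = indicator {0<..<t} s *\<^sub>R angular_deriv2 j (\<lambda>\<zeta>. e \<zeta> s) w" for s
    proof (cases "s \<in> {0<..<t}")
      case True
      then have "h s = (\<lambda>c. e (vec_upd w j c) s)" by (simp add: h_def[abs_def])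
      then show ?thesis
        using True angular_deriv2_eq(3)[of w j "\<lambda>\<zeta>. e \<zeta> s"] cauchy_solution_holomorphic[OF e _ Kp(2)[OF w], of s j] c11
        by (simp add: c1_def)
    next
      case False
      then have "h s = (\<lambda>_. 0)" by (simp add: h_def[abs_def])
      then show ?thesis using False by simp
    qed
    show ?thesis
      using integrable_angular_deriv2[OF *] integral_angular_deriv2_nonpos[OF *]
      unfolding ang_eq set_integrable_def set_lebesgue_integral_def by blast
  qed
  define D where "D s = 1 / 2 * (\<Sum>j\<in>UNIV. angular_deriv2 j (\<lambda>\<zeta>. e \<zeta> s) w)" for s
  define \<Phi> where "\<Phi> \<tau> = b *\<^sub>R (e w \<tau> - e w 0) + (LBINT s:{0<..<\<tau>}. levy_tail \<nu> (\<tau> - s) *\<^sub>R (e w s - e w 0))" for \<tau>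
  have \<Phi>': "(\<Phi> has_vector_derivative D \<tau>) (at \<tau>)" if "0 < \<tau>" for \<tau>
    using e that Kp[OF w] unfolding cauchy_solution_def has_generalized_derivative_def \<Phi>_def D_def by blast
  have \<Phi>c: "continuous_on {0..} \<Phi>"
    unfolding \<Phi>_def by (intro continuous_intros ec[OF w] continuous_on_convolution) auto
  let ?A = "\<lambda>j s. indicator {0<..<t} s *\<^sub>R angular_deriv2 j (\<lambda>\<zeta>. e \<zeta> s) w"
  have Ai: "integrable lborel (?A j)" for j using ang[of j] by (simp only: set_integrable_def)
  have DA: "indicator {0<..<t} s *\<^sub>R D s = 1 / 2 * (\<Sum>j\<in>UNIV. ?A j s)" for s
    by (cases "s \<in> {0<..<t}") (simp_all add: D_def)
  have Di: "set_integrable lborel {0<..<t} D"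
    unfolding set_integrable_def DA by (intro integrable_mult_right Bochner_Integration.integrable_sum Ai)
  have DI: "(LBINT s:{0<..<t}. D s) = 1 / 2 * (\<Sum>j\<in>UNIV. (LBINT s:{0<..<t}. angular_deriv2 j (\<lambda>\<zeta>. e \<zeta> s) w))"
    unfolding set_lebesgue_integral_def DA Bochner_Integration.integral_mult_right_zero
    by (subst Bochner_Integration.integral_sum) (rule Ai, rule refl)
  \<comment> \<open>\<open>D\<close> is known to be the derivative of \<open>\<Phi>\<close> only at
    positive times, so the fundamental theorem is used with continuity at the end points and
    derivatives in the interior. The integrability from \<open>ang\<close> then identifies the gauge
    integral with the Lebesgue integral.\<close>
  have "(D has_integral (\<Phi> t - \<Phi> 0)) {0..t}"
    using \<Phi>' continuous_on_subset[OF \<Phi>c] t by (intro fundamental_theorem_of_calculus_interior) auto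
  then have "\<Phi> t - \<Phi> 0 = integral {0..t} D" by (simp add: integral_unique)
  also have "\<dots> = (LBINT s:{0<..<t}. D s)"
    using set_borel_integral_eq_integral(2)[OF Di] integral_open_interval_real[of 0 t D] by simp
  finally have "Re (\<Phi> t) = Re (LBINT s:{0<..<t}. D s)" by (simp add: \<Phi>_def set_lebesgue_integral_def)
  also have "\<dots> = 1 / 2 * (\<Sum>j\<in>UNIV. Re (LBINT s:{0<..<t}. angular_deriv2 j (\<lambda>\<zeta>. e \<zeta> s) w))"
    unfolding DI by simp
  also have "\<dots> \<le> 0" using ang by (simp add: sum_nonpos)
  finally have "Re (\<Phi> t) \<le> 0" .
  moreover have "Re (\<Phi> t) = b * y t + (LBINT s:{0<..<t}. levy_tail \<nu> (t - s) * y s)"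
  proof -
    have "set_integrable lborel {0<..<t} (\<lambda>s. levy_tail \<nu> (t - s) *\<^sub>R (e w s - e w 0))"
      by (intro set_integrable_convolution continuous_intros continuous_on_subset[OF ec[OF w]]) auto
    then have "Re (LBINT s:{0<..<t}. levy_tail \<nu> (t - s) *\<^sub>R (e w s - e w 0)) = (LBINT s:{0<..<t}. levy_tail \<nu> (t - s) * y s)"
      unfolding set_integrable_def set_lebesgue_integral_def by (subst integral_Re[symmetric]) (auto simp: y_def e0[OF Kp(2)[OF w]] mult.assoc)
    then show ?thesis by (simp add: \<Phi>_def y_def e0[OF Kp(2)[OF w]])
  qed
  ultimately show False using y1 y2 b mult_nonneg_nonneg[OF b y1] by linarith
qed

text \<open>With the four choices of \<open>\<kappa>\<close> the maximum principle forces every time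
  integral of the difference to vanish; differentiating in the upper limit gives equality at all
  points with nonzero coordinates, and \<open>polydisc_algebra_eqI\<close> extends it to the closed
  polydisc.\<close>

lemma cauchy_solution_unique:
  fixes u v :: "complex ^ 'n \<Rightarrow> real \<Rightarrow> complex"
  assumes b: "0 \<le> b" and u: "cauchy_solution b \<nu> f u" and v: "cauchy_solution b \<nu> f v"
    and t: "0 \<le> t" and z: "z \<in> closed_polydisc"
  shows "u z t = v z t"
proof (cases "t = 0")
  case True
  then show ?thesis using u v z by (simp add: cauchy_solution_def)
next
  case False
  with t have t0: "0 < t" by simp
  show ?thesis
  proof (rule polydisc_algebra_eqI[OF _ _ _ z])
    show "(\<lambda>z. u z t) \<in> polydisc_algebra" "(\<lambda>z. v z t) \<in> polydisc_algebra"
      using u v t0 by (auto simp: cauchy_solution_def)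
    fix z :: "complex ^ 'n" assume z: "z \<in> polydisc" "\<forall>j. z $ j \<noteq> 0"
    define D where "D s = u z s - v z s" for s
    have Dc: "continuous_on {0..} D"
      unfolding D_def by (intro continuous_intros cauchy_solution_continuous[OF u z(1)] cauchy_solution_continuous[OF v z(1)])
    have I0: "(LBINT s:{0<..<T}. D s) = 0" if T: "0 < T" for T
    proof -
      have i: "set_integrable lborel {0<..<T} D"
        by (rule set_integral_Ioo_eq_integral(1)[OF continuous_on_subset[OF Dc]]) auto
      have *: "Re (\<kappa> * (LBINT s:{0<..<T}. D s)) \<le> 0" for \<kappa>
      proof -
        have "(LBINT s:{0<..<T}. Re (\<kappa> * D s)) \<le> 0"
          using cauchy_solution_zero_nonpos[OF b cauchy_solution_diff[OF u v] z, of T \<kappa>] T by (simp add: D_def)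
        moreover have "set_integrable lborel {0<..<T} (\<lambda>s. \<kappa> * D s)" using i by simp
        then have "Re (LBINT s:{0<..<T}. \<kappa> * D s) = (LBINT s:{0<..<T}. Re (\<kappa> * D s))"
          unfolding set_integrable_def set_lebesgue_integral_def by (subst integral_Re[symmetric]) auto
        ultimately show ?thesis by simp
      qed
      show ?thesis using *[of 1] *[of "-1"] *[of \<i>] *[of "-\<i>"] by (intro complex_eqI) auto
    qed
    have "((\<lambda>T. LBINT s:{0<..<T}. D s) has_vector_derivative D t) (at t)"
      by (rule has_vector_derivative_set_integral_Ioo[OF Dc t0])
    moreover have "((\<lambda>T. LBINT s:{0<..<T}. D s) has_vector_derivative 0) (at t)"
      by (rule has_vector_derivative_transform_within_open[of "\<lambda>_. 0" _ _ "{0<..}"]) (use t0 I0 in auto)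
    ultimately have "D t = 0" by (rule vector_derivative_unique_at)
    then show "u z t = v z t" by (simp add: D_def)
  qed
qed

end

theorem theorem5p1:
  fixes M :: "'a measure"
    and b :: real and \<nu> :: "real measure"
    and H :: "real \<Rightarrow> 'a \<Rightarrow> real"
    and m :: "real \<Rightarrow> real \<Rightarrow> real"
    and f :: "complex ^ 'n \<Rightarrow> complex"
    and a :: "('n \<Rightarrow> nat) \<Rightarrow> complex"
  assumes b: "b \<ge> 0"
    and levy: "levy_measure \<nu>"
    and tail_ac: "abs_continuous_pos (levy_tail \<nu>)"
    and tail_inf: "filterlim (levy_tail \<nu>) at_top (at_right 0)"
    and sub: "subordinator M H (bernstein b \<nu>)"
    and m_nonneg: "\<And>s t. t > 0 \<Longrightarrow> m s t \<ge> 0"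
    and m_density: "\<And>t. t > 0 \<Longrightarrow>
          distributed M lborel (inverse_subordinator H t) (\<lambda>s. ennreal (m s t))"
    and f: "f \<in> polydisc_algebra"
    and expansion: "\<And>z. z \<in> polydisc \<Longrightarrow> ((\<lambda>k. a k * monomial z k) has_sum f z) UNIV"
  shows
    "(\<forall>z\<in>polydisc. \<forall>t>0.
       ((\<lambda>k. a k * monomial z k *
          complex_of_real
            (LINT \<omega>|M. exp (- (inverse_subordinator H t \<omega> / 2 * sum_squares k))))
        has_sum W_op m t f z) UNIV) \<and>
     (\<forall>z\<in>polydisc. \<forall>\<theta>>0.
       set_integrable lborel {0<..} (\<lambda>t. complex_of_real (exp (- (\<theta> * t))) * W_op m t f z) \<and>
       ((\<lambda>k. a k * monomial z k *
          complex_of_real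
            ((bernstein b \<nu> \<theta> / \<theta>) / (bernstein b \<nu> \<theta> + sum_squares k / 2)))
        has_sum (LBINT t:{0<..}. complex_of_real (exp (- (\<theta> * t))) * W_op m t f z)) UNIV) \<and>
     (bounded (f ` closed_polydisc) \<longrightarrow>
       cauchy_solution b \<nu> f (\<lambda>z t. W_op m t f z) \<and>
       (\<forall>v. cauchy_solution b \<nu> f v \<longrightarrow>
          (\<forall>t\<ge>0. \<forall>z\<in>closed_polydisc. v z t = W_op m t f z)))"
proof -
  interpret polydisc_expansion \<nu> M b H m f a
    by unfold_locales (fact levy tail_inf b sub m_nonneg m_density f expansion)+
  have d: "(LINT \<omega>|M. exp (- (inverse_subordinator H t \<omega> / 2 * sum_squares k))) = d (sum_squares k / 2) t"
    if "0 < t" for t and k :: "'n \<Rightarrow> nat"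
    using that by (simp add: d_def E0_def mult.commute)
  show ?thesis
  proof (intro conjI ballI allI impI)
    show "((\<lambda>k. a k * monomial z k *
          complex_of_real (LINT \<omega>|M. exp (- (inverse_subordinator H t \<omega> / 2 * sum_squares k))))
        has_sum W_op m t f z) UNIV" if "z \<in> polydisc" "0 < t" for z t
      unfolding d[OF that(2)] by (rule W_has_sum[OF that(1) less_imp_le[OF that(2)]])
    show "cauchy_solution b \<nu> f (\<lambda>z t. W_op m t f z)" if "bounded (f ` closed_polydisc)"
      by (rule cauchy_solution_W[OF that])
    show "v z t = W_op m t f z"
      if "bounded (f ` closed_polydisc)" "cauchy_solution b \<nu> f v" "0 \<le> t" "z \<in> closed_polydisc" for v t z
      by (rule cauchy_solution_unique[OF b that(2) cauchy_solution_W[OF that(1)] that(3,4)])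
  qed (rule laplace_W; assumption)+
qed

end
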